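(* Let $\mathcal A$ be a category with finite limits and colimits. Let $\underline{\mathsf{Cyl}}=(\mathsf{Cyl},i_0,i_1,p,v,\mathsf S,r_0,r_1,s,\Gamma_{ul},\Gamma_{lr},\Gamma_{ur})$ be a cylinder in $\mathcal A$ equipped with a contraction structure $p$, an involution structure $v$ compatible with $p$, a subdivision structure $(\mathsf S,r_0,r_1,s)$ compatible with $p$, an upper left connection structure $\Gamma_{ul}$, a lower right connection structure $\Gamma_{lr}$ compatible with $p$, and an upper right connection structure $\Gamma_{ur}$. Suppose that $\Gamma_{lr}$ and $\Gamma_{ur}$ are compatible with $(\mathsf S,r_0,r_1,s)$, that $\mathsf{Cyl}$ preserves mapping cylinders with respect to $\underline{\mathsf{Cyl}}$, and that $\underline{\mathsf{Cyl}}$ has strictness of identities. Let $\underline{\mathsf{coCyl}}=(\mathsf{coCyl},e_0,e_1,c,v',\mathsf S',r_0',r_1',s',\Gamma_{ul}',\Gamma_{lr}')$ be a co-cylinder in $\mathcal A$ equipped with a contraction structure $c$, an involution structure $v'$ compatible with $c$, a subdivision structure $(\mathsf S',r_0',r_1',s')$ compatible with $c$, an upper left connection structure $\Gamma_{ul}'$, and a lower right connection structure $\Gamma_{lr}'$ compatible with $c$. Suppose that $\mathsf{coCyl}$ preserves mapping co-cylinders with respect to $\underline{\mathsf{coCyl}}$, and that $\underline{\mathsf{coCyl}}$ has strictness of identities. Suppose moreover that $\underline{\mathsf{Cyl}}$ is left adjoint to $\underline{\mathsf{coCyl}}$, and that the adjunction between $\mathsf{Cyl}$ and $\mathsf{coCyl}$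 is compatible with $p$ and $c$. Then one obtains a model structure on $\mathcal A$ by taking: weak equivalences to be the homotopy equivalences with respect to $\underline{\mathsf{Cyl}}$ (equivalently, the homotopy equivalences with respect to $\underline{\mathsf{coCyl}}$); fibrations to be the normally cloven fibrations with respect to $\underline{\mathsf{coCyl}}$; cofibrations to be the cofibrations with respect to $\underline{\mathsf{Cyl}}$.
   Context: Notation: for a natural transformation $\eta$ between endofunctors of $\mathcal A$ and an endofunctor $F$, $\eta\cdot F$ has components $\eta(F(a))$ and $F\cdot\eta$ has components $F(\eta(a))$. A cylinder in $\mathcal A$ is a functor $\mathsf{Cyl}:\mathcal A\to\mathcal A$ with natural transformations $i_0,i_1:\mathrm{id}_{\mathcal A}\to\mathsf{Cyl}$. Structures on it (all natural transformations): - Contraction: $p:\mathsf{Cyl}\to\mathrm{id}_{\mathcal A}$ with $p i_0=p i_1=\mathrm{id}$. - Involution: $v:\mathsf{Cyl}\to\mathsf{Cyl}$ with $v i_0=i_1$, $v i_1=i_0$; compatible with $p$ if $pv=p$. - Subdivision: a functor $\mathsf S:\mathcal A\to\mathcal A$ and $r_0,r_1:\mathsf{Cyl}\to\mathsf S$ with $r_0i_0=r_1i_1$ such that this commutative square is a pushout (of $i_0$ and $i_1$) in the category of endofunctors of $\mathcal A$, and $s:\mathsf{Cyl}\to\mathsf S$ with $s i_0=r_1i_0$, $s i_1=r_0i_1$. It is compatible with $p$ if $\overline p s=p$, where $\overline p:\mathsf S\to\mathrm{id}_{\mathcal A}$ is the unique map with $\overline p r_0=\overline p r_1=p$. - Upper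 left connection: $\Gamma_{ul}:\mathsf{Cyl}^2\to\mathsf{Cyl}$ with $\Gamma_{ul}(i_0\cdot\mathsf{Cyl})=\Gamma_{ul}(\mathsf{Cyl}\cdot i_0)=\mathrm{id}$ and $\Gamma_{ul}(i_1\cdot\mathsf{Cyl})=\Gamma_{ul}(\mathsf{Cyl}\cdot i_1)=i_1p$. - Lower right connection: $\Gamma_{lr}:\mathsf{Cyl}^2\to\mathsf{Cyl}$ with $\Gamma_{lr}(i_1\cdot\mathsf{Cyl})=\Gamma_{lr}(\mathsf{Cyl}\cdot i_1)=\mathrm{id}$ and $\Gamma_{lr}(i_0\cdot\mathsf{Cyl})=\Gamma_{lr}(\mathsf{Cyl}\cdot i_0)=i_0p$; compatible with $p$ if $p\Gamma_{lr}=p(p\cdot\mathsf{Cyl})$. - Upper right connection: $\Gamma_{ur}:\mathsf{Cyl}^2\to\mathsf{Cyl}$ with $\Gamma_{ur}(i_0\cdot\mathsf{Cyl})=\mathrm{id}$, $\Gamma_{ur}(\mathsf{Cyl}\cdot i_1)=v$, $\Gamma_{ur}(\mathsf{Cyl}\cdot i_0)=\Gamma_{ur}(i_1\cdot\mathsf{Cyl})=i_0p$. - $\Gamma_{lr},\Gamma_{ur}$ are compatible with $(\mathsf S,r_0,r_1,s)$ if $x(s\cdot\mathsf{Cyl})=p\cdot\mathsf{Cyl}$, where $x:\mathsf S\circ\mathsf{Cyl}\to\mathsf{Cyl}$ is the unique map with $x(r_0\cdot\mathsf{Cyl})=\Gamma_{lr}$ and $x(r_1\cdot\mathsf{Cyl})=\Gamma_{ur}$.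 - Strictness of identities: $q_ls=\mathrm{id}$ and $q_rs=\mathrm{id}$, where $q_l,q_r:\mathsf S\to\mathsf{Cyl}$ are the unique maps with $q_lr_0=\mathrm{id}$, $q_lr_1=i_0p$ and $q_rr_0=i_1p$, $q_rr_1=\mathrm{id}$. A co-cylinder in $\mathcal A$ is a functor $\mathsf{coCyl}:\mathcal A\to\mathcal A$ with natural transformations $e_0,e_1:\mathsf{coCyl}\to\mathrm{id}_{\mathcal A}$; equivalently $(\mathsf{coCyl},e_0^{op},e_1^{op})$ is a cylinder in $\mathcal A^{op}$. Every structure or property of a co-cylinder is by definition the structure or property of the same name for this cylinder in $\mathcal A^{op}$ (so e.g. $c:\mathrm{id}_{\mathcal A}\to\mathsf{coCyl}$ with $e_0c=e_1c=\mathrm{id}$). Mapping cylinder of $f:a_0\to a_1$: an object $a_f$ with $d^0:\mathsf{Cyl}(a_0)\to a_f$, $d^1:a_1\to a_f$ such that $d^0\circ i_0(a_0)=d^1\circ f$ is a pushout square. $\mathsf{Cyl}$ preserves mapping cylinders if $\mathsf{Cyl}$ carries each such square to a pushout square (the square with maps $\mathsf{Cyl}(i_0(a_0)),\mathsf{Cyl}(d^0),\mathsf{Cyl}(f),\mathsf{Cyl}(d^1)$). $\mathsf{coCyl}$ preserves mapping co-cylinders: the dual (the pullback squares of $f$ and $e_0(a_1)$ are carried by $\mathsf{coCyl}$ to pullback squares). $\underline{\mathsf{Cyl}}$ is left adjoint to $\underline{\mathsf{coCyl}}$ if $\mathsf{Cyl}\dashv\mathsf{coCyl}$, with natural bijection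 $\mathsf{adj}:\mathrm{Hom}(\mathsf{Cyl}(a_0),a_1)\to\mathrm{Hom}(a_0,\mathsf{coCyl}(a_1))$, and $e_\epsilon(a_1)\circ\mathsf{adj}(h)=h\circ i_\epsilon(a_0)$ for $\epsilon=0,1$ and all $h$. The adjunction is compatible with $p$ and $c$ if $\mathsf{adj}(f\circ p(a_0))=c(a_1)\circ f$ for all $f:a_0\to a_1$. A homotopy from $f_0$ to $f_1$ ($f_0,f_1:a_0\to a_1$) with respect to $\underline{\mathsf{Cyl}}$ is $h:\mathsf{Cyl}(a_0)\to a_1$ with $h\circ i_0(a_0)=f_0$, $h\circ i_1(a_0)=f_1$; with respect to $\underline{\mathsf{coCyl}}$ it is $h:a_0\to\mathsf{coCyl}(a_1)$ with $e_0(a_1)\circ h=f_0$, $e_1(a_1)\circ h=f_1$. An arrow $f:a_0\to a_1$ is a homotopy equivalence if there are $f^{-1}:a_1\to a_0$ and homotopies from $f^{-1}f$ to $\mathrm{id}(a_0)$ and from $ff^{-1}$ to $\mathrm{id}(a_1)$. Cofibration with respect to $\underline{\mathsf{Cyl}}$: $j:a_0\to a_1$ such that for all $f:a_1\to a_2$, $h:\mathsf{Cyl}(a_0)\to a_2$ with $h\circ i_0(a_0)=f\circ j$ there is $k:\mathsf{Cyl}(a_1)\to a_2$ with $k\circ\mathsf{Cyl}(j)=h$ and $k\circ i_0(a_1)=f$. Normally cloven fibration with respect to $\underline{\mathsf{coCyl}}$ and $c$: $f:a_1\to a_2$ for which one can choose, for every object $a_0$ and all $g:a_0\to a_1$, $h:a_0\to\mathsf{coCyl}(a_2)$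 with $e_0(a_2)\circ h=f\circ g$, an arrow $k_{a_0}(g,h):a_0\to\mathsf{coCyl}(a_1)$ with $\mathsf{coCyl}(f)\circ k_{a_0}(g,h)=h$ and $e_0(a_1)\circ k_{a_0}(g,h)=g$, such that (i) $k_{a_0}(g,c(a_2)\circ f\circ g)=c(a_1)\circ g$, and (ii) $k_{a_{-1}}(g\circ u,h\circ u)=k_{a_0}(g,h)\circ u$ for all $u:a_{-1}\to a_0$. A model structure means a (closed) model structure in the sense of Quillen: weak equivalences satisfy two-out-of-three; (trivial) fibrations are exactly the arrows with the right lifting property with respect to trivial cofibrations (resp. cofibrations); (trivial) cofibrations are exactly the arrows with the left lifting property with respect to trivial fibrations (resp. fibrations); every arrow factors as a cofibration followed by a trivial fibration and as a trivial cofibration followed by a fibration (factorisations not required functorial). *)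

theory Defs
  imports Main
begin

section \<open>Categories, functors, natural transformations\<close>

record ('o, 'm) cat =
  Obj :: "'o set"
  Arr :: "'m set"
  Dom :: "'m \<Rightarrow> 'o"
  Cod :: "'m \<Rightarrow> 'o"
  Id :: "'o \<Rightarrow> 'm"
  Comp :: "'m \<Rightarrow> 'm \<Rightarrow> 'm" (infixr "\<cdot>\<index>" 70)

definition hom :: "('o, 'm) cat \<Rightarrow> 'o \<Rightarrow> 'o \<Rightarrow> 'm set" where
  "hom A a b = {f \<in> Arr A. Dom A f = a \<and> Cod A f = b}"

locale category =
  fixes A :: "('o, 'm) cat"
  assumes Dom_in_Obj: "f \<in> Arr A \<Longrightarrow> Dom A f \<in> Obj A"
    and Cod_in_Obj: "f \<in> Arr A \<Longrightarrow> Cod A f \<in> Obj A"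
    and Id_in_hom: "a \<in> Obj A \<Longrightarrow> Id A a \<in> hom A a a"
    and Comp_in_hom: "f \<in> hom A a b \<Longrightarrow> g \<in> hom A b c \<Longrightarrow> g \<cdot>\<^bsub>A\<^esub> f \<in> hom A a c"
    and Comp_Id: "f \<in> hom A a b \<Longrightarrow> f \<cdot>\<^bsub>A\<^esub> Id A a = f"
    and Id_Comp: "f \<in> hom A a b \<Longrightarrow> Id A b \<cdot>\<^bsub>A\<^esub> f = f"
    and Comp_assoc: "f \<in> hom A a b \<Longrightarrow> g \<in> hom A b c \<Longrightarrow> h \<in> hom A c d \<Longrightarrow>
      (h \<cdot>\<^bsub>A\<^esub> g) \<cdot>\<^bsub>A\<^esub> f = h \<cdot>\<^bsub>A\<^esub> (g \<cdot>\<^bsub>A\<^esub> f)"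

definition opp :: "('o, 'm) cat \<Rightarrow> ('o, 'm) cat" where
  "opp A = \<lparr>Obj = Obj A, Arr = Arr A, Dom = Cod A, Cod = Dom A, Id = Id A,
    Comp = (\<lambda>g f. f \<cdot>\<^bsub>A\<^esub> g)\<rparr>"

record ('o1, 'm1, 'o2, 'm2) func =
  omap :: "'o1 \<Rightarrow> 'o2"
  amap :: "'m1 \<Rightarrow> 'm2"

type_synonym ('o, 'm) endofunc = "('o, 'm, 'o, 'm) func"

definition is_functor ::
  "('o1, 'm1) cat \<Rightarrow> ('o2, 'm2) cat \<Rightarrow> ('o1, 'm1, 'o2, 'm2) func \<Rightarrow> bool" where
  "is_functor A B F \<longleftrightarrow>
    (\<forall>a \<in> Obj A. omap F a \<in> Obj B) \<and>
    (\<forall>a b f. f \<in> hom A a b \<longrightarrow> amap F f \<in> hom B (omap F a) (omap F b)) \<and>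
    (\<forall>a \<in> Obj A. amap F (Id A a) = Id B (omap F a)) \<and>
    (\<forall>a b c f g. f \<in> hom A a b \<longrightarrow> g \<in> hom A b c \<longrightarrow>
      amap F (g \<cdot>\<^bsub>A\<^esub> f) = amap F g \<cdot>\<^bsub>B\<^esub> amap F f)"

definition id_func :: "('o, 'm) endofunc" where
  "id_func = \<lparr>omap = (\<lambda>a. a), amap = (\<lambda>f. f)\<rparr>"

definition comp_func :: "('o, 'm) endofunc \<Rightarrow> ('o, 'm) endofunc \<Rightarrow> ('o, 'm) endofunc" where
  "comp_func F G = \<lparr>omap = (\<lambda>a. omap F (omap G a)), amap = (\<lambda>f. amap F (amap G f))\<rparr>"

text \<open>A natural transformation is given by its components at the objects of the category; two of
  them are equal if they agree on \<open>Obj A\<close> (values outside are irrelevant).\<close>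

definition nat_trans ::
  "('o, 'm) cat \<Rightarrow> ('o, 'm) endofunc \<Rightarrow> ('o, 'm) endofunc \<Rightarrow> ('o \<Rightarrow> 'm) \<Rightarrow> bool" where
  "nat_trans A F G \<eta> \<longleftrightarrow>
    (\<forall>a \<in> Obj A. \<eta> a \<in> hom A (omap F a) (omap G a)) \<and>
    (\<forall>a b f. f \<in> hom A a b \<longrightarrow> amap G f \<cdot>\<^bsub>A\<^esub> \<eta> a = \<eta> b \<cdot>\<^bsub>A\<^esub> amap F f)"


section \<open>Finite limits and colimits, pushouts\<close>

definition is_cone ::
  "('o, 'm) cat \<Rightarrow> ('j, 'k) cat \<Rightarrow> ('j, 'k, 'o, 'm) func \<Rightarrow> 'o \<Rightarrow> ('j \<Rightarrow> 'm) \<Rightarrow> bool" where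
  "is_cone A J D c \<pi> \<longleftrightarrow>
    c \<in> Obj A \<and>
    (\<forall>j \<in> Obj J. \<pi> j \<in> hom A c (omap D j)) \<and>
    (\<forall>i j u. u \<in> hom J i j \<longrightarrow> amap D u \<cdot>\<^bsub>A\<^esub> \<pi> i = \<pi> j)"

definition is_limit ::
  "('o, 'm) cat \<Rightarrow> ('j, 'k) cat \<Rightarrow> ('j, 'k, 'o, 'm) func \<Rightarrow> 'o \<Rightarrow> ('j \<Rightarrow> 'm) \<Rightarrow> bool" where
  "is_limit A J D c \<pi> \<longleftrightarrow>
    is_cone A J D c \<pi> \<and>
    (\<forall>c' \<pi>'. is_cone A J D c' \<pi>' \<longrightarrow>
      (\<exists>!m. m \<in> hom A c' c \<and> (\<forall>j \<in> Obj J. \<pi> j \<cdot>\<^bsub>A\<^esub> m = \<pi>' j)))"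

definition is_colimit ::
  "('o, 'm) cat \<Rightarrow> ('j, 'k) cat \<Rightarrow> ('j, 'k, 'o, 'm) func \<Rightarrow> 'o \<Rightarrow> ('j \<Rightarrow> 'm) \<Rightarrow> bool" where
  "is_colimit A J D c \<iota> \<longleftrightarrow> is_limit (opp A) (opp J) D c \<iota>"

text \<open>Every finite category is isomorphic to one whose objects and arrows are natural numbers, so
  these index categories suffice.\<close>

definition finite_category :: "(nat, nat) cat \<Rightarrow> bool" where
  "finite_category J \<longleftrightarrow> category J \<and> finite (Obj J) \<and> finite (Arr J)"

definition has_finite_limits :: "('o, 'm) cat \<Rightarrow> bool" where
  "has_finite_limits A \<longleftrightarrow>
    (\<forall>J D. finite_category J \<longrightarrow> is_functor J A D \<longrightarrow> (\<exists>c \<pi>. is_limit A J D c \<pi>))"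

definition has_finite_colimits :: "('o, 'm) cat \<Rightarrow> bool" where
  "has_finite_colimits A \<longleftrightarrow>
    (\<forall>J D. finite_category J \<longrightarrow> is_functor J A D \<longrightarrow> (\<exists>c \<iota>. is_colimit A J D c \<iota>))"

text \<open>\<open>is_pushout A f g u v\<close>: the square \<open>u f = v g\<close> is a pushout of \<open>f\<close> and \<open>g\<close>.\<close>

definition is_pushout :: "('o, 'm) cat \<Rightarrow> 'm \<Rightarrow> 'm \<Rightarrow> 'm \<Rightarrow> 'm \<Rightarrow> bool" where
  "is_pushout A f g u v \<longleftrightarrow>
    f \<in> Arr A \<and> g \<in> Arr A \<and> u \<in> Arr A \<and> v \<in> Arr A \<and>
    Dom A f = Dom A g \<and> Dom A u = Cod A f \<and> Dom A v = Cod A g \<and> Cod A u = Cod A v \<and>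
    u \<cdot>\<^bsub>A\<^esub> f = v \<cdot>\<^bsub>A\<^esub> g \<and>
    (\<forall>b x y. x \<in> hom A (Cod A f) b \<longrightarrow> y \<in> hom A (Cod A g) b \<longrightarrow> x \<cdot>\<^bsub>A\<^esub> f = y \<cdot>\<^bsub>A\<^esub> g \<longrightarrow>
      (\<exists>!w. w \<in> hom A (Cod A u) b \<and> w \<cdot>\<^bsub>A\<^esub> u = x \<and> w \<cdot>\<^bsub>A\<^esub> v = y))"

text \<open>\<open>nt_factors A S T r0 r1 x y w\<close>: \<open>w : S \<rightarrow> T\<close> is natural with \<open>w r0 = x\<close> and \<open>w r1 = y\<close>.\<close>

definition nt_factors ::
  "('o, 'm) cat \<Rightarrow> ('o, 'm) endofunc \<Rightarrow> ('o, 'm) endofunc \<Rightarrow> ('o \<Rightarrow> 'm) \<Rightarrow> ('o \<Rightarrow> 'm) \<Rightarrow>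
    ('o \<Rightarrow> 'm) \<Rightarrow> ('o \<Rightarrow> 'm) \<Rightarrow> ('o \<Rightarrow> 'm) \<Rightarrow> bool" where
  "nt_factors A S T r0 r1 x y w \<longleftrightarrow>
    nat_trans A S T w \<and> (\<forall>a \<in> Obj A. w a \<cdot>\<^bsub>A\<^esub> r0 a = x a \<and> w a \<cdot>\<^bsub>A\<^esub> r1 a = y a)"

text \<open>The square \<open>r0 f = r1 g\<close> of natural transformations \<open>f : K \<rightarrow> F\<close>, \<open>g : K \<rightarrow> G\<close>,
  \<open>r0 : F \<rightarrow> S\<close>, \<open>r1 : G \<rightarrow> S\<close> is a pushout in the category of endofunctors of \<open>A\<close>.\<close>

definition is_endofunctor_pushout ::
  "('o, 'm) cat \<Rightarrow> ('o, 'm) endofunc \<Rightarrow> ('o, 'm) endofunc \<Rightarrow> ('o, 'm) endofunc \<Rightarrow>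
    ('o, 'm) endofunc \<Rightarrow> ('o \<Rightarrow> 'm) \<Rightarrow> ('o \<Rightarrow> 'm) \<Rightarrow> ('o \<Rightarrow> 'm) \<Rightarrow> ('o \<Rightarrow> 'm) \<Rightarrow> bool" where
  "is_endofunctor_pushout A K F G S f g r0 r1 \<longleftrightarrow>
    is_functor A A K \<and> is_functor A A F \<and> is_functor A A G \<and> is_functor A A S \<and>
    nat_trans A K F f \<and> nat_trans A K G g \<and> nat_trans A F S r0 \<and> nat_trans A G S r1 \<and>
    (\<forall>a \<in> Obj A. r0 a \<cdot>\<^bsub>A\<^esub> f a = r1 a \<cdot>\<^bsub>A\<^esub> g a) \<and>
    (\<forall>T x y. is_functor A A T \<longrightarrow> nat_trans A F T x \<longrightarrow> nat_trans A G T y \<longrightarrow>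
      (\<forall>a \<in> Obj A. x a \<cdot>\<^bsub>A\<^esub> f a = y a \<cdot>\<^bsub>A\<^esub> g a) \<longrightarrow>
      (\<exists>w. nt_factors A S T r0 r1 x y w) \<and>
      (\<forall>w w'. nt_factors A S T r0 r1 x y w \<longrightarrow> nt_factors A S T r0 r1 x y w' \<longrightarrow>
        (\<forall>a \<in> Obj A. w a = w' a)))"


section \<open>Cylinders and structures on them\<close>

text \<open>A functor or natural transformation on \<open>opp A\<close> has the same underlying data as its dual on
  \<open>A\<close>. Hence a structure on a co-cylinder in \<open>A\<close> is the structure of the same name below, taken
  over \<open>opp A\<close>, and no separate definitions are given.\<close>

definition cylinder ::
  "('o, 'm) cat \<Rightarrow> ('o, 'm) endofunc \<Rightarrow> ('o \<Rightarrow> 'm) \<Rightarrow> ('o \<Rightarrow> 'm) \<Rightarrow> bool" where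
  "cylinder A Cyl i0 i1 \<longleftrightarrow>
    is_functor A A Cyl \<and> nat_trans A id_func Cyl i0 \<and> nat_trans A id_func Cyl i1"

definition cocylinder ::
  "('o, 'm) cat \<Rightarrow> ('o, 'm) endofunc \<Rightarrow> ('o \<Rightarrow> 'm) \<Rightarrow> ('o \<Rightarrow> 'm) \<Rightarrow> bool" where
  "cocylinder A coCyl e0 e1 \<longleftrightarrow>
    is_functor A A coCyl \<and> nat_trans A coCyl id_func e0 \<and> nat_trans A coCyl id_func e1"

definition contraction ::
  "('o, 'm) cat \<Rightarrow> ('o, 'm) endofunc \<Rightarrow> ('o \<Rightarrow> 'm) \<Rightarrow> ('o \<Rightarrow> 'm) \<Rightarrow> ('o \<Rightarrow> 'm) \<Rightarrow> bool" where
  "contraction A Cyl i0 i1 p \<longleftrightarrow>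
    nat_trans A Cyl id_func p \<and>
    (\<forall>a \<in> Obj A. p a \<cdot>\<^bsub>A\<^esub> i0 a = Id A a \<and> p a \<cdot>\<^bsub>A\<^esub> i1 a = Id A a)"

definition involution ::
  "('o, 'm) cat \<Rightarrow> ('o, 'm) endofunc \<Rightarrow> ('o \<Rightarrow> 'm) \<Rightarrow> ('o \<Rightarrow> 'm) \<Rightarrow> ('o \<Rightarrow> 'm) \<Rightarrow> bool" where
  "involution A Cyl i0 i1 v \<longleftrightarrow>
    nat_trans A Cyl Cyl v \<and>
    (\<forall>a \<in> Obj A. v a \<cdot>\<^bsub>A\<^esub> i0 a = i1 a \<and> v a \<cdot>\<^bsub>A\<^esub> i1 a = i0 a)"

definition involution_compatible ::
  "('o, 'm) cat \<Rightarrow> ('o \<Rightarrow> 'm) \<Rightarrow> ('o \<Rightarrow> 'm) \<Rightarrow> bool" where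
  "involution_compatible A v p \<longleftrightarrow> (\<forall>a \<in> Obj A. p a \<cdot>\<^bsub>A\<^esub> v a = p a)"

definition subdivision ::
  "('o, 'm) cat \<Rightarrow> ('o, 'm) endofunc \<Rightarrow> ('o \<Rightarrow> 'm) \<Rightarrow> ('o \<Rightarrow> 'm) \<Rightarrow>
    ('o, 'm) endofunc \<Rightarrow> ('o \<Rightarrow> 'm) \<Rightarrow> ('o \<Rightarrow> 'm) \<Rightarrow> ('o \<Rightarrow> 'm) \<Rightarrow> bool" where
  "subdivision A Cyl i0 i1 S r0 r1 s \<longleftrightarrow>
    is_endofunctor_pushout A id_func Cyl Cyl S i0 i1 r0 r1 \<and>
    nat_trans A Cyl S s \<and>
    (\<forall>a \<in> Obj A. s a \<cdot>\<^bsub>A\<^esub> i0 a = r1 a \<cdot>\<^bsub>A\<^esub> i0 a \<and> s a \<cdot>\<^bsub>A\<^esub> i1 a = r0 a \<cdot>\<^bsub>A\<^esub> i1 a)"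

text \<open>In the next definition and in \<open>strict_identities\<close> the map asserted to exist is the unique one
  induced by the universal property of the pushout \<open>S\<close>; in \<open>connections_compatible\<close> it is unique
  because pushouts of endofunctors are computed objectwise when \<open>A\<close> has pushouts, so that
  precomposition with \<open>Cyl\<close> preserves them.\<close>

definition subdivision_compatible ::
  "('o, 'm) cat \<Rightarrow> ('o, 'm) endofunc \<Rightarrow> ('o \<Rightarrow> 'm) \<Rightarrow> ('o \<Rightarrow> 'm) \<Rightarrow> ('o \<Rightarrow> 'm) \<Rightarrow>
    ('o \<Rightarrow> 'm) \<Rightarrow> bool" where
  "subdivision_compatible A S r0 r1 s p \<longleftrightarrow>
    (\<exists>pb. nt_factors A S id_func r0 r1 p p pb \<and> (\<forall>a \<in> Obj A. pb a \<cdot>\<^bsub>A\<^esub> s a = p a))"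

definition upper_left_connection ::
  "('o, 'm) cat \<Rightarrow> ('o, 'm) endofunc \<Rightarrow> ('o \<Rightarrow> 'm) \<Rightarrow> ('o \<Rightarrow> 'm) \<Rightarrow> ('o \<Rightarrow> 'm) \<Rightarrow>
    ('o \<Rightarrow> 'm) \<Rightarrow> bool" where
  "upper_left_connection A Cyl i0 i1 p \<Gamma> \<longleftrightarrow>
    nat_trans A (comp_func Cyl Cyl) Cyl \<Gamma> \<and>
    (\<forall>a \<in> Obj A.
      \<Gamma> a \<cdot>\<^bsub>A\<^esub> i0 (omap Cyl a) = Id A (omap Cyl a) \<and>
      \<Gamma> a \<cdot>\<^bsub>A\<^esub> amap Cyl (i0 a) = Id A (omap Cyl a) \<and>
      \<Gamma> a \<cdot>\<^bsub>A\<^esub> i1 (omap Cyl a) = i1 a \<cdot>\<^bsub>A\<^esub> p a \<and>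
      \<Gamma> a \<cdot>\<^bsub>A\<^esub> amap Cyl (i1 a) = i1 a \<cdot>\<^bsub>A\<^esub> p a)"

definition lower_right_connection ::
  "('o, 'm) cat \<Rightarrow> ('o, 'm) endofunc \<Rightarrow> ('o \<Rightarrow> 'm) \<Rightarrow> ('o \<Rightarrow> 'm) \<Rightarrow> ('o \<Rightarrow> 'm) \<Rightarrow>
    ('o \<Rightarrow> 'm) \<Rightarrow> bool" where
  "lower_right_connection A Cyl i0 i1 p \<Gamma> \<longleftrightarrow>
    nat_trans A (comp_func Cyl Cyl) Cyl \<Gamma> \<and>
    (\<forall>a \<in> Obj A.
      \<Gamma> a \<cdot>\<^bsub>A\<^esub> i1 (omap Cyl a) = Id A (omap Cyl a) \<and>
      \<Gamma> a \<cdot>\<^bsub>A\<^esub> amap Cyl (i1 a) = Id A (omap Cyl a) \<and>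
      \<Gamma> a \<cdot>\<^bsub>A\<^esub> i0 (omap Cyl a) = i0 a \<cdot>\<^bsub>A\<^esub> p a \<and>
      \<Gamma> a \<cdot>\<^bsub>A\<^esub> amap Cyl (i0 a) = i0 a \<cdot>\<^bsub>A\<^esub> p a)"

definition lower_right_compatible ::
  "('o, 'm) cat \<Rightarrow> ('o, 'm) endofunc \<Rightarrow> ('o \<Rightarrow> 'm) \<Rightarrow> ('o \<Rightarrow> 'm) \<Rightarrow> bool" where
  "lower_right_compatible A Cyl p \<Gamma> \<longleftrightarrow>
    (\<forall>a \<in> Obj A. p a \<cdot>\<^bsub>A\<^esub> \<Gamma> a = p a \<cdot>\<^bsub>A\<^esub> p (omap Cyl a))"

definition upper_right_connection ::
  "('o, 'm) cat \<Rightarrow> ('o, 'm) endofunc \<Rightarrow> ('o \<Rightarrow> 'm) \<Rightarrow> ('o \<Rightarrow> 'm) \<Rightarrow> ('o \<Rightarrow> 'm) \<Rightarrow>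
    ('o \<Rightarrow> 'm) \<Rightarrow> ('o \<Rightarrow> 'm) \<Rightarrow> bool" where
  "upper_right_connection A Cyl i0 i1 p v \<Gamma> \<longleftrightarrow>
    nat_trans A (comp_func Cyl Cyl) Cyl \<Gamma> \<and>
    (\<forall>a \<in> Obj A.
      \<Gamma> a \<cdot>\<^bsub>A\<^esub> i0 (omap Cyl a) = Id A (omap Cyl a) \<and>
      \<Gamma> a \<cdot>\<^bsub>A\<^esub> amap Cyl (i1 a) = v a \<and>
      \<Gamma> a \<cdot>\<^bsub>A\<^esub> amap Cyl (i0 a) = i0 a \<cdot>\<^bsub>A\<^esub> p a \<and>
      \<Gamma> a \<cdot>\<^bsub>A\<^esub> i1 (omap Cyl a) = i0 a \<cdot>\<^bsub>A\<^esub> p a)"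

definition connections_compatible ::
  "('o, 'm) cat \<Rightarrow> ('o, 'm) endofunc \<Rightarrow> ('o \<Rightarrow> 'm) \<Rightarrow> ('o, 'm) endofunc \<Rightarrow> ('o \<Rightarrow> 'm) \<Rightarrow>
    ('o \<Rightarrow> 'm) \<Rightarrow> ('o \<Rightarrow> 'm) \<Rightarrow> ('o \<Rightarrow> 'm) \<Rightarrow> ('o \<Rightarrow> 'm) \<Rightarrow> bool" where
  "connections_compatible A Cyl p S r0 r1 s \<Gamma>lr \<Gamma>ur \<longleftrightarrow>
    (\<exists>x. nt_factors A (comp_func S Cyl) Cyl
            (\<lambda>a. r0 (omap Cyl a)) (\<lambda>a. r1 (omap Cyl a)) \<Gamma>lr \<Gamma>ur x \<and>
         (\<forall>a \<in> Obj A. x a \<cdot>\<^bsub>A\<^esub> s (omap Cyl a) = p (omap Cyl a)))"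

definition strict_identities ::
  "('o, 'm) cat \<Rightarrow> ('o, 'm) endofunc \<Rightarrow> ('o \<Rightarrow> 'm) \<Rightarrow> ('o \<Rightarrow> 'm) \<Rightarrow> ('o \<Rightarrow> 'm) \<Rightarrow>
    ('o, 'm) endofunc \<Rightarrow> ('o \<Rightarrow> 'm) \<Rightarrow> ('o \<Rightarrow> 'm) \<Rightarrow> ('o \<Rightarrow> 'm) \<Rightarrow> bool" where
  "strict_identities A Cyl i0 i1 p S r0 r1 s \<longleftrightarrow>
    (\<exists>ql. nt_factors A S Cyl r0 r1 (\<lambda>a. Id A (omap Cyl a)) (\<lambda>a. i0 a \<cdot>\<^bsub>A\<^esub> p a) ql \<and>
          (\<forall>a \<in> Obj A. ql a \<cdot>\<^bsub>A\<^esub> s a = Id A (omap Cyl a))) \<and>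
    (\<exists>qr. nt_factors A S Cyl r0 r1 (\<lambda>a. i1 a \<cdot>\<^bsub>A\<^esub> p a) (\<lambda>a. Id A (omap Cyl a)) qr \<and>
          (\<forall>a \<in> Obj A. qr a \<cdot>\<^bsub>A\<^esub> s a = Id A (omap Cyl a)))"

text \<open>\<open>is_mapping_cylinder A i0 f d0 d1\<close>: the object \<open>Cod A d0 = Cod A d1\<close>, with \<open>d0\<close> and \<open>d1\<close>,
  is a mapping cylinder of \<open>f\<close>.\<close>

definition is_mapping_cylinder ::
  "('o, 'm) cat \<Rightarrow> ('o \<Rightarrow> 'm) \<Rightarrow> 'm \<Rightarrow> 'm \<Rightarrow> 'm \<Rightarrow> bool" where
  "is_mapping_cylinder A i0 f d0 d1 \<longleftrightarrow> f \<in> Arr A \<and> is_pushout A (i0 (Dom A f)) f d0 d1"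

definition preserves_mapping_cylinders ::
  "('o, 'm) cat \<Rightarrow> ('o, 'm) endofunc \<Rightarrow> ('o \<Rightarrow> 'm) \<Rightarrow> bool" where
  "preserves_mapping_cylinders A Cyl i0 \<longleftrightarrow>
    (\<forall>f d0 d1. is_mapping_cylinder A i0 f d0 d1 \<longrightarrow>
      is_pushout A (amap Cyl (i0 (Dom A f))) (amap Cyl f) (amap Cyl d0) (amap Cyl d1))"


section \<open>Adjunction between a cylinder and a co-cylinder\<close>

definition adjunction ::
  "('o, 'm) cat \<Rightarrow> ('o, 'm) endofunc \<Rightarrow> ('o, 'm) endofunc \<Rightarrow> ('o \<Rightarrow> 'o \<Rightarrow> 'm \<Rightarrow> 'm) \<Rightarrow> bool" where
  "adjunction A L R adj \<longleftrightarrow>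
    (\<forall>a0 \<in> Obj A. \<forall>a1 \<in> Obj A.
      bij_betw (adj a0 a1) (hom A (omap L a0) a1) (hom A a0 (omap R a1))) \<and>
    (\<forall>a0 a1 b0 b1 u g h. u \<in> hom A b0 a0 \<longrightarrow> h \<in> hom A (omap L a0) a1 \<longrightarrow> g \<in> hom A a1 b1 \<longrightarrow>
      adj b0 b1 (g \<cdot>\<^bsub>A\<^esub> h \<cdot>\<^bsub>A\<^esub> amap L u) = amap R g \<cdot>\<^bsub>A\<^esub> adj a0 a1 h \<cdot>\<^bsub>A\<^esub> u)"

definition cylinder_left_adjoint ::
  "('o, 'm) cat \<Rightarrow> ('o, 'm) endofunc \<Rightarrow> ('o \<Rightarrow> 'm) \<Rightarrow> ('o \<Rightarrow> 'm) \<Rightarrow>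
    ('o, 'm) endofunc \<Rightarrow> ('o \<Rightarrow> 'm) \<Rightarrow> ('o \<Rightarrow> 'm) \<Rightarrow> ('o \<Rightarrow> 'o \<Rightarrow> 'm \<Rightarrow> 'm) \<Rightarrow> bool" where
  "cylinder_left_adjoint A Cyl i0 i1 coCyl e0 e1 adj \<longleftrightarrow>
    adjunction A Cyl coCyl adj \<and>
    (\<forall>a0 \<in> Obj A. \<forall>a1 \<in> Obj A. \<forall>h \<in> hom A (omap Cyl a0) a1.
      e0 a1 \<cdot>\<^bsub>A\<^esub> adj a0 a1 h = h \<cdot>\<^bsub>A\<^esub> i0 a0 \<and>
      e1 a1 \<cdot>\<^bsub>A\<^esub> adj a0 a1 h = h \<cdot>\<^bsub>A\<^esub> i1 a0)"

definition adjunction_compatible ::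
  "('o, 'm) cat \<Rightarrow> ('o \<Rightarrow> 'm) \<Rightarrow> ('o \<Rightarrow> 'm) \<Rightarrow> ('o \<Rightarrow> 'o \<Rightarrow> 'm \<Rightarrow> 'm) \<Rightarrow> bool" where
  "adjunction_compatible A p c adj \<longleftrightarrow>
    (\<forall>a0 a1 f. f \<in> hom A a0 a1 \<longrightarrow> adj a0 a1 (f \<cdot>\<^bsub>A\<^esub> p a0) = c a1 \<cdot>\<^bsub>A\<^esub> f)"


section \<open>Homotopy equivalences, cofibrations, fibrations\<close>

definition cyl_homotopy ::
  "('o, 'm) cat \<Rightarrow> ('o, 'm) endofunc \<Rightarrow> ('o \<Rightarrow> 'm) \<Rightarrow> ('o \<Rightarrow> 'm) \<Rightarrow> 'o \<Rightarrow> 'o \<Rightarrow> 'm \<Rightarrow> 'm \<Rightarrow> 'm \<Rightarrow> bool"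
  where
  "cyl_homotopy A Cyl i0 i1 a0 a1 f0 f1 h \<longleftrightarrow>
    h \<in> hom A (omap Cyl a0) a1 \<and> h \<cdot>\<^bsub>A\<^esub> i0 a0 = f0 \<and> h \<cdot>\<^bsub>A\<^esub> i1 a0 = f1"

definition cocyl_homotopy ::
  "('o, 'm) cat \<Rightarrow> ('o, 'm) endofunc \<Rightarrow> ('o \<Rightarrow> 'm) \<Rightarrow> ('o \<Rightarrow> 'm) \<Rightarrow> 'o \<Rightarrow> 'o \<Rightarrow> 'm \<Rightarrow> 'm \<Rightarrow> 'm \<Rightarrow> bool"
  where
  "cocyl_homotopy A coCyl e0 e1 a0 a1 f0 f1 h \<longleftrightarrow>
    h \<in> hom A a0 (omap coCyl a1) \<and> e0 a1 \<cdot>\<^bsub>A\<^esub> h = f0 \<and> e1 a1 \<cdot>\<^bsub>A\<^esub> h = f1"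

text \<open>The parameter \<open>H a0 a1 f0 f1 h\<close> says that \<open>h\<close> is a homotopy from \<open>f0\<close> to \<open>f1\<close>,
  where \<open>f0, f1 : a0 \<rightarrow> a1\<close>.\<close>

definition homotopy_equivalences ::
  "('o, 'm) cat \<Rightarrow> ('o \<Rightarrow> 'o \<Rightarrow> 'm \<Rightarrow> 'm \<Rightarrow> 'm \<Rightarrow> bool) \<Rightarrow> 'm set" where
  "homotopy_equivalences A H =
    {f. \<exists>a0 a1 g. f \<in> hom A a0 a1 \<and> g \<in> hom A a1 a0 \<and>
      (\<exists>h. H a0 a0 (g \<cdot>\<^bsub>A\<^esub> f) (Id A a0) h) \<and> (\<exists>h. H a1 a1 (f \<cdot>\<^bsub>A\<^esub> g) (Id A a1) h)}"

definition cyl_homotopy_equivalences ::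
  "('o, 'm) cat \<Rightarrow> ('o, 'm) endofunc \<Rightarrow> ('o \<Rightarrow> 'm) \<Rightarrow> ('o \<Rightarrow> 'm) \<Rightarrow> 'm set" where
  "cyl_homotopy_equivalences A Cyl i0 i1 = homotopy_equivalences A (cyl_homotopy A Cyl i0 i1)"

definition cocyl_homotopy_equivalences ::
  "('o, 'm) cat \<Rightarrow> ('o, 'm) endofunc \<Rightarrow> ('o \<Rightarrow> 'm) \<Rightarrow> ('o \<Rightarrow> 'm) \<Rightarrow> 'm set" where
  "cocyl_homotopy_equivalences A coCyl e0 e1 =
    homotopy_equivalences A (cocyl_homotopy A coCyl e0 e1)"

definition cofibrations ::
  "('o, 'm) cat \<Rightarrow> ('o, 'm) endofunc \<Rightarrow> ('o \<Rightarrow> 'm) \<Rightarrow> 'm set" where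
  "cofibrations A Cyl i0 =
    {j. \<exists>a0 a1. j \<in> hom A a0 a1 \<and>
      (\<forall>a2 f h. f \<in> hom A a1 a2 \<longrightarrow> h \<in> hom A (omap Cyl a0) a2 \<longrightarrow> h \<cdot>\<^bsub>A\<^esub> i0 a0 = f \<cdot>\<^bsub>A\<^esub> j \<longrightarrow>
        (\<exists>k \<in> hom A (omap Cyl a1) a2. k \<cdot>\<^bsub>A\<^esub> amap Cyl j = h \<and> k \<cdot>\<^bsub>A\<^esub> i0 a1 = f))}"

definition normally_cloven_fibrations ::
  "('o, 'm) cat \<Rightarrow> ('o, 'm) endofunc \<Rightarrow> ('o \<Rightarrow> 'm) \<Rightarrow> ('o \<Rightarrow> 'm) \<Rightarrow> 'm set" where
  "normally_cloven_fibrations A coCyl e0 c =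
    {f. \<exists>a1 a2. f \<in> hom A a1 a2 \<and>
      (\<exists>k :: 'o \<Rightarrow> 'm \<Rightarrow> 'm \<Rightarrow> 'm.
        (\<forall>a0 g h. g \<in> hom A a0 a1 \<longrightarrow> h \<in> hom A a0 (omap coCyl a2) \<longrightarrow> e0 a2 \<cdot>\<^bsub>A\<^esub> h = f \<cdot>\<^bsub>A\<^esub> g \<longrightarrow>
          k a0 g h \<in> hom A a0 (omap coCyl a1) \<and>
          amap coCyl f \<cdot>\<^bsub>A\<^esub> k a0 g h = h \<and> e0 a1 \<cdot>\<^bsub>A\<^esub> k a0 g h = g) \<and>
        (\<forall>a0 g. g \<in> hom A a0 a1 \<longrightarrow> k a0 g (c a2 \<cdot>\<^bsub>A\<^esub> f \<cdot>\<^bsub>A\<^esub> g) = c a1 \<cdot>\<^bsub>A\<^esub> g) \<and>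
        (\<forall>a0 b g h u. g \<in> hom A a0 a1 \<longrightarrow> h \<in> hom A a0 (omap coCyl a2) \<longrightarrow> e0 a2 \<cdot>\<^bsub>A\<^esub> h = f \<cdot>\<^bsub>A\<^esub> g \<longrightarrow>
          u \<in> hom A b a0 \<longrightarrow>
          k b (g \<cdot>\<^bsub>A\<^esub> u) (h \<cdot>\<^bsub>A\<^esub> u) = k a0 g h \<cdot>\<^bsub>A\<^esub> u))}"


section \<open>Model structures\<close>

definition lifts_against :: "('o, 'm) cat \<Rightarrow> 'm \<Rightarrow> 'm \<Rightarrow> bool" where
  "lifts_against A j f \<longleftrightarrow>
    (\<forall>g h. g \<in> hom A (Dom A j) (Dom A f) \<longrightarrow> h \<in> hom A (Cod A j) (Cod A f) \<longrightarrow>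
      f \<cdot>\<^bsub>A\<^esub> g = h \<cdot>\<^bsub>A\<^esub> j \<longrightarrow>
      (\<exists>l \<in> hom A (Cod A j) (Dom A f). l \<cdot>\<^bsub>A\<^esub> j = g \<and> f \<cdot>\<^bsub>A\<^esub> l = h))"

definition llp :: "('o, 'm) cat \<Rightarrow> 'm set \<Rightarrow> 'm set" where
  "llp A M = {j \<in> Arr A. \<forall>f \<in> M. lifts_against A j f}"

definition rlp :: "('o, 'm) cat \<Rightarrow> 'm set \<Rightarrow> 'm set" where
  "rlp A M = {f \<in> Arr A. \<forall>j \<in> M. lifts_against A j f}"

definition two_out_of_three :: "('o, 'm) cat \<Rightarrow> 'm set \<Rightarrow> bool" where
  "two_out_of_three A W \<longleftrightarrow>
    (\<forall>a b c f g. f \<in> hom A a b \<longrightarrow> g \<in> hom A b c \<longrightarrow>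
      (f \<in> W \<and> g \<in> W \<longrightarrow> g \<cdot>\<^bsub>A\<^esub> f \<in> W) \<and>
      (f \<in> W \<and> g \<cdot>\<^bsub>A\<^esub> f \<in> W \<longrightarrow> g \<in> W) \<and>
      (g \<in> W \<and> g \<cdot>\<^bsub>A\<^esub> f \<in> W \<longrightarrow> f \<in> W))"

definition factors_through :: "('o, 'm) cat \<Rightarrow> 'm set \<Rightarrow> 'm set \<Rightarrow> bool" where
  "factors_through A L R \<longleftrightarrow>
    (\<forall>f \<in> Arr A. \<exists>l \<in> L. \<exists>r \<in> R. Cod A l = Dom A r \<and> r \<cdot>\<^bsub>A\<^esub> l = f)"

text \<open>\<open>W\<close>, \<open>F\<close>, \<open>C\<close> are the weak equivalences, fibrations and cofibrations.\<close>

definition model_structure :: "('o, 'm) cat \<Rightarrow> 'm set \<Rightarrow> 'm set \<Rightarrow> 'm set \<Rightarrow> bool" where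
  "model_structure A W F C \<longleftrightarrow>
    W \<subseteq> Arr A \<and> F \<subseteq> Arr A \<and> C \<subseteq> Arr A \<and>
    two_out_of_three A W \<and>
    F = rlp A (C \<inter> W) \<and> F \<inter> W = rlp A C \<and>
    C = llp A (F \<inter> W) \<and> C \<inter> W = llp A F \<and>
    factors_through A C (F \<inter> W) \<and> factors_through A (C \<inter> W) F"


section \<open>Duality\<close>

lemma opp_simps [simp]:
  "Obj (opp A) = Obj A" "Arr (opp A) = Arr A" "Dom (opp A) = Cod A" "Cod (opp A) = Dom A"
  "Id (opp A) = Id A" "g \<cdot>\<^bsub>opp A\<^esub> f = f \<cdot>\<^bsub>A\<^esub> g"
  by (simp_all add: opp_def)

lemma opp_opp [simp]: "opp (opp A) = A"
  by (simp add: opp_def)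

lemma hom_opp [simp]: "hom (opp A) a b = hom A b a"
  by (auto simp: hom_def)

lemma category_opp: "category A \<Longrightarrow> category (opp A)"
  unfolding category_def by (simp, metis)

lemma is_functor_opp [simp]: "is_functor (opp A) (opp B) F \<longleftrightarrow> is_functor A B F"
  unfolding is_functor_def by auto

lemma nat_trans_opp [simp]: "nat_trans (opp A) F G \<eta> \<longleftrightarrow> nat_trans A G F \<eta>"
  unfolding nat_trans_def by (auto simp: eq_commute)

lemma cylinder_opp: "cylinder (opp A) coCyl e0 e1 \<longleftrightarrow> cocylinder A coCyl e0 e1"
  by (simp add: cylinder_def cocylinder_def)

end

theory Submission
  imports Defs
begin

text \<open>Write \<open>I\<close> for the cylinder and \<open>P\<close> for the co-cylinder.

  All that is needed about one cylinder is proved in the locale \<open>structured_cylinder\<close>, and is then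
  available both for \<open>I\<close> in \<open>A\<close> and for \<open>P\<close> in \<open>opp A\<close>. Three results carry the proof.
  A cofibration that is a homotopy equivalence is a strong deformation retract
  (\<open>trivial_cof_sdr\<close>, the argument of Dold). Conversely a strong deformation retract is a cofibration
  (\<open>sdr_cof\<close>); here constant homotopies have to be strict identities for concatenation. Finally every
  arrow factors through its mapping cylinder as a cofibration with natural and normal
  extensions, followed by a deformation retraction (\<open>mapping_cylinder_factorisation\<close>).

  The adjunction identifies homotopies with respect to \<open>I\<close> and \<open>P\<close>, constant ones included, and so
  connects the two sides. A strong deformation retract lifts against a normally cloven fibration,
  because paths that are constant on the subobject have lifts that are constant there
  (\<open>sdr_lift\<close>). A cofibration lifts against a fibration that is a homotopy equivalence, because by
  duality the latter deforms onto a section over its target (\<open>trivial_fib_lift\<close>). An arrow \<open>f\<close>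
  factors through its mapping co-cylinder as a strong deformation retract followed by a normally
  cloven fibration (\<open>factor_trivial_cof_fib\<close>); factoring the projection of the mapping cylinder in
  this way gives the other factorisation (\<open>factor_cof_trivial_fib\<close>). The remaining parts of the axioms
  follow by the retract argument.\<close>

section \<open>Composition of arrows\<close>

context category
begin

lemma comp_arr [simp]:
  assumes "f \<in> Arr A" "g \<in> Arr A" "Dom A g = Cod A f"
  shows "g \<cdot>\<^bsub>A\<^esub> f \<in> Arr A" "Dom A (g \<cdot>\<^bsub>A\<^esub> f) = Dom A f" "Cod A (g \<cdot>\<^bsub>A\<^esub> f) = Cod A g"
  using Comp_in_hom[of f "Dom A f" "Cod A f" g "Cod A g"] assms by (auto simp: hom_def)

lemma comp_assoc [simp]:
  assumes "f \<in> Arr A" "g \<in> Arr A" "h \<in> Arr A" "Dom A g = Cod A f" "Dom A h = Cod A g"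
  shows "(h \<cdot>\<^bsub>A\<^esub> g) \<cdot>\<^bsub>A\<^esub> f = h \<cdot>\<^bsub>A\<^esub> (g \<cdot>\<^bsub>A\<^esub> f)"
  using Comp_assoc[of f "Dom A f" "Cod A f" g "Cod A g" h "Cod A h"] assms by (auto simp: hom_def)

lemma id_arr [simp]:
  assumes "a \<in> Obj A"
  shows "Id A a \<in> Arr A" "Dom A (Id A a) = a" "Cod A (Id A a) = a"
  using Id_in_hom[OF assms] by (auto simp: hom_def)

lemma dom_cod_obj [simp]:
  assumes "f \<in> Arr A"
  shows "Dom A f \<in> Obj A" "Cod A f \<in> Obj A"
  using assms Dom_in_Obj Cod_in_Obj by auto

lemma comp_id [simp]:
  assumes "f \<in> Arr A"
  shows "Dom A f = a \<Longrightarrow> f \<cdot>\<^bsub>A\<^esub> Id A a = f" "Cod A f = a \<Longrightarrow> Id A a \<cdot>\<^bsub>A\<^esub> f = f"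
  using Comp_Id[of f "Dom A f" "Cod A f"] Id_Comp[of f "Dom A f" "Cod A f"] assms
  by (auto simp: hom_def)

text \<open>An equation between composites, in the form needed to rewrite inside a composite that is
  bracketed to the right.\<close>

lemma comp_eq_pre:
  assumes "g \<cdot>\<^bsub>A\<^esub> f = k" "f \<in> Arr A" "g \<in> Arr A" "Dom A g = Cod A f"
  shows "x \<in> Arr A \<Longrightarrow> Cod A x = Dom A f \<Longrightarrow> g \<cdot>\<^bsub>A\<^esub> (f \<cdot>\<^bsub>A\<^esub> x) = k \<cdot>\<^bsub>A\<^esub> x"
  using assms comp_assoc by metis

end

lemma homI: "f \<in> Arr A \<Longrightarrow> Dom A f = a \<Longrightarrow> Cod A f = b \<Longrightarrow> f \<in> hom A a b"
  by (simp add: hom_def)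

lemma homD:
  assumes "f \<in> hom A a b"
  shows "f \<in> Arr A" "Dom A f = a" "Cod A f = b"
  using assms by (auto simp: hom_def)

section \<open>Pushouts\<close>

lemma is_pushoutD:
  assumes "is_pushout A f g u v"
  shows "f \<in> Arr A" "g \<in> Arr A" "u \<in> Arr A" "v \<in> Arr A"
    "Dom A g = Dom A f" "Dom A u = Cod A f" "Dom A v = Cod A g" "Cod A v = Cod A u"
    "u \<cdot>\<^bsub>A\<^esub> f = v \<cdot>\<^bsub>A\<^esub> g"
  using assms unfolding is_pushout_def by auto

lemma is_pushout_ex:
  assumes "is_pushout A f g u v" "x \<in> Arr A" "y \<in> Arr A" "Dom A x = Cod A f" "Dom A y = Cod A g"
    "Cod A y = Cod A x" "x \<cdot>\<^bsub>A\<^esub> f = y \<cdot>\<^bsub>A\<^esub> g"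
  obtains w where "w \<in> Arr A" "Dom A w = Cod A u" "Cod A w = Cod A x"
    "w \<cdot>\<^bsub>A\<^esub> u = x" "w \<cdot>\<^bsub>A\<^esub> v = y"
proof -
  have "x \<in> hom A (Cod A f) (Cod A x)" "y \<in> hom A (Cod A g) (Cod A x)"
    using assms by (auto simp: hom_def)
  then have "\<exists>!w. w \<in> hom A (Cod A u) (Cod A x) \<and> w \<cdot>\<^bsub>A\<^esub> u = x \<and> w \<cdot>\<^bsub>A\<^esub> v = y"
    using assms(1,7) unfolding is_pushout_def by blast
  then show ?thesis using that by (auto simp: hom_def)
qed

lemma (in category) is_pushout_unique:
  assumes "is_pushout A f g u v" "w \<in> Arr A" "w' \<in> Arr A" "Dom A w = Cod A u" "Dom A w' = Cod A u"
    "Cod A w = Cod A w'" "w \<cdot>\<^bsub>A\<^esub> u = w' \<cdot>\<^bsub>A\<^esub> u" "w \<cdot>\<^bsub>A\<^esub> v = w' \<cdot>\<^bsub>A\<^esub> v"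
  shows "w = w'"
proof -
  note [simp] = is_pushoutD[OF assms(1)]
  have "w \<cdot>\<^bsub>A\<^esub> u \<in> hom A (Cod A f) (Cod A w)" "w \<cdot>\<^bsub>A\<^esub> v \<in> hom A (Cod A g) (Cod A w)"
    using assms(2-6) by (auto simp: hom_def)
  moreover have "(w \<cdot>\<^bsub>A\<^esub> u) \<cdot>\<^bsub>A\<^esub> f = (w \<cdot>\<^bsub>A\<^esub> v) \<cdot>\<^bsub>A\<^esub> g"
    using assms(2-6) by simp
  ultimately have "\<exists>!z. z \<in> hom A (Cod A u) (Cod A w) \<and> z \<cdot>\<^bsub>A\<^esub> u = w \<cdot>\<^bsub>A\<^esub> u \<and> z \<cdot>\<^bsub>A\<^esub> v = w \<cdot>\<^bsub>A\<^esub> v"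
    using assms(1) unfolding is_pushout_def by blast
  moreover have "w \<in> hom A (Cod A u) (Cod A w)" "w' \<in> hom A (Cod A u) (Cod A w)"
    using assms(2-6) by (auto simp: hom_def)
  ultimately show ?thesis using assms(7,8) by metis
qed

lemma has_finite_limits_opp:
  assumes "has_finite_colimits A"
  shows "has_finite_limits (opp A)"
  unfolding has_finite_limits_def
proof (intro allI impI)
  fix J :: "(nat, nat) cat" and D :: "(nat, nat, 'a, 'b) func"
  assume J: "finite_category J" and D: "is_functor J (opp A) D"
  have "finite_category (opp J)"
    using J category_opp by (auto simp: finite_category_def)
  moreover have "is_functor (opp J) A D"
    using D is_functor_opp[of "opp J" A D] by simp
  ultimately have "\<exists>c \<iota>. is_colimit A (opp J) D c \<iota>"
    using assms by (simp add: has_finite_colimits_def)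
  then show "\<exists>c \<pi>. is_limit (opp A) J D c \<pi>"
    by (simp add: is_colimit_def)
qed

text \<open>The cospan \<open>0 \<rightarrow> 2 \<leftarrow> 1\<close>; the arrows \<open>0, 1, 2\<close> are the identities and \<open>3, 4\<close> the two
  others.\<close>

definition cospan :: "(nat, nat) cat" where
  "cospan = \<lparr>Obj = {0, 1, 2}, Arr = {0, 1, 2, 3, 4},
    Dom = (\<lambda>n. if n = 3 then 0 else if n = 4 then 1 else n),
    Cod = (\<lambda>n. if n = 3 \<or> n = 4 then 2 else n), Id = (\<lambda>n. n),
    Comp = (\<lambda>g f. if g = 3 \<or> g = 4 then g else f)\<rparr>"

lemma cospan_simps [simp]:
  "Obj cospan = {0, 1, 2}" "Arr cospan = {0, 1, 2, 3, 4}" "Id cospan n = n"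
  "Dom cospan n = (if n = 3 then 0 else if n = 4 then 1 else n)"
  "Cod cospan n = (if n = 3 \<or> n = 4 then 2 else n)"
  "g \<cdot>\<^bsub>cospan\<^esub> f = (if g = 3 \<or> g = 4 then g else f)"
  by (simp_all add: cospan_def)

lemma finite_category_cospan: "finite_category cospan"
  unfolding finite_category_def category_def hom_def by auto

lemma (in category) pullback_exists:
  assumes "has_finite_limits A" and f: "f \<in> Arr A" and g: "g \<in> Arr A" and fg: "Cod A f = Cod A g"
  shows "\<exists>u w. is_pushout (opp A) f g u w"
proof -
  define D :: "(nat, nat, 'o, 'm) func" where
    "D = \<lparr>omap = (\<lambda>n. if n = 0 then Dom A f else if n = 1 then Dom A g else Cod A g),
      amap = (\<lambda>n. if n = 0 then Id A (Dom A f) else if n = 1 then Id A (Dom A g)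
        else if n = 2 then Id A (Cod A g) else if n = 3 then f else g)\<rparr>"
  have D: "is_functor cospan A D"
    unfolding is_functor_def D_def hom_def using f g fg by auto
  then obtain c \<pi> where lim: "is_limit A cospan D c \<pi>"
    using assms(1) finite_category_cospan unfolding has_finite_limits_def by meson
  have cone_iff: "is_cone A cospan D b \<rho> \<longleftrightarrow> b \<in> Obj A \<and> \<rho> 0 \<in> hom A b (Dom A f) \<and>
    \<rho> 1 \<in> hom A b (Dom A g) \<and> \<rho> 2 \<in> hom A b (Cod A g) \<and> f \<cdot>\<^bsub>A\<^esub> \<rho> 0 = \<rho> 2 \<and> g \<cdot>\<^bsub>A\<^esub> \<rho> 1 = \<rho> 2"
    for b \<rho>
  proof -
    have "(\<forall>i j u. u \<in> hom cospan i j \<longrightarrow> amap D u \<cdot>\<^bsub>A\<^esub> \<rho> i = \<rho> j) \<longleftrightarrow>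
        (\<forall>u \<in> Arr cospan. amap D u \<cdot>\<^bsub>A\<^esub> \<rho> (Dom cospan u) = \<rho> (Cod cospan u))"
      by (auto simp: hom_def simp del: cospan_simps)
    then show ?thesis
      unfolding is_cone_def by (auto simp: D_def hom_def simp del: One_nat_def)
  qed
  have cone: "is_cone A cospan D c \<pi>" using lim by (simp add: is_limit_def)
  have "is_pushout (opp A) f g (\<pi> 0) (\<pi> 1)"
    unfolding is_pushout_def
  proof (intro conjI allI impI)
    fix b x y
    assume x: "x \<in> hom (opp A) (Cod (opp A) f) b" and y: "y \<in> hom (opp A) (Cod (opp A) g) b"
      and xy: "x \<cdot>\<^bsub>opp A\<^esub> f = y \<cdot>\<^bsub>opp A\<^esub> g"
    define \<rho> where "\<rho> = (\<lambda>n::nat. if n = 0 then x else if n = 1 then y else f \<cdot>\<^bsub>A\<^esub> x)"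
    have "is_cone A cospan D b \<rho>"
      unfolding cone_iff \<rho>_def using x y xy f g fg by (auto simp: hom_def)
    then have "\<exists>!m. m \<in> hom A b c \<and> (\<forall>j \<in> Obj cospan. \<pi> j \<cdot>\<^bsub>A\<^esub> m = \<rho> j)"
      using lim by (auto simp: is_limit_def)
    moreover have "m \<in> hom A b c \<and> (\<forall>j \<in> Obj cospan. \<pi> j \<cdot>\<^bsub>A\<^esub> m = \<rho> j) \<longleftrightarrow>
        m \<in> hom A b c \<and> \<pi> 0 \<cdot>\<^bsub>A\<^esub> m = x \<and> \<pi> 1 \<cdot>\<^bsub>A\<^esub> m = y" for m
    proof -
      have "\<pi> 2 \<cdot>\<^bsub>A\<^esub> m = f \<cdot>\<^bsub>A\<^esub> (\<pi> 0 \<cdot>\<^bsub>A\<^esub> m)" if "m \<in> hom A b c"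
        using cone that f unfolding cone_iff by (auto simp: hom_def comp_eq_pre)
      then show ?thesis by (auto simp: \<rho>_def)
    qed
    ultimately show "\<exists>!m. m \<in> hom (opp A) (Cod (opp A) (\<pi> 0)) b \<and>
        m \<cdot>\<^bsub>opp A\<^esub> \<pi> 0 = x \<and> m \<cdot>\<^bsub>opp A\<^esub> \<pi> 1 = y"
      using cone unfolding cone_iff by (simp add: hom_def conj_ac)
  qed (use cone f g fg cone_iff in \<open>auto simp: hom_def\<close>)
  then show ?thesis by blast
qed

section \<open>Pushouts of endofunctors\<close>

lemma is_functorD:
  assumes "is_functor A B F"
  shows "a \<in> Obj A \<Longrightarrow> omap F a \<in> Obj B"
    "f \<in> Arr A \<Longrightarrow> amap F f \<in> Arr B"
    "f \<in> Arr A \<Longrightarrow> Dom B (amap F f) = omap F (Dom A f)"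
    "f \<in> Arr A \<Longrightarrow> Cod B (amap F f) = omap F (Cod A f)"
    "a \<in> Obj A \<Longrightarrow> amap F (Id A a) = Id B (omap F a)"
    "f \<in> Arr A \<Longrightarrow> g \<in> Arr A \<Longrightarrow> Dom A g = Cod A f \<Longrightarrow>
      amap F (g \<cdot>\<^bsub>A\<^esub> f) = amap F g \<cdot>\<^bsub>B\<^esub> amap F f"
  using assms unfolding is_functor_def hom_def by auto

lemma nat_transD:
  assumes "nat_trans A F G \<eta>"
  shows "a \<in> Obj A \<Longrightarrow> \<eta> a \<in> Arr A" "a \<in> Obj A \<Longrightarrow> Dom A (\<eta> a) = omap F a"
    "a \<in> Obj A \<Longrightarrow> Cod A (\<eta> a) = omap G a"
    "f \<in> Arr A \<Longrightarrow> amap G f \<cdot>\<^bsub>A\<^esub> \<eta> (Dom A f) = \<eta> (Cod A f) \<cdot>\<^bsub>A\<^esub> amap F f"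
  using assms unfolding nat_trans_def hom_def by auto

text \<open>The objectwise pushouts assemble into a functor \<open>T\<close> that has the same universal property
  as \<open>S\<close>; comparing the two shows that the components of \<open>S\<close> are pushouts as well.\<close>

lemma (in category) endofunctor_pushout_objectwise:
  assumes po: "is_endofunctor_pushout A K F G S f g r0 r1"
    and ex: "\<And>f g. f \<in> Arr A \<Longrightarrow> g \<in> Arr A \<Longrightarrow> Dom A f = Dom A g \<Longrightarrow>
      \<exists>u w. is_pushout A f g u w"
    and a: "a \<in> Obj A"
  shows "is_pushout A (f a) (g a) (r0 a) (r1 a)"
proof -
  have K: "is_functor A A K" and F: "is_functor A A F" and G: "is_functor A A G"
    and S: "is_functor A A S" and f: "nat_trans A K F f" and g: "nat_trans A K G g"
    and r0: "nat_trans A F S r0" and r1: "nat_trans A G S r1"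
    and comm: "\<And>a. a \<in> Obj A \<Longrightarrow> r0 a \<cdot>\<^bsub>A\<^esub> f a = r1 a \<cdot>\<^bsub>A\<^esub> g a"
    using po unfolding is_endofunctor_pushout_def by auto
  note [simp] = is_functorD[OF K] is_functorD[OF F] is_functorD[OF G] is_functorD[OF S]
    nat_transD(1-3)[OF f] nat_transD(1-3)[OF g] nat_transD(1-3)[OF r0] nat_transD(1-3)[OF r1]
  have "\<exists>u w. is_pushout A (f a) (g a) u w" if "a \<in> Obj A" for a
    using that by (intro ex) auto
  then obtain u w where uw: "\<And>a. a \<in> Obj A \<Longrightarrow> is_pushout A (f a) (g a) (u a) (w a)"
    by metis
  have uw_arr [simp]: "u a \<in> Arr A" "w a \<in> Arr A" "Dom A (u a) = omap F a" "Dom A (w a) = omap G a"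
    "Cod A (w a) = Cod A (u a)" if "a \<in> Obj A" for a
    using is_pushoutD[OF uw[OF that]] that by auto
  have uw_comm: "u a \<cdot>\<^bsub>A\<^esub> f a = w a \<cdot>\<^bsub>A\<^esub> g a" if "a \<in> Obj A" for a
    using is_pushoutD[OF uw[OF that]] by auto
  have "\<exists>t. t \<in> Arr A \<and> Dom A t = Cod A (u (Dom A h)) \<and> Cod A t = Cod A (u (Cod A h)) \<and>
      t \<cdot>\<^bsub>A\<^esub> u (Dom A h) = u (Cod A h) \<cdot>\<^bsub>A\<^esub> amap F h \<and>
      t \<cdot>\<^bsub>A\<^esub> w (Dom A h) = w (Cod A h) \<cdot>\<^bsub>A\<^esub> amap G h" if h: "h \<in> Arr A" for h
  proof -
    have "(u (Cod A h) \<cdot>\<^bsub>A\<^esub> amap F h) \<cdot>\<^bsub>A\<^esub> f (Dom A h) = u (Cod A h) \<cdot>\<^bsub>A\<^esub> (f (Cod A h) \<cdot>\<^bsub>A\<^esub> amap K h)"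
      using h nat_transD(4)[OF f h] by simp
    also have "\<dots> = w (Cod A h) \<cdot>\<^bsub>A\<^esub> (g (Cod A h) \<cdot>\<^bsub>A\<^esub> amap K h)"
      using h comp_eq_pre[OF uw_comm[of "Cod A h"], of "amap K h"] by simp
    also have "\<dots> = (w (Cod A h) \<cdot>\<^bsub>A\<^esub> amap G h) \<cdot>\<^bsub>A\<^esub> g (Dom A h)"
      using h nat_transD(4)[OF g h] by simp
    finally obtain t where "t \<in> Arr A" "Dom A t = Cod A (u (Dom A h))"
      "Cod A t = Cod A (u (Cod A h) \<cdot>\<^bsub>A\<^esub> amap F h)"
      "t \<cdot>\<^bsub>A\<^esub> u (Dom A h) = u (Cod A h) \<cdot>\<^bsub>A\<^esub> amap F h"
      "t \<cdot>\<^bsub>A\<^esub> w (Dom A h) = w (Cod A h) \<cdot>\<^bsub>A\<^esub> amap G h"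
      by (rule is_pushout_ex[OF uw[of "Dom A h"], rotated -2]) (use h in simp_all)
    then show ?thesis using h by auto
  qed
  then obtain t where t [simp]: "\<And>h. h \<in> Arr A \<Longrightarrow> t h \<in> Arr A"
      "\<And>h. h \<in> Arr A \<Longrightarrow> Dom A (t h) = Cod A (u (Dom A h))"
      "\<And>h. h \<in> Arr A \<Longrightarrow> Cod A (t h) = Cod A (u (Cod A h))"
    and tu: "\<And>h. h \<in> Arr A \<Longrightarrow> t h \<cdot>\<^bsub>A\<^esub> u (Dom A h) = u (Cod A h) \<cdot>\<^bsub>A\<^esub> amap F h"
    and tw: "\<And>h. h \<in> Arr A \<Longrightarrow> t h \<cdot>\<^bsub>A\<^esub> w (Dom A h) = w (Cod A h) \<cdot>\<^bsub>A\<^esub> amap G h"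
    by metis
  define T :: "('o, 'm) endofunc" where "T = \<lparr>omap = (\<lambda>a. Cod A (u a)), amap = t\<rparr>"
  have T_simps [simp]: "omap T a = Cod A (u a)" "amap T h = t h" for a h
    by (simp_all add: T_def)
  have "is_functor A A T"
    unfolding is_functor_def
  proof (intro conjI ballI allI impI)
    fix a assume a: "a \<in> Obj A"
    show "amap T (Id A a) = Id A (omap T a)"
      by (rule is_pushout_unique[OF uw[OF a]]) (use a tu[of "Id A a"] tw[of "Id A a"] in simp_all)
  next
    fix a b c h k assume "h \<in> hom A a b" "k \<in> hom A b c"
    note [simp] = homD[OF this(1)] homD[OF this(2)]
    have a: "a \<in> Obj A" using dom_cod_obj(1)[of h] by simp
    show "amap T (k \<cdot>\<^bsub>A\<^esub> h) = amap T k \<cdot>\<^bsub>A\<^esub> amap T h"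
      by (rule is_pushout_unique[OF uw[OF a]])
        (use tu[of h] tu[of k] tu[of "k \<cdot>\<^bsub>A\<^esub> h"] tw[of h] tw[of k] tw[of "k \<cdot>\<^bsub>A\<^esub> h"] a
          comp_eq_pre[OF tu[of k], of "amap F h"] comp_eq_pre[OF tw[of k], of "amap G h"]
          dom_cod_obj[of h] dom_cod_obj[of k] in \<open>simp_all del: dom_cod_obj\<close>)
  qed (auto simp: hom_def)
  moreover have "nat_trans A F T u" "nat_trans A G T w"
    unfolding nat_trans_def using tu tw by (auto simp: hom_def)
  ultimately obtain m where m: "nt_factors A S T r0 r1 u w m"
    using po uw_comm unfolding is_endofunctor_pushout_def by meson
  have m_nat: "nat_trans A S T m" and m0: "\<And>a. a \<in> Obj A \<Longrightarrow> m a \<cdot>\<^bsub>A\<^esub> r0 a = u a"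
    and m1: "\<And>a. a \<in> Obj A \<Longrightarrow> m a \<cdot>\<^bsub>A\<^esub> r1 a = w a"
    using m unfolding nt_factors_def by auto
  note [simp] = nat_transD(1-3)[OF m_nat]
  have "\<exists>n. n \<in> Arr A \<and> Dom A n = Cod A (u a) \<and> Cod A n = omap S a \<and>
      n \<cdot>\<^bsub>A\<^esub> u a = r0 a \<and> n \<cdot>\<^bsub>A\<^esub> w a = r1 a" if a: "a \<in> Obj A" for a
    by (rule is_pushout_ex[OF uw[OF a], of "r0 a" "r1 a"]) (use a comm in \<open>simp_all, blast\<close>)
  then obtain n where n [simp]: "\<And>a. a \<in> Obj A \<Longrightarrow> n a \<in> Arr A"
      "\<And>a. a \<in> Obj A \<Longrightarrow> Dom A (n a) = Cod A (u a)" "\<And>a. a \<in> Obj A \<Longrightarrow> Cod A (n a) = omap S a"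
    and n0: "\<And>a. a \<in> Obj A \<Longrightarrow> n a \<cdot>\<^bsub>A\<^esub> u a = r0 a"
    and n1: "\<And>a. a \<in> Obj A \<Longrightarrow> n a \<cdot>\<^bsub>A\<^esub> w a = r1 a"
    by metis
  have n_nat: "amap S h \<cdot>\<^bsub>A\<^esub> n (Dom A h) = n (Cod A h) \<cdot>\<^bsub>A\<^esub> t h" if h: "h \<in> Arr A" for h
    by (rule is_pushout_unique[OF uw[of "Dom A h"]])
      (use h tu[OF h] tw[OF h] n0[of "Dom A h"] n1[of "Dom A h"]
        comp_eq_pre[OF n0[of "Cod A h"], of "amap F h"] comp_eq_pre[OF n1[of "Cod A h"], of "amap G h"]
        nat_transD(4)[OF r0 h] nat_transD(4)[OF r1 h] in simp_all)
  have "nt_factors A S S r0 r1 r0 r1 (\<lambda>a. n a \<cdot>\<^bsub>A\<^esub> m a)"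
    unfolding nt_factors_def nat_trans_def
  proof (intro conjI ballI allI impI)
    fix a b h assume "h \<in> hom A a b"
    note [simp] = homD[OF this]
    have "a \<in> Obj A" "b \<in> Obj A" using dom_cod_obj[of h] by simp_all
    then show "amap S h \<cdot>\<^bsub>A\<^esub> n a \<cdot>\<^bsub>A\<^esub> m a = (n b \<cdot>\<^bsub>A\<^esub> m b) \<cdot>\<^bsub>A\<^esub> amap S h"
      using n_nat[of h] nat_transD(4)[OF m_nat, of h] comp_eq_pre[OF n_nat[of h], of "m a"] by simp
  qed (auto simp: hom_def m0 m1 n0 n1)
  moreover have "nt_factors A S S r0 r1 r0 r1 (\<lambda>a. Id A (omap S a))"
    unfolding nt_factors_def nat_trans_def
    by (auto simp: hom_def)
  ultimately have nm: "n a \<cdot>\<^bsub>A\<^esub> m a = Id A (omap S a)" if "a \<in> Obj A" for a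
    using po S r0 r1 comm that unfolding is_endofunctor_pushout_def by meson
  show ?thesis
    unfolding is_pushout_def
  proof (intro conjI allI impI)
    fix b x y
    assume "x \<in> hom A (Cod A (f a)) b" "y \<in> hom A (Cod A (g a)) b"
      and xy: "x \<cdot>\<^bsub>A\<^esub> f a = y \<cdot>\<^bsub>A\<^esub> g a"
    then have [simp]: "x \<in> Arr A" "y \<in> Arr A" "Dom A x = omap F a" "Dom A y = omap G a"
      "Cod A x = b" "Cod A y = b" using a by (auto simp: hom_def)
    obtain l where l [simp]: "l \<in> Arr A" "Dom A l = Cod A (u a)" "Cod A l = b"
      and l0: "l \<cdot>\<^bsub>A\<^esub> u a = x" and l1: "l \<cdot>\<^bsub>A\<^esub> w a = y"
      by (rule is_pushout_ex[OF uw[OF a], of x y]) (use a xy in simp_all)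
    show "\<exists>!z. z \<in> hom A (Cod A (r0 a)) b \<and> z \<cdot>\<^bsub>A\<^esub> r0 a = x \<and> z \<cdot>\<^bsub>A\<^esub> r1 a = y"
    proof (intro ex1I conjI)
      fix z assume "z \<in> hom A (Cod A (r0 a)) b \<and> z \<cdot>\<^bsub>A\<^esub> r0 a = x \<and> z \<cdot>\<^bsub>A\<^esub> r1 a = y"
      then have [simp]: "z \<in> Arr A" "Dom A z = omap S a" "Cod A z = b"
        and z: "z \<cdot>\<^bsub>A\<^esub> r0 a = x" "z \<cdot>\<^bsub>A\<^esub> r1 a = y" using a by (auto simp: hom_def)
      have "z \<cdot>\<^bsub>A\<^esub> n a = l"
        by (rule is_pushout_unique[OF uw[OF a]]) (use a in \<open>simp_all add: n0 n1 l0 l1 z\<close>)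
      then have "l \<cdot>\<^bsub>A\<^esub> m a = z \<cdot>\<^bsub>A\<^esub> (n a \<cdot>\<^bsub>A\<^esub> m a)"
        using a by (auto simp: comp_eq_pre)
      then show "z = l \<cdot>\<^bsub>A\<^esub> m a" using a nm by simp
    qed (use a m0 m1 l0 l1 in \<open>auto simp: hom_def\<close>)
  qed (use a comm in auto)
qed

section \<open>Concatenation of homotopies\<close>

text \<open>An inclusion \<open>j\<close> of a strong deformation retract, with the homotopy \<open>H\<close> from \<open>j r\<close> to the
  identity constant along \<open>j\<close>. The category is an explicit argument because the dual notion, a
  map that deforms onto a section over its target, is this one read in \<open>opp A\<close>.\<close>

definition sdr ::
  "('o, 'm) cat \<Rightarrow> ('o, 'm) endofunc \<Rightarrow> ('o \<Rightarrow> 'm) \<Rightarrow> ('o \<Rightarrow> 'm) \<Rightarrow> ('o \<Rightarrow> 'm) \<Rightarrow>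
    'm \<Rightarrow> 'm \<Rightarrow> 'm \<Rightarrow> bool" where
  "sdr A I i0 i1 p j r H \<longleftrightarrow>
    j \<in> Arr A \<and> r \<in> hom A (Cod A j) (Dom A j) \<and> r \<cdot>\<^bsub>A\<^esub> j = Id A (Dom A j) \<and>
    cyl_homotopy A I i0 i1 (Cod A j) (Cod A j) (j \<cdot>\<^bsub>A\<^esub> r) (Id A (Cod A j)) H \<and>
    H \<cdot>\<^bsub>A\<^esub> amap I j = j \<cdot>\<^bsub>A\<^esub> p (Dom A j)"

text \<open>The structure is one that both a cylinder in \<open>A\<close> and a co-cylinder, seen as a cylinder in
  \<open>opp A\<close>, carry, so that each result applies in both categories.\<close>

locale structured_cylinder = category A for A :: "('o, 'm) cat" (structure) +
  fixes I S :: "('o, 'm) endofunc" and i0 i1 p v r0 r1 s \<Gamma>ul \<Gamma>lr :: "'o \<Rightarrow> 'm"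
  assumes pushouts: "has_finite_limits (opp A)"
    and cyl: "cylinder A I i0 i1"
    and contr: "contraction A I i0 i1 p"
    and inv: "involution A I i0 i1 v" and inv_comp: "involution_compatible A v p"
    and subdiv: "subdivision A I i0 i1 S r0 r1 s"
    and ul: "upper_left_connection A I i0 i1 p \<Gamma>ul"
    and lr: "lower_right_connection A I i0 i1 p \<Gamma>lr"
    and lr_comp: "lower_right_compatible A I p \<Gamma>lr"
    and pres: "preserves_mapping_cylinders A I i0"
    and strict: "strict_identities A I i0 i1 p S r0 r1 s"
begin

lemma I_functor: "is_functor A A I"
  and i0_nat_trans: "nat_trans A id_func I i0" and i1_nat_trans: "nat_trans A id_func I i1"
  and p_nat_trans: "nat_trans A I id_func p" and v_nat_trans: "nat_trans A I I v"
  and \<Gamma>ul_nat_trans: "nat_trans A (comp_func I I) I \<Gamma>ul"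
  and \<Gamma>lr_nat_trans: "nat_trans A (comp_func I I) I \<Gamma>lr"
  and r0_nat_trans: "nat_trans A I S r0" and r1_nat_trans: "nat_trans A I S r1"
  and s_nat_trans: "nat_trans A I S s" and S_functor: "is_functor A A S"
  using cyl contr inv subdiv ul lr
  unfolding cylinder_def contraction_def involution_def subdivision_def
    is_endofunctor_pushout_def upper_left_connection_def lower_right_connection_def by auto

lemmas [simp] = is_functorD[OF I_functor] is_functorD[OF S_functor]

lemma nat_arr [simp]:
  assumes "a \<in> Obj A"
  shows "i0 a \<in> Arr A" "Dom A (i0 a) = a" "Cod A (i0 a) = omap I a"
    "i1 a \<in> Arr A" "Dom A (i1 a) = a" "Cod A (i1 a) = omap I a"
    "p a \<in> Arr A" "Dom A (p a) = omap I a" "Cod A (p a) = a"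
    "v a \<in> Arr A" "Dom A (v a) = omap I a" "Cod A (v a) = omap I a"
    "\<Gamma>ul a \<in> Arr A" "Dom A (\<Gamma>ul a) = omap I (omap I a)" "Cod A (\<Gamma>ul a) = omap I a"
    "\<Gamma>lr a \<in> Arr A" "Dom A (\<Gamma>lr a) = omap I (omap I a)" "Cod A (\<Gamma>lr a) = omap I a"
    "r0 a \<in> Arr A" "Dom A (r0 a) = omap I a" "Cod A (r0 a) = omap S a"
    "r1 a \<in> Arr A" "Dom A (r1 a) = omap I a" "Cod A (r1 a) = omap S a"
    "s a \<in> Arr A" "Dom A (s a) = omap I a" "Cod A (s a) = omap S a"
  using nat_transD(1-3)[OF i0_nat_trans assms] nat_transD(1-3)[OF i1_nat_trans assms]
    nat_transD(1-3)[OF p_nat_trans assms] nat_transD(1-3)[OF v_nat_trans assms]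
    nat_transD(1-3)[OF \<Gamma>ul_nat_trans assms] nat_transD(1-3)[OF \<Gamma>lr_nat_trans assms]
    nat_transD(1-3)[OF r0_nat_trans assms] nat_transD(1-3)[OF r1_nat_trans assms]
    nat_transD(1-3)[OF s_nat_trans assms]
  by (simp_all add: id_func_def comp_func_def)

text \<open>As rewrite rules these give a normal form of composites: the inclusions \<open>i0\<close> and \<open>i1\<close> as far to the left, the
  transformations out of \<open>I\<close> as far to the right as naturality allows.\<close>

lemma nat_simps [simp]:
  assumes "f \<in> Arr A"
  shows "a = Dom A f \<Longrightarrow> amap I f \<cdot> i0 a = i0 (Cod A f) \<cdot> f"
    "a = Dom A f \<Longrightarrow> amap I f \<cdot> i1 a = i1 (Cod A f) \<cdot> f"
    "b = Cod A f \<Longrightarrow> p b \<cdot> amap I f = f \<cdot> p (Dom A f)"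
    "b = Cod A f \<Longrightarrow> v b \<cdot> amap I f = amap I f \<cdot> v (Dom A f)"
    "b = Cod A f \<Longrightarrow> \<Gamma>ul b \<cdot> amap I (amap I f) = amap I f \<cdot> \<Gamma>ul (Dom A f)"
    "b = Cod A f \<Longrightarrow> \<Gamma>lr b \<cdot> amap I (amap I f) = amap I f \<cdot> \<Gamma>lr (Dom A f)"
    "b = Cod A f \<Longrightarrow> r0 b \<cdot> amap I f = amap S f \<cdot> r0 (Dom A f)"
    "b = Cod A f \<Longrightarrow> r1 b \<cdot> amap I f = amap S f \<cdot> r1 (Dom A f)"
    "b = Cod A f \<Longrightarrow> s b \<cdot> amap I f = amap S f \<cdot> s (Dom A f)"
  using nat_transD(4)[OF i0_nat_trans assms] nat_transD(4)[OF i1_nat_trans assms]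
    nat_transD(4)[OF p_nat_trans assms] nat_transD(4)[OF v_nat_trans assms]
    nat_transD(4)[OF \<Gamma>ul_nat_trans assms] nat_transD(4)[OF \<Gamma>lr_nat_trans assms]
    nat_transD(4)[OF r0_nat_trans assms] nat_transD(4)[OF r1_nat_trans assms]
    nat_transD(4)[OF s_nat_trans assms]
  by (simp_all add: id_func_def comp_func_def)

lemma nat_simps_pre [simp]:
  assumes "f \<in> Arr A" "x \<in> Arr A"
  shows "a = Dom A f \<Longrightarrow> Cod A x = a \<Longrightarrow> amap I f \<cdot> i0 a \<cdot> x = i0 (Cod A f) \<cdot> f \<cdot> x"
    "a = Dom A f \<Longrightarrow> Cod A x = a \<Longrightarrow> amap I f \<cdot> i1 a \<cdot> x = i1 (Cod A f) \<cdot> f \<cdot> x"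
    "b = Cod A f \<Longrightarrow> Cod A x = omap I (Dom A f) \<Longrightarrow>
      p b \<cdot> amap I f \<cdot> x = f \<cdot> p (Dom A f) \<cdot> x"
    "b = Cod A f \<Longrightarrow> Cod A x = omap I (Dom A f) \<Longrightarrow>
      v b \<cdot> amap I f \<cdot> x = amap I f \<cdot> v (Dom A f) \<cdot> x"
    "b = Cod A f \<Longrightarrow> Cod A x = omap I (omap I (Dom A f)) \<Longrightarrow>
      \<Gamma>ul b \<cdot> amap I (amap I f) \<cdot> x = amap I f \<cdot> \<Gamma>ul (Dom A f) \<cdot> x"
    "b = Cod A f \<Longrightarrow> Cod A x = omap I (omap I (Dom A f)) \<Longrightarrow>
      \<Gamma>lr b \<cdot> amap I (amap I f) \<cdot> x = amap I f \<cdot> \<Gamma>lr (Dom A f) \<cdot> x"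
  using assms by (auto simp: comp_eq_pre[OF nat_simps(1)] comp_eq_pre[OF nat_simps(2)] comp_eq_pre[OF nat_simps(3)]
      comp_eq_pre[OF nat_simps(4)] comp_eq_pre[OF nat_simps(5)] comp_eq_pre[OF nat_simps(6)])

lemma faces [simp]:
  assumes "a \<in> Obj A"
  shows "p a \<cdot> i0 a = Id A a" "p a \<cdot> i1 a = Id A a" "v a \<cdot> i0 a = i1 a" "v a \<cdot> i1 a = i0 a"
    "p a \<cdot> v a = p a"
    "s a \<cdot> i0 a = r1 a \<cdot> i0 a" "s a \<cdot> i1 a = r0 a \<cdot> i1 a" "r0 a \<cdot> i0 a = r1 a \<cdot> i1 a"
    "\<Gamma>ul a \<cdot> i0 (omap I a) = Id A (omap I a)" "\<Gamma>ul a \<cdot> amap I (i0 a) = Id A (omap I a)"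
    "\<Gamma>ul a \<cdot> i1 (omap I a) = i1 a \<cdot> p a" "\<Gamma>ul a \<cdot> amap I (i1 a) = i1 a \<cdot> p a"
    "\<Gamma>lr a \<cdot> i1 (omap I a) = Id A (omap I a)" "\<Gamma>lr a \<cdot> amap I (i1 a) = Id A (omap I a)"
    "\<Gamma>lr a \<cdot> i0 (omap I a) = i0 a \<cdot> p a" "\<Gamma>lr a \<cdot> amap I (i0 a) = i0 a \<cdot> p a"
    "p a \<cdot> \<Gamma>lr a = p a \<cdot> p (omap I a)"
  using assms contr inv inv_comp subdiv ul lr lr_comp
  unfolding contraction_def involution_def involution_compatible_def subdivision_def
    is_endofunctor_pushout_def upper_left_connection_def lower_right_connection_def
    lower_right_compatible_def by auto

lemma faces_pre [simp]:
  assumes "a \<in> Obj A" "x \<in> Arr A"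
  shows "Cod A x = a \<Longrightarrow> p a \<cdot> i0 a \<cdot> x = x" "Cod A x = a \<Longrightarrow> p a \<cdot> i1 a \<cdot> x = x"
    "Cod A x = a \<Longrightarrow> v a \<cdot> i0 a \<cdot> x = i1 a \<cdot> x" "Cod A x = a \<Longrightarrow> v a \<cdot> i1 a \<cdot> x = i0 a \<cdot> x"
    "Cod A x = omap I a \<Longrightarrow> p a \<cdot> v a \<cdot> x = p a \<cdot> x"
    "Cod A x = omap I a \<Longrightarrow> \<Gamma>ul a \<cdot> i0 (omap I a) \<cdot> x = x"
    "Cod A x = omap I a \<Longrightarrow> \<Gamma>ul a \<cdot> amap I (i0 a) \<cdot> x = x"
    "Cod A x = omap I a \<Longrightarrow> \<Gamma>ul a \<cdot> i1 (omap I a) \<cdot> x = i1 a \<cdot> p a \<cdot> x"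
    "Cod A x = omap I a \<Longrightarrow> \<Gamma>ul a \<cdot> amap I (i1 a) \<cdot> x = i1 a \<cdot> p a \<cdot> x"
    "Cod A x = omap I a \<Longrightarrow> \<Gamma>lr a \<cdot> i1 (omap I a) \<cdot> x = x"
    "Cod A x = omap I a \<Longrightarrow> \<Gamma>lr a \<cdot> amap I (i1 a) \<cdot> x = x"
    "Cod A x = omap I a \<Longrightarrow> \<Gamma>lr a \<cdot> i0 (omap I a) \<cdot> x = i0 a \<cdot> p a \<cdot> x"
    "Cod A x = omap I a \<Longrightarrow> \<Gamma>lr a \<cdot> amap I (i0 a) \<cdot> x = i0 a \<cdot> p a \<cdot> x"
    "Cod A x = omap I (omap I a) \<Longrightarrow> p a \<cdot> \<Gamma>lr a \<cdot> x = p a \<cdot> p (omap I a) \<cdot> x"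
  using assms by (auto simp: comp_eq_pre[OF faces(1)] comp_eq_pre[OF faces(2)] comp_eq_pre[OF faces(3)]
      comp_eq_pre[OF faces(4)] comp_eq_pre[OF faces(5)] comp_eq_pre[OF faces(9)] comp_eq_pre[OF faces(10)] comp_eq_pre[OF faces(11)]
      comp_eq_pre[OF faces(12)] comp_eq_pre[OF faces(13)] comp_eq_pre[OF faces(14)] comp_eq_pre[OF faces(15)] comp_eq_pre[OF faces(16)]
      comp_eq_pre[OF faces(17)])

lemma pushout_exists:
  assumes "f \<in> Arr A" "g \<in> Arr A" "Dom A f = Dom A g"
  shows "\<exists>u w. is_pushout A f g u w"
  using category.pullback_exists[OF category_opp[OF category_axioms] pushouts, of f g] assms
  by simp

lemma S_pushout: "a \<in> Obj A \<Longrightarrow> is_pushout A (i0 a) (i1 a) (r0 a) (r1 a)"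
  using endofunctor_pushout_objectwise[of id_func I I S i0 i1 r0 r1 a] subdiv pushout_exists
  unfolding subdivision_def by blast

text \<open>Homotopies are concatenated along the subdivision. As \<open>s i0 = r1 i0\<close>, the half indexed by
  \<open>r1\<close> is passed through first, so \<open>join a h k\<close> means: first \<open>h\<close>, then \<open>k\<close>. The object \<open>a\<close> is an
  argument because it cannot be recovered from \<open>omap I a\<close>.\<close>

definition glue :: "'o \<Rightarrow> 'm \<Rightarrow> 'm \<Rightarrow> 'm" where
  "glue a h k = (SOME w. w \<in> Arr A \<and> Dom A w = omap S a \<and> Cod A w = Cod A h \<and>
    w \<cdot> r1 a = h \<and> w \<cdot> r0 a = k)"

definition join :: "'o \<Rightarrow> 'm \<Rightarrow> 'm \<Rightarrow> 'm" where
  "join a h k = glue a h k \<cdot> s a"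

definition joinable :: "'o \<Rightarrow> 'm \<Rightarrow> 'm \<Rightarrow> bool" where
  "joinable a h k \<longleftrightarrow> a \<in> Obj A \<and> h \<in> Arr A \<and> k \<in> Arr A \<and> Dom A h = omap I a \<and>
    Dom A k = omap I a \<and> Cod A k = Cod A h \<and> h \<cdot> i1 a = k \<cdot> i0 a"

lemma glue:
  assumes "joinable a h k"
  shows "glue a h k \<in> Arr A" "Dom A (glue a h k) = omap S a" "Cod A (glue a h k) = Cod A h"
    "glue a h k \<cdot> r1 a = h" "glue a h k \<cdot> r0 a = k"
proof -
  have "\<exists>w. w \<in> Arr A \<and> Dom A w = omap S a \<and> Cod A w = Cod A h \<and> w \<cdot> r1 a = h \<and> w \<cdot> r0 a = k"
    by (rule is_pushout_ex[OF S_pushout[of a], of k h])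
      (use assms in \<open>auto simp: joinable_def\<close>)
  from someI_ex[OF this] show "glue a h k \<in> Arr A" "Dom A (glue a h k) = omap S a"
    "Cod A (glue a h k) = Cod A h" "glue a h k \<cdot> r1 a = h" "glue a h k \<cdot> r0 a = k"
    unfolding glue_def by auto
qed

lemma glue_eqI:
  assumes "joinable a h k" "w \<in> Arr A" "Dom A w = omap S a" "w \<cdot> r1 a = h" "w \<cdot> r0 a = k"
  shows "glue a h k = w"
proof -
  have a: "a \<in> Obj A" using assms by (simp add: joinable_def)
  show ?thesis
    by (rule is_pushout_unique[OF S_pushout[OF a]])
      (use a assms glue[OF assms(1)] in auto)
qed

lemma join:
  assumes "joinable a h k"
  shows "join a h k \<in> Arr A" "Dom A (join a h k) = omap I a" "Cod A (join a h k) = Cod A h"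
    "join a h k \<cdot> i0 a = h \<cdot> i0 a" "join a h k \<cdot> i1 a = k \<cdot> i1 a"
  using glue[OF assms] assms
  by (auto simp: join_def joinable_def comp_eq_pre)

lemma join_pre:
  assumes "joinable b h k" "f \<in> Arr A" "Cod A f = b" "Dom A f = a"
  shows "joinable a (h \<cdot> amap I f) (k \<cdot> amap I f)"
    "join b h k \<cdot> amap I f = join a (h \<cdot> amap I f) (k \<cdot> amap I f)"
proof -
  have ab: "a \<in> Obj A" "b \<in> Obj A" using assms by auto
  have "h \<cdot> i1 b = k \<cdot> i0 b" using assms by (simp add: joinable_def)
  from comp_eq_pre[OF this] have "h \<cdot> i1 b \<cdot> f = (k \<cdot> i0 b) \<cdot> f"
    using assms ab by (auto simp: joinable_def)
  then show *: "joinable a (h \<cdot> amap I f) (k \<cdot> amap I f)"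
    using assms ab by (auto simp: joinable_def)
  have "glue a (h \<cdot> amap I f) (k \<cdot> amap I f) = glue b h k \<cdot> amap S f"
    by (rule glue_eqI[OF *])
      (use assms ab glue[OF assms(1)] nat_simps(7,8)[of f b, symmetric] in
        \<open>simp_all add: joinable_def comp_eq_pre del: nat_simps(7,8)\<close>)
  then show "join b h k \<cdot> amap I f = join a (h \<cdot> amap I f) (k \<cdot> amap I f)"
    using assms ab glue[OF assms(1)] by (auto simp: join_def joinable_def)
qed

text \<open>Strictness of identities: concatenating with a constant homotopy changes nothing, on the
  nose. Paths in a topological space, traversed at double speed, fail this; here it makes the arguments
  equational.\<close>

lemma join_id:
  assumes a: "a \<in> Obj A" and h: "h \<in> Arr A" "Dom A h = omap I a"
  shows join_id_left: "join a (h \<cdot> i0 a \<cdot> p a) h = h"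
    and join_id_right: "join a h (h \<cdot> i1 a \<cdot> p a) = h"
proof -
  obtain ql qr where ql: "nt_factors A S I r0 r1 (\<lambda>a. Id A (omap I a)) (\<lambda>a. i0 a \<cdot> p a) ql"
    and qls: "ql a \<cdot> s a = Id A (omap I a)"
    and qr: "nt_factors A S I r0 r1 (\<lambda>a. i1 a \<cdot> p a) (\<lambda>a. Id A (omap I a)) qr"
    and qrs: "qr a \<cdot> s a = Id A (omap I a)"
    using strict a unfolding strict_identities_def by blast
  have q: "ql a \<in> Arr A" "Dom A (ql a) = omap S a" "Cod A (ql a) = omap I a"
    "ql a \<cdot> r0 a = Id A (omap I a)" "ql a \<cdot> r1 a = i0 a \<cdot> p a"
    "qr a \<in> Arr A" "Dom A (qr a) = omap S a" "Cod A (qr a) = omap I a"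
    "qr a \<cdot> r0 a = i1 a \<cdot> p a" "qr a \<cdot> r1 a = Id A (omap I a)"
    using ql qr a unfolding nt_factors_def by (auto simp: nat_transD)
  have "glue a (h \<cdot> i0 a \<cdot> p a) h = h \<cdot> ql a"
    by (rule glue_eqI) (use a h q in \<open>auto simp: joinable_def\<close>)
  then show "join a (h \<cdot> i0 a \<cdot> p a) h = h"
    using a h q qls by (simp add: join_def)
  have "glue a h (h \<cdot> i1 a \<cdot> p a) = h \<cdot> qr a"
    by (rule glue_eqI) (use a h q in \<open>auto simp: joinable_def\<close>)
  then show "join a h (h \<cdot> i1 a \<cdot> p a) = h"
    using a h q qrs by (simp add: join_def)
qed

lemma join_const:
  assumes "x \<in> Arr A" "a = Dom A x"
  shows "join a (x \<cdot> p a) (x \<cdot> p a) = x \<cdot> p a"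
  using join_id_left[of a "x \<cdot> p a"] assms by simp

section \<open>The homotopy relation\<close>

definition homotopic :: "'o \<Rightarrow> 'o \<Rightarrow> 'm \<Rightarrow> 'm \<Rightarrow> bool" where
  "homotopic a b f g \<longleftrightarrow> a \<in> Obj A \<and> (\<exists>h. cyl_homotopy A I i0 i1 a b f g h)"

lemma homotopicI:
  assumes "a \<in> Obj A" "h \<in> Arr A" "Dom A h = omap I a" "Cod A h = b" "h \<cdot> i0 a = f" "h \<cdot> i1 a = g"
  shows "homotopic a b f g"
  using assms unfolding homotopic_def cyl_homotopy_def hom_def by blast

lemma homotopicE:
  assumes "homotopic a b f g"
  obtains h where "a \<in> Obj A" "h \<in> Arr A" "Dom A h = omap I a" "Cod A h = b"
    "h \<cdot> i0 a = f" "h \<cdot> i1 a = g"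
  using assms unfolding homotopic_def cyl_homotopy_def hom_def by blast

lemma homotopic_refl:
  assumes "f \<in> hom A a b"
  shows "homotopic a b f f"
  using homD[OF assms] by (intro homotopicI[of _ "f \<cdot> p a"]) auto

lemma homotopic_sym:
  assumes "homotopic a b f g"
  shows "homotopic a b g f"
  using assms
proof (rule homotopicE)
  fix h assume "a \<in> Obj A" "h \<in> Arr A" "Dom A h = omap I a" "Cod A h = b" "h \<cdot> i0 a = f" "h \<cdot> i1 a = g"
  then show ?thesis by (intro homotopicI[of _ "h \<cdot> v a"]) auto
qed

lemma homotopic_trans:
  assumes "homotopic a b f g" "homotopic a b g k"
  shows "homotopic a b f k"
proof -
  obtain h where h: "a \<in> Obj A" "h \<in> Arr A" "Dom A h = omap I a" "Cod A h = b" "h \<cdot> i0 a = f" "h \<cdot> i1 a = g"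
    using assms(1) by (rule homotopicE)
  obtain h' where h': "h' \<in> Arr A" "Dom A h' = omap I a" "Cod A h' = b" "h' \<cdot> i0 a = g" "h' \<cdot> i1 a = k"
    using assms(2) by (rule homotopicE)
  have "joinable a h h'" using h h' by (simp add: joinable_def)
  then show ?thesis
    using h h' join[of a h h'] by (intro homotopicI[of _ "join a h h'"]) auto
qed

lemma homotopic_post:
  assumes "homotopic a b f g" "u \<in> hom A b c"
  shows "homotopic a c (u \<cdot> f) (u \<cdot> g)"
proof -
  obtain h where h: "a \<in> Obj A" "h \<in> Arr A" "Dom A h = omap I a" "Cod A h = b" "h \<cdot> i0 a = f" "h \<cdot> i1 a = g"
    using assms(1) by (rule homotopicE)
  then show ?thesis using homD[OF assms(2)] by (intro homotopicI[of _ "u \<cdot> h"]) auto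
qed

lemma homotopic_pre:
  assumes "homotopic a b f g" "u \<in> hom A c a"
  shows "homotopic c b (f \<cdot> u) (g \<cdot> u)"
proof -
  obtain h where h: "a \<in> Obj A" "h \<in> Arr A" "Dom A h = omap I a" "Cod A h = b" "h \<cdot> i0 a = f" "h \<cdot> i1 a = g"
    using assms(1) by (rule homotopicE)
  then show ?thesis using homD[OF assms(2)] dom_cod_obj(1)[of u]
    by (intro homotopicI[of _ "h \<cdot> amap I u"]) (auto simp: comp_eq_pre)
qed

section \<open>Homotopy equivalences\<close>

abbreviation W :: "'m set" where "W \<equiv> cyl_homotopy_equivalences A I i0 i1"

lemma W_I:
  assumes "f \<in> hom A a b" "g \<in> hom A b a"
    "homotopic a a (g \<cdot> f) (Id A a)" "homotopic b b (f \<cdot> g) (Id A b)"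
  shows "f \<in> W"
  using assms unfolding cyl_homotopy_equivalences_def homotopy_equivalences_def homotopic_def by blast

lemma W_E:
  assumes "f \<in> W"
  obtains g where "f \<in> hom A (Dom A f) (Cod A f)" "g \<in> hom A (Cod A f) (Dom A f)"
    "homotopic (Dom A f) (Dom A f) (g \<cdot> f) (Id A (Dom A f))"
    "homotopic (Cod A f) (Cod A f) (f \<cdot> g) (Id A (Cod A f))"
proof -
  obtain a b g where g: "f \<in> hom A a b" "g \<in> hom A b a"
    "\<exists>h. cyl_homotopy A I i0 i1 a a (g \<cdot> f) (Id A a) h"
    "\<exists>h. cyl_homotopy A I i0 i1 b b (f \<cdot> g) (Id A b) h"
    using assms unfolding cyl_homotopy_equivalences_def homotopy_equivalences_def by auto
  with homD[OF g(1)] dom_cod_obj[of f] show ?thesis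
    by (intro that[of g]) (auto simp: homotopic_def)
qed

lemma W_cancel_right:
  assumes f: "f \<in> W" "f \<in> hom A a b" and xy: "x \<in> hom A b c" "y \<in> hom A b c"
    and h: "homotopic a c (x \<cdot> f) (y \<cdot> f)"
  shows "homotopic b c x y"
proof -
  note [simp] = homD[OF f(2)] homD[OF xy(1)] homD[OF xy(2)]
  obtain g where g: "g \<in> hom A b a" "homotopic b b (f \<cdot> g) (Id A b)"
    using W_E[OF f(1)] by auto
  note [simp] = homD[OF g(1)]
  have "homotopic b c (x \<cdot> (f \<cdot> g)) x" "homotopic b c (y \<cdot> (f \<cdot> g)) y"
    using homotopic_post[OF g(2) xy(1)] homotopic_post[OF g(2) xy(2)] by simp_all
  moreover have "homotopic b c (x \<cdot> (f \<cdot> g)) (y \<cdot> (f \<cdot> g))"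
    using homotopic_pre[OF h g(1)] by simp
  ultimately show ?thesis
    by (blast intro: homotopic_trans homotopic_sym)
qed

lemma W_cancel_left:
  assumes f: "f \<in> W" "f \<in> hom A a b" and xy: "x \<in> hom A c a" "y \<in> hom A c a"
    and h: "homotopic c b (f \<cdot> x) (f \<cdot> y)"
  shows "homotopic c a x y"
proof -
  note [simp] = homD[OF f(2)] homD[OF xy(1)] homD[OF xy(2)]
  obtain g where g: "g \<in> hom A b a" "homotopic a a (g \<cdot> f) (Id A a)"
    using W_E[OF f(1)] by auto
  note [simp] = homD[OF g(1)]
  have "homotopic c a (g \<cdot> (f \<cdot> x)) x" "homotopic c a (g \<cdot> (f \<cdot> y)) y"
    using homotopic_pre[OF g(2) xy(1)] homotopic_pre[OF g(2) xy(2)] by simp_all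
  moreover have "homotopic c a (g \<cdot> (f \<cdot> x)) (g \<cdot> (f \<cdot> y))"
    using homotopic_post[OF h g(1)] by simp
  ultimately show ?thesis
    by (blast intro: homotopic_trans homotopic_sym)
qed

lemma W_two_out_of_three: "two_out_of_three A W"
  unfolding two_out_of_three_def
proof (intro allI impI conjI; elim conjE)
  fix a b c f g
  assume hf: "f \<in> hom A a b" and hg: "g \<in> hom A b c"
  note [simp] = homD[OF hf] homD[OF hg]
  {
    assume f: "f \<in> W" and g: "g \<in> W"
    obtain f' where f': "f' \<in> hom A b a" "homotopic a a (f' \<cdot> f) (Id A a)"
      "homotopic b b (f \<cdot> f') (Id A b)"
      using W_E[OF f] by auto
    obtain g' where g': "g' \<in> hom A c b" "homotopic b b (g' \<cdot> g) (Id A b)"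
      "homotopic c c (g \<cdot> g') (Id A c)"
      using W_E[OF g] by auto
    note [simp] = homD[OF f'(1)] homD[OF g'(1)]
    have "homotopic a a (f' \<cdot> g' \<cdot> g \<cdot> f) (f' \<cdot> f)"
      using homotopic_post[OF homotopic_pre[OF g'(2) hf] f'(1)] by simp
    moreover have "homotopic c c (g \<cdot> f \<cdot> f' \<cdot> g') (g \<cdot> g')"
      using homotopic_post[OF homotopic_pre[OF f'(3) g'(1)] hg] by simp
    ultimately show "g \<cdot> f \<in> W"
      using f' g' by (intro W_I[of _ a c "f' \<cdot> g'"])
        (auto intro: homotopic_trans simp: hom_def)
  next
    assume f: "f \<in> W" and gf: "g \<cdot> f \<in> W"
    obtain k where k: "k \<in> hom A c a" "homotopic a a (k \<cdot> g \<cdot> f) (Id A a)"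
      "homotopic c c (g \<cdot> f \<cdot> k) (Id A c)"
      using W_E[OF gf] by (auto simp: hom_def)
    note [simp] = homD[OF k(1)]
    have "homotopic a b ((f \<cdot> k \<cdot> g) \<cdot> f) (Id A b \<cdot> f)"
      using homotopic_post[OF k(2) hf] by simp
    then have "homotopic b b (f \<cdot> k \<cdot> g) (Id A b)"
      by (rule W_cancel_right[OF f hf, rotated -1]) (use dom_cod_obj[of g] in \<open>auto simp: hom_def\<close>)
    then show "g \<in> W"
      using k by (intro W_I[of _ b c "f \<cdot> k"]) (auto simp: hom_def)
  next
    assume g: "g \<in> W" and gf: "g \<cdot> f \<in> W"
    obtain k where k: "k \<in> hom A c a" "homotopic a a (k \<cdot> g \<cdot> f) (Id A a)"
      "homotopic c c (g \<cdot> f \<cdot> k) (Id A c)"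
      using W_E[OF gf] by (auto simp: hom_def)
    note [simp] = homD[OF k(1)]
    have "homotopic b c (g \<cdot> (f \<cdot> k \<cdot> g)) (g \<cdot> Id A b)"
      using homotopic_pre[OF k(3) hg] by simp
    then have "homotopic b b (f \<cdot> k \<cdot> g) (Id A b)"
      by (rule W_cancel_left[OF g hg, rotated -1]) (use dom_cod_obj[of g] in \<open>auto simp: hom_def\<close>)
    then show "f \<in> W"
      using k by (intro W_I[of _ a b "k \<cdot> g"]) (auto simp: hom_def)
  }
qed

section \<open>Cofibrations and strong deformation retracts\<close>

abbreviation C :: "'m set" where "C \<equiv> cofibrations A I i0"

lemma cofE:
  assumes "j \<in> C" "f \<in> Arr A" "Dom A f = Cod A j" "h \<in> Arr A" "Dom A h = omap I (Dom A j)"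
    "Cod A h = Cod A f" "h \<cdot> i0 (Dom A j) = f \<cdot> j"
  obtains k where "k \<in> Arr A" "Dom A k = omap I (Cod A j)" "Cod A k = Cod A f"
    "k \<cdot> amap I j = h" "k \<cdot> i0 (Cod A j) = f"
proof -
  have "f \<in> hom A (Cod A j) (Cod A f)" "h \<in> hom A (omap I (Dom A j)) (Cod A f)"
    using assms by (auto simp: hom_def)
  then have "\<exists>k \<in> hom A (omap I (Cod A j)) (Cod A f). k \<cdot> amap I j = h \<and> k \<cdot> i0 (Cod A j) = f"
    using assms(1,7) unfolding cofibrations_def by (auto simp: hom_def)
  then show ?thesis using that by (auto simp: hom_def)
qed

lemma cofI:
  assumes "j \<in> Arr A"
    and "\<And>f h. f \<in> Arr A \<Longrightarrow> Dom A f = Cod A j \<Longrightarrow> h \<in> Arr A \<Longrightarrow> Dom A h = omap I (Dom A j) \<Longrightarrow>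
      Cod A h = Cod A f \<Longrightarrow> h \<cdot> i0 (Dom A j) = f \<cdot> j \<Longrightarrow>
      \<exists>k. k \<in> Arr A \<and> Dom A k = omap I (Cod A j) \<and> Cod A k = Cod A f \<and>
        k \<cdot> amap I j = h \<and> k \<cdot> i0 (Cod A j) = f"
  shows "j \<in> C"
proof -
  have "\<exists>k \<in> hom A (omap I (Cod A j)) x. k \<cdot> amap I j = h \<and> k \<cdot> i0 (Cod A j) = f"
    if "f \<in> hom A (Cod A j) x" "h \<in> hom A (omap I (Dom A j)) x" "h \<cdot> i0 (Dom A j) = f \<cdot> j" for f h x
    using assms(2)[of f h] that by (auto simp: hom_def)
  then show ?thesis
    unfolding cofibrations_def using assms(1) by (auto simp: hom_def)
qed

lemma cof_arr: "j \<in> C \<Longrightarrow> j \<in> Arr A"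
  unfolding cofibrations_def by (auto simp: hom_def)

lemma mapping_cylinder_ex:
  assumes "f \<in> Arr A"
  obtains d0 d1 where "is_pushout A (i0 (Dom A f)) f d0 d1"
    "is_pushout A (amap I (i0 (Dom A f))) (amap I f) (amap I d0) (amap I d1)"
proof -
  obtain d0 d1 where "is_pushout A (i0 (Dom A f)) f d0 d1"
    using pushout_exists[of "i0 (Dom A f)" f] assms by auto
  moreover from this have "is_pushout A (amap I (i0 (Dom A f))) (amap I f) (amap I d0) (amap I d1)"
    using pres assms unfolding preserves_mapping_cylinders_def is_mapping_cylinder_def by simp
  ultimately show ?thesis by (rule that)
qed

text \<open>A cofibration is an inclusion with a retraction \<open>\<rho>\<close> of \<open>I b\<close> onto the mapping cylinder.
  Since \<open>I\<close> preserves the mapping cylinder, applying \<open>I\<close> to \<open>\<rho>\<close> extends homotopies of homotopies in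
  the inner coordinate, with prescribed value on \<open>I (i0 b)\<close>.\<close>

lemma cof_extend_inner:
  assumes j: "j \<in> C" and E: "E \<in> Arr A" "Dom A E = omap I (Cod A j)"
    and D: "D \<in> Arr A" "Dom A D = omap I (omap I (Dom A j))" "Cod A D = Cod A E"
    and DE: "D \<cdot> amap I (i0 (Dom A j)) = E \<cdot> amap I j"
  obtains k where "k \<in> Arr A" "Dom A k = omap I (omap I (Cod A j))" "Cod A k = Cod A E"
    "k \<cdot> amap I (amap I j) = D" "k \<cdot> amap I (i0 (Cod A j)) = E"
proof -
  have [simp]: "j \<in> Arr A" using j by (rule cof_arr)
  obtain d0 d1 where po: "is_pushout A (i0 (Dom A j)) j d0 d1"
    and Ipo: "is_pushout A (amap I (i0 (Dom A j))) (amap I j) (amap I d0) (amap I d1)"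
    using mapping_cylinder_ex[of j] by auto
  note [simp] = is_pushoutD(3,4,7,8)[OF po]
  have [simp]: "Dom A d0 = omap I (Dom A j)" using is_pushoutD(6)[OF po] by simp
  obtain \<rho> where \<rho>: "\<rho> \<in> Arr A" "Dom A \<rho> = omap I (Cod A j)" "Cod A \<rho> = Cod A d0"
    "\<rho> \<cdot> amap I j = d0" "\<rho> \<cdot> i0 (Cod A j) = d1"
    by (rule cofE[OF j, of d1 d0]) (use is_pushoutD(9)[OF po] in auto)
  obtain w where w: "w \<in> Arr A" "Dom A w = Cod A (amap I d0)" "Cod A w = Cod A D"
    "w \<cdot> amap I d0 = D" "w \<cdot> amap I d1 = E"
    by (rule is_pushout_ex[OF Ipo, of D E]) (use D E DE in auto)
  have "amap I \<rho> \<cdot> amap I (amap I j) = amap I (\<rho> \<cdot> amap I j)"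
    "amap I \<rho> \<cdot> amap I (i0 (Cod A j)) = amap I (\<rho> \<cdot> i0 (Cod A j))"
    using \<rho>(1-3) by simp_all
  with \<rho> w D show ?thesis
    by (intro that[of "w \<cdot> amap I \<rho>"]) auto
qed

lemma sdrI:
  assumes "j \<in> Arr A" "r \<in> Arr A" "Dom A r = Cod A j" "Cod A r = Dom A j" "r \<cdot> j = Id A (Dom A j)"
    "H \<in> Arr A" "Dom A H = omap I (Cod A j)" "Cod A H = Cod A j"
    "H \<cdot> i0 (Cod A j) = j \<cdot> r" "H \<cdot> i1 (Cod A j) = Id A (Cod A j)"
    "H \<cdot> amap I j = j \<cdot> p (Dom A j)"
  shows "sdr A I i0 i1 p j r H"
  using assms by (auto simp: sdr_def cyl_homotopy_def hom_def)

lemma sdrD: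
  assumes "sdr A I i0 i1 p j r H"
  shows "j \<in> Arr A" "r \<in> Arr A" "Dom A r = Cod A j" "Cod A r = Dom A j" "r \<cdot> j = Id A (Dom A j)"
    "H \<in> Arr A" "Dom A H = omap I (Cod A j)" "Cod A H = Cod A j"
    "H \<cdot> i0 (Cod A j) = j \<cdot> r" "H \<cdot> i1 (Cod A j) = Id A (Cod A j)"
    "H \<cdot> amap I j = j \<cdot> p (Dom A j)"
  using assms by (auto simp: sdr_def cyl_homotopy_def hom_def)

text \<open>A homotopy inverse of \<open>j\<close> is deformed, by extending the homotopy from \<open>g j\<close> to the identity, to
  a strict retraction.\<close>

lemma trivial_cof_retraction:
  assumes j: "j \<in> C" and jW: "j \<in> W"
  obtains r where "r \<in> hom A (Cod A j) (Dom A j)" "r \<cdot> j = Id A (Dom A j)"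
    "homotopic (Cod A j) (Cod A j) (Id A (Cod A j)) (j \<cdot> r)"
proof -
  obtain g where jh: "j \<in> hom A (Dom A j) (Cod A j)" and g: "g \<in> hom A (Cod A j) (Dom A j)"
    and gj: "homotopic (Dom A j) (Dom A j) (g \<cdot> j) (Id A (Dom A j))"
    and jg: "homotopic (Cod A j) (Cod A j) (j \<cdot> g) (Id A (Cod A j))"
    using W_E[OF jW] by blast
  note [simp] = homD(1)[OF jh] homD[OF g]
  obtain K where K: "K \<in> Arr A" "Dom A K = omap I (Dom A j)" "Cod A K = Dom A j"
    "K \<cdot> i0 (Dom A j) = g \<cdot> j" "K \<cdot> i1 (Dom A j) = Id A (Dom A j)"
    using homotopicE[OF gj] by blast
  obtain k where k: "k \<in> Arr A" "Dom A k = omap I (Cod A j)" "Cod A k = Dom A j"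
    "k \<cdot> amap I j = K" "k \<cdot> i0 (Cod A j) = g"
    by (rule cofE[OF j, of g K]) (use K in auto)
  define r where "r = k \<cdot> i1 (Cod A j)"
  have "r \<cdot> j = (k \<cdot> amap I j) \<cdot> i1 (Dom A j)"
    using k(1-3) by (simp add: r_def)
  also have "\<dots> = Id A (Dom A j)" using k K by simp
  finally have rj: "r \<cdot> j = Id A (Dom A j)" .
  have r: "r \<in> hom A (Cod A j) (Dom A j)" using k by (simp add: r_def hom_def)
  have "homotopic (Cod A j) (Dom A j) g r"
    using k by (intro homotopicI[of _ k]) (auto simp: r_def)
  from homotopic_post[OF this jh] have "homotopic (Cod A j) (Cod A j) (j \<cdot> r) (Id A (Cod A j))"
    using jg homotopic_sym homotopic_trans by blast
  then show ?thesis using that r rj homotopic_sym by blast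
qed

lemma join_rel:
  assumes "joinable b h k" "j \<in> Arr A" "Cod A j = b" "h \<cdot> amap I j = x \<cdot> p (Dom A j)"
    "k \<cdot> amap I j = x \<cdot> p (Dom A j)" "x \<in> Arr A" "Dom A x = Dom A j"
  shows "join b h k \<cdot> amap I j = x \<cdot> p (Dom A j)"
  using join_pre(2)[OF assms(1-3) refl] join_const[of x "Dom A j"] assms by simp

text \<open>The argument of Dold. Let \<open>H\<close> be a homotopy from the identity to \<open>j r\<close> and \<open>G\<close> its
  restriction along \<open>j\<close>, a loop at \<open>j\<close>. The homotopy \<open>H\<close> followed by the reverse of \<open>H (j r)\<close>
  restricts along \<open>j\<close> to \<open>G\<close> followed by its reverse, which contracts with its ends fixed, through
  a square \<open>D\<close> made from the two connections. Extending \<open>D\<close> along \<open>j\<close> in the inner coordinate and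
  running along the three other sides of the resulting square gives a homotopy from the identity to
  \<open>j r\<close> that is constant along \<open>j\<close>.\<close>

lemma trivial_cof_sdr:
  assumes j: "j \<in> C" and jW: "j \<in> W"
  shows "\<exists>r H. sdr A I i0 i1 p j r H"
proof -
  define a b where "a = Dom A j" and "b = Cod A j"
  have [simp]: "j \<in> Arr A" "Dom A j = a" "Cod A j = b"
    using cof_arr[OF j] by (simp_all add: a_def b_def)
  have [simp]: "a \<in> Obj A" "b \<in> Obj A"
    using dom_cod_obj[of j] by simp_all
  obtain r where r: "r \<in> hom A b a" and rj: "r \<cdot> j = Id A a" and "homotopic b b (Id A b) (j \<cdot> r)"
    using trivial_cof_retraction[OF j jW] by auto
  then obtain H where H: "H \<in> Arr A" "Dom A H = omap I b" "Cod A H = b"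
    "H \<cdot> i0 b = Id A b" "H \<cdot> i1 b = j \<cdot> r"
    using homotopicE by metis
  note [simp] = homD[OF r] H rj comp_eq_pre[OF rj] comp_eq_pre[OF H(4)] comp_eq_pre[OF H(5)]
  define G where "G = H \<cdot> amap I j"
  have G [simp]: "G \<in> Arr A" "Dom A G = omap I a" "Cod A G = b" "G \<cdot> i0 a = j" "G \<cdot> i1 a = j"
    by (simp_all add: G_def)
  note [simp] = comp_eq_pre[OF G(4)] comp_eq_pre[OF G(5)]
  have rj': "amap I r \<cdot> amap I j = Id A (omap I a)"
    using is_functorD(6)[OF I_functor, of j r] by simp
  define H' where "H' = H \<cdot> v b \<cdot> amap I j \<cdot> amap I r"
  have H' [simp]: "H' \<in> Arr A" "Dom A H' = omap I b" "Cod A H' = b" "H' \<cdot> i0 b = j \<cdot> r" "H' \<cdot> i1 b = j \<cdot> r"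
    by (simp_all add: H'_def)
  have joinE: "joinable b H H'" by (simp add: joinable_def)
  note E = join[OF joinE]
  have "H' \<cdot> amap I j = G \<cdot> v a" by (simp add: H'_def G_def comp_eq_pre[OF rj'])
  then have Ej: "join b H H' \<cdot> amap I j = join a G (G \<cdot> v a)"
    using join_pre(2)[OF joinE, of j a] by (simp add: G_def)
  \<comment> \<open>The outer coordinate is the time of the loop, the inner one that of the contraction. In the
    first square the connection with inner coordinate reversed has \<open>G\<close> at inner time 0 and the
    reverse of \<open>G\<close> at outer time 1, where the second square takes over.\<close>
  define \<alpha> \<beta> where "\<alpha> = G \<cdot> \<Gamma>lr a \<cdot> amap I (v a)" and "\<beta> = G \<cdot> v a \<cdot> \<Gamma>ul a"
  have v_faces: "amap I (v a) \<cdot> amap I (i0 a) = amap I (i1 a)"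
    "amap I (v a) \<cdot> amap I (i1 a) = amap I (i0 a)"
    using is_functorD(6)[OF I_functor, of "i0 a" "v a"] is_functorD(6)[OF I_functor, of "i1 a" "v a"]
    by simp_all
  have \<alpha>: "\<alpha> \<in> Arr A" "Dom A \<alpha> = omap I (omap I a)" "Cod A \<alpha> = b" "\<alpha> \<cdot> i0 (omap I a) = j \<cdot> p a"
    "\<alpha> \<cdot> i1 (omap I a) = G \<cdot> v a" "\<alpha> \<cdot> amap I (i0 a) = G" "\<alpha> \<cdot> amap I (i1 a) = j \<cdot> p a"
    by (simp_all add: \<alpha>_def v_faces)
  have \<beta>: "\<beta> \<in> Arr A" "Dom A \<beta> = omap I (omap I a)" "Cod A \<beta> = b" "\<beta> \<cdot> i0 (omap I a) = G \<cdot> v a"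
    "\<beta> \<cdot> i1 (omap I a) = j \<cdot> p a" "\<beta> \<cdot> amap I (i0 a) = G \<cdot> v a" "\<beta> \<cdot> amap I (i1 a) = j \<cdot> p a"
    by (simp_all add: \<beta>_def)
  have joinD: "joinable (omap I a) \<alpha> \<beta>" using \<alpha> \<beta> by (simp add: joinable_def)
  define D where "D = join (omap I a) \<alpha> \<beta>"
  have D [simp]: "D \<in> Arr A" "Dom A D = omap I (omap I a)" "Cod A D = b"
    "D \<cdot> i0 (omap I a) = j \<cdot> p a" "D \<cdot> i1 (omap I a) = j \<cdot> p a"
    using join[OF joinD] \<alpha> \<beta> by (simp_all add: D_def)
  have D_i0: "D \<cdot> amap I (i0 a) = join a G (G \<cdot> v a)"
    using join_pre(2)[OF joinD, of "i0 a" a] \<alpha> \<beta> by (simp add: D_def)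
  have D_i1: "D \<cdot> amap I (i1 a) = j \<cdot> p a"
    using join_pre(2)[OF joinD, of "i1 a" a] \<alpha> \<beta> join_const[of j a] by (simp add: D_def)
  obtain k where k: "k \<in> Arr A" "Dom A k = omap I (omap I b)" "Cod A k = b"
    and kj: "k \<cdot> amap I (amap I j) = D" and kE: "k \<cdot> amap I (i0 b) = join b H H'"
    by (rule cof_extend_inner[OF j, of "join b H H'" D]) (use D_i0 Ej E in simp_all)
  note [simp] = k
  \<comment> \<open>the three sides of \<open>k\<close> other than \<open>I (i0 b)\<close>; along \<open>j\<close> each of them is constant\<close>
  define T0 T1 T2 where "T0 = k \<cdot> i0 (omap I b)" and "T1 = k \<cdot> amap I (i1 b)"
    and "T2 = k \<cdot> i1 (omap I b) \<cdot> v b"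
  have T_typ [simp]: "T0 \<in> Arr A" "Dom A T0 = omap I b" "Cod A T0 = b" "T1 \<in> Arr A" "Dom A T1 = omap I b" "Cod A T1 = b"
    "T2 \<in> Arr A" "Dom A T2 = omap I b" "Cod A T2 = b"
    by (simp_all add: T0_def T1_def T2_def)
  have k_ends: "k \<cdot> i0 (omap I b) \<cdot> i0 b = Id A b" "k \<cdot> i1 (omap I b) \<cdot> i0 b = j \<cdot> r"
    using arg_cong[OF kE, of "\<lambda>z. z \<cdot> i0 b"] arg_cong[OF kE, of "\<lambda>z. z \<cdot> i1 b"] E by simp_all
  have T01: "T0 \<cdot> i0 b = Id A b" "T0 \<cdot> i1 b = T1 \<cdot> i0 b" "T1 \<cdot> i1 b = T2 \<cdot> i0 b" "T2 \<cdot> i1 b = j \<cdot> r"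
    using k_ends by (simp_all add: T0_def T1_def T2_def)
  have "T0 \<cdot> amap I j = (k \<cdot> amap I (amap I j)) \<cdot> i0 (omap I a)"
    by (simp add: T0_def)
  then have T0j: "T0 \<cdot> amap I j = j \<cdot> p a" by (simp add: kj)
  have "amap I (i1 b) \<cdot> amap I j = amap I (amap I j) \<cdot> amap I (i1 a)"
    using is_functorD(6)[OF I_functor, of j "i1 b"] is_functorD(6)[OF I_functor, of "i1 a" "amap I j"]
    by simp
  then have "T1 \<cdot> amap I j = (k \<cdot> amap I (amap I j)) \<cdot> amap I (i1 a)"
    by (simp add: T1_def)
  then have T1j: "T1 \<cdot> amap I j = j \<cdot> p a" by (simp add: kj D_i1)
  have "T2 \<cdot> amap I j = (k \<cdot> amap I (amap I j)) \<cdot> i1 (omap I a) \<cdot> v a"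
    by (simp add: T2_def)
  then have T2j: "T2 \<cdot> amap I j = j \<cdot> p a" by (simp add: kj comp_eq_pre[OF D(5)])
  have J1: "joinable b T0 T1" using T01 by (simp add: joinable_def)
  have J2: "joinable b (join b T0 T1) T2" using T01 join[OF J1] by (simp add: joinable_def)
  define H1 where "H1 = join b (join b T0 T1) T2"
  have H1: "H1 \<in> Arr A" "Dom A H1 = omap I b" "Cod A H1 = b" "H1 \<cdot> i0 b = Id A b" "H1 \<cdot> i1 b = j \<cdot> r"
    using join[OF J1] join[OF J2] T01 by (simp_all add: H1_def)
  have "H1 \<cdot> amap I j = j \<cdot> p a"
    unfolding H1_def using join_rel[OF J2, of j j] join_rel[OF J1, of j j] T0j T1j T2j by simp
  then have "sdr A I i0 i1 p j r (H1 \<cdot> v b)"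
    using H1 by (intro sdrI) (auto simp: comp_eq_pre)
  then show ?thesis by blast
qed

lemma sdr_W:
  assumes "sdr A I i0 i1 p j r H"
  shows "j \<in> W" "r \<in> W"
proof -
  note [simp] = sdrD[OF assms]
  have "homotopic (Cod A j) (Cod A j) (j \<cdot> r) (Id A (Cod A j))"
    by (rule homotopicI[of _ H]) simp_all
  moreover have "homotopic (Dom A j) (Dom A j) (r \<cdot> j) (Id A (Dom A j))"
    by (simp, rule homotopic_refl) (simp add: hom_def)
  ultimately show "j \<in> W" "r \<in> W"
    by (auto intro: W_I[of j "Dom A j" "Cod A j" r] W_I[of r "Cod A j" "Dom A j" j] simp: hom_def)
qed

text \<open>To extend a homotopy \<open>h\<close> starting at \<open>f j\<close>, first deform \<open>f\<close> to \<open>f j r\<close>, then follow \<open>h r\<close>.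
  Along \<open>j\<close> the first part is constant, so by strictness of identities the whole restricts to \<open>h\<close>.\<close>

lemma sdr_cof:
  assumes "sdr A I i0 i1 p j r H"
  shows "j \<in> C"
proof (rule cofI)
  note [simp] = sdrD[OF assms]
  show "j \<in> Arr A" by simp
  fix f h
  assume f [simp]: "f \<in> Arr A" "Dom A f = Cod A j" "h \<in> Arr A" "Dom A h = omap I (Dom A j)"
    "Cod A h = Cod A f" and hf: "h \<cdot> i0 (Dom A j) = f \<cdot> j"
  define k where "k = f \<cdot> H \<cdot> v (Cod A j)"
  note [simp] = comp_eq_pre[OF sdrD(9)[OF assms]] comp_eq_pre[OF sdrD(10)[OF assms]] comp_eq_pre[OF sdrD(11)[OF assms]] comp_eq_pre[OF hf] hf
  have k [simp]: "k \<in> Arr A" "Dom A k = omap I (Cod A j)" "Cod A k = Cod A f" "k \<cdot> i0 (Cod A j) = f"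
    "k \<cdot> i1 (Cod A j) = f \<cdot> j \<cdot> r"
    by (simp_all add: k_def)
  have J: "joinable (Cod A j) k (h \<cdot> amap I r)"
    by (simp add: joinable_def)
  have "amap I r \<cdot> amap I j = Id A (omap I (Dom A j))"
    using is_functorD(6)[OF I_functor, of j r] by simp
  then have "join (Cod A j) k (h \<cdot> amap I r) \<cdot> amap I j = join (Dom A j) (h \<cdot> i0 (Dom A j) \<cdot> p (Dom A j)) h"
    using join_pre(2)[OF J, of j] comp_eq_pre[OF hf, of "p (Dom A j)"] by (simp add: k_def)
  also have "\<dots> = h" by (rule join_id_left) simp_all
  finally show "\<exists>k. k \<in> Arr A \<and> Dom A k = omap I (Cod A j) \<and> Cod A k = Cod A f \<and>
        k \<cdot> amap I j = h \<and> k \<cdot> i0 (Cod A j) = f"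
    using join[OF J] by (intro exI[of _ "join (Cod A j) k (h \<cdot> amap I r)"]) auto
qed

section \<open>Mapping cylinders\<close>

lemma inclusion_slide:
  assumes "x \<in> Arr A" "f \<in> Arr A" "Cod A f = m" "Dom A x = omap I m" "Dom A f = a"
  shows "x \<cdot> i0 m \<cdot> f = (x \<cdot> amap I f) \<cdot> i0 a" "x \<cdot> i1 m \<cdot> f = (x \<cdot> amap I f) \<cdot> i1 a"
  using assms by auto

text \<open>The end inclusion \<open>j = d0 i1\<close> into the mapping cylinder is a cofibration, and its extensions
  can be chosen naturally and so that constant homotopies extend to constant ones; in
  \<open>opp A\<close> this says that the projection from a mapping co-cylinder is a normally cloven fibration. A
  homotopy \<open>h\<close> of \<open>\<phi> j\<close> is extended as follows. On the cylinder part, \<open>\<phi> d0\<close> is a path ending at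
  \<open>h i0\<close>; at each time it is prolonged by the part of \<open>h\<close> already traversed, which is the square
  \<open>h \<Gamma>lr\<close>. On the other part the extension is constant. The prolongation at time 0 is by a constant
  path, so strictness of identities gives back \<open>\<phi> d0\<close> there.

  The other inclusion \<open>d1\<close> is a strong deformation retract, the homotopy \<open>H\<close> being contraction of
  the cylinder coordinate by \<open>\<Gamma>lr\<close>. Besides, \<open>r H\<close> is constant; by the adjunction this makes
  the dual statement one about strong deformation retracts in \<open>A\<close> again.\<close>

lemma mapping_cylinder_factorisation:
  assumes f: "f \<in> Arr A"
  obtains j r d H where "j \<in> normally_cloven_fibrations (opp A) I i0 p" "j \<in> Arr A" "r \<in> Arr A"
    "Dom A r = Cod A j" "r \<cdot> j = f" "sdr A I i0 i1 p d r H" "r \<cdot> H = r \<cdot> p (Cod A d)"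
proof -
  define a b where "a = Dom A f" and "b = Cod A f"
  have [simp]: "f \<in> Arr A" "Dom A f = a" "Cod A f = b" "a \<in> Obj A" "b \<in> Obj A"
    using f dom_cod_obj[OF f] by (simp_all add: a_def b_def)
  obtain d0 d1 where po: "is_pushout A (i0 a) f d0 d1"
    and Ipo: "is_pushout A (amap I (i0 a)) (amap I f) (amap I d0) (amap I d1)"
    using mapping_cylinder_ex[OF f] by auto
  define m where "m = Cod A d0"
  have d [simp]: "d0 \<in> Arr A" "d1 \<in> Arr A" "Dom A d0 = omap I a" "Dom A d1 = b" "Cod A d0 = m"
    "Cod A d1 = m"
    using is_pushoutD(3,4,6-8)[OF po] by (simp_all add: m_def)
  have m [simp]: "m \<in> Obj A" using dom_cod_obj(2)[OF d(1)] by simp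
  have comm: "d0 \<cdot> i0 a = d1 \<cdot> f" using is_pushoutD(9)[OF po] .
  note comm_pre = comp_eq_pre[OF comm, simplified]
  have M_eq: "x = y" if "x \<in> Arr A" "y \<in> Arr A" "Dom A x = m" "Dom A y = m" "Cod A x = Cod A y"
    "x \<cdot> d0 = y \<cdot> d0" "x \<cdot> d1 = y \<cdot> d1" for x y
    by (rule is_pushout_unique[OF po]) (use that in simp_all)
  have IM_eq: "x = y" if "x \<in> Arr A" "y \<in> Arr A" "Dom A x = omap I m" "Dom A y = omap I m"
    "Cod A x = Cod A y" "x \<cdot> amap I d0 = y \<cdot> amap I d0" "x \<cdot> amap I d1 = y \<cdot> amap I d1" for x y
    by (rule is_pushout_unique[OF Ipo]) (use that in simp_all)
  \<comment> \<open>the subdivision \<open>S a\<close> is the mapping cylinder of \<open>i1 a\<close>, hence is preserved by \<open>I\<close>\<close>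
  have "is_mapping_cylinder A i0 (i1 a) (r0 a) (r1 a)"
    using S_pushout[of a] by (simp add: is_mapping_cylinder_def)
  then have ISpo: "is_pushout A (amap I (i0 a)) (amap I (i1 a)) (amap I (r0 a)) (amap I (r1 a))"
    using pres unfolding preserves_mapping_cylinders_def by fastforce

  define j where "j = d0 \<cdot> i1 a"
  have j [simp]: "j \<in> Arr A" "Dom A j = a" "Cod A j = m" by (simp_all add: j_def)
  define adm where "adm = (\<lambda>\<phi> h. \<phi> \<in> Arr A \<and> Dom A \<phi> = m \<and> h \<in> Arr A \<and> Dom A h = omap I a \<and>
    Cod A h = Cod A \<phi> \<and> h \<cdot> i0 a = \<phi> \<cdot> j)"
  \<comment> \<open>\<open>Sq\<close>: the two squares that are concatenated in the inner coordinate, on the image of \<open>S a\<close>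
    under \<open>I\<close>; \<open>Ext\<close>: the extension. Both are determined by these equations, which yields
    naturality and normality of the choice.\<close>
  define Sq where "Sq = (\<lambda>\<phi> h w. w \<in> Arr A \<and> Dom A w = omap I (omap S a) \<and> Cod A w = Cod A \<phi> \<and>
    w \<cdot> amap I (r1 a) = \<phi> \<cdot> d0 \<cdot> p (omap I a) \<and> w \<cdot> amap I (r0 a) = h \<cdot> \<Gamma>lr a)"
  define Ext where "Ext = (\<lambda>\<phi> h k. k \<in> Arr A \<and> Dom A k = omap I m \<and> Cod A k = Cod A \<phi> \<and>
    k \<cdot> amap I d1 = \<phi> \<cdot> d1 \<cdot> p b \<and> (\<exists>w. Sq \<phi> h w \<and> k \<cdot> amap I d0 = w \<cdot> amap I (s a)))"
  have s_faces: "amap I (s a) \<cdot> amap I (i0 a) = amap I (r1 a) \<cdot> amap I (i0 a)"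
    "amap I (s a) \<cdot> amap I (i1 a) = amap I (r0 a) \<cdot> amap I (i1 a)"
    using is_functorD(6)[OF I_functor, of "i0 a" "s a"] is_functorD(6)[OF I_functor, of "i1 a" "s a"]
      is_functorD(6)[OF I_functor, of "i0 a" "r1 a"] is_functorD(6)[OF I_functor, of "i1 a" "r0 a"]
    by simp_all

  have Ext_ex: "\<exists>k. Ext \<phi> h k" if "adm \<phi> h" for \<phi> h
  proof -
    have [simp]: "\<phi> \<in> Arr A" "Dom A \<phi> = m" "h \<in> Arr A" "Dom A h = omap I a" "Cod A h = Cod A \<phi>"
      and h0: "h \<cdot> i0 a = \<phi> \<cdot> j" using that by (auto simp: adm_def)
    note [simp] = h0 comp_eq_pre[OF h0, simplified]
    obtain w where [simp]: "w \<in> Arr A" "Dom A w = omap I (omap S a)" "Cod A w = Cod A \<phi>"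
      and w0: "w \<cdot> amap I (r0 a) = h \<cdot> \<Gamma>lr a" and w1: "w \<cdot> amap I (r1 a) = \<phi> \<cdot> d0 \<cdot> p (omap I a)"
      by (rule is_pushout_ex[OF ISpo, of "h \<cdot> \<Gamma>lr a" "\<phi> \<cdot> d0 \<cdot> p (omap I a)"])
        (simp_all add: j_def)
    have Sq: "Sq \<phi> h w" using w0 w1 by (simp add: Sq_def)
    have "(w \<cdot> amap I (s a)) \<cdot> amap I (i0 a) = (w \<cdot> amap I (r1 a)) \<cdot> amap I (i0 a)"
      by (simp add: s_faces)
    also have "\<dots> = (\<phi> \<cdot> d1 \<cdot> p b) \<cdot> amap I f"
      unfolding w1 by (simp add: comm_pre)
    finally obtain k where "k \<in> Arr A" "Dom A k = omap I m" "Cod A k = Cod A \<phi>"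
      "k \<cdot> amap I d0 = w \<cdot> amap I (s a)" "k \<cdot> amap I d1 = \<phi> \<cdot> d1 \<cdot> p b"
      by (rule is_pushout_ex[OF Ipo, rotated -2]) simp_all
    then show ?thesis using Sq by (auto simp: Ext_def)
  qed
  have Ext_unique: "k = k'" if kk: "Ext \<phi> h k" "Ext \<phi> h k'" for \<phi> h k k'
  proof -
    obtain w w' where w: "Sq \<phi> h w" "k \<cdot> amap I d0 = w \<cdot> amap I (s a)"
      and w': "Sq \<phi> h w'" "k' \<cdot> amap I d0 = w' \<cdot> amap I (s a)"
      using kk unfolding Ext_def by blast
    have "w = w'"
      by (rule is_pushout_unique[OF ISpo]) (use w w' in \<open>simp_all add: Sq_def\<close>)
    then show ?thesis
      by - (rule IM_eq, use kk w w' in \<open>simp_all add: Ext_def\<close>)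
  qed
  have q: "joinable a (\<phi> \<cdot> d0) (\<phi> \<cdot> d0 \<cdot> i1 a \<cdot> p a)"
      "glue a (\<phi> \<cdot> d0) (\<phi> \<cdot> d0 \<cdot> i1 a \<cdot> p a) \<cdot> s a = \<phi> \<cdot> d0"
    if "\<phi> \<in> Arr A" "Dom A \<phi> = m" for \<phi>
    using that join_id_right[of a "\<phi> \<cdot> d0"] by (simp_all add: joinable_def join_def)

  have Ext_extends: "k \<cdot> amap I j = h" "k \<cdot> i0 m = \<phi>" if adm: "adm \<phi> h" and Ext: "Ext \<phi> h k" for \<phi> h k
  proof -
    have [simp]: "\<phi> \<in> Arr A" "Dom A \<phi> = m" "h \<in> Arr A" "Dom A h = omap I a" "Cod A h = Cod A \<phi>"
      and h0: "h \<cdot> i0 a = \<phi> \<cdot> j" using adm by (auto simp: adm_def)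
    obtain w where [simp]: "k \<in> Arr A" "Dom A k = omap I m" "Cod A k = Cod A \<phi>"
      "w \<in> Arr A" "Dom A w = omap I (omap S a)" "Cod A w = Cod A \<phi>"
      and k1: "k \<cdot> amap I d1 = \<phi> \<cdot> d1 \<cdot> p b" and k0: "k \<cdot> amap I d0 = w \<cdot> amap I (s a)"
      and w1: "w \<cdot> amap I (r1 a) = \<phi> \<cdot> d0 \<cdot> p (omap I a)" and w0: "w \<cdot> amap I (r0 a) = h \<cdot> \<Gamma>lr a"
      using Ext unfolding Ext_def Sq_def by blast
    have "k \<cdot> amap I j = (k \<cdot> amap I d0) \<cdot> amap I (i1 a)" by (simp add: j_def)
    also have "\<dots> = (w \<cdot> amap I (r0 a)) \<cdot> amap I (i1 a)" unfolding k0 by (simp add: s_faces)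
    also have "\<dots> = h" unfolding w0 by simp
    finally show "k \<cdot> amap I j = h" .
    have "glue a (\<phi> \<cdot> d0) (\<phi> \<cdot> d0 \<cdot> i1 a \<cdot> p a) = w \<cdot> i0 (omap S a)"
    proof (rule glue_eqI)
      show "(w \<cdot> i0 (omap S a)) \<cdot> r1 a = \<phi> \<cdot> d0"
        using inclusion_slide(1)[of w "r1 a" "omap S a" "omap I a"] by (simp add: w1)
      show "(w \<cdot> i0 (omap S a)) \<cdot> r0 a = \<phi> \<cdot> d0 \<cdot> i1 a \<cdot> p a"
        using inclusion_slide(1)[of w "r0 a" "omap S a" "omap I a"] by (simp add: w0 comp_eq_pre[OF h0] j_def)
    qed (simp_all add: q)
    then have "w \<cdot> i0 (omap S a) \<cdot> s a = \<phi> \<cdot> d0" using q(2)[of \<phi>] by simp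
    then have "(k \<cdot> i0 m) \<cdot> d0 = \<phi> \<cdot> d0"
      using inclusion_slide(1)[of k d0 m "omap I a"] by (simp add: k0)
    moreover have "(k \<cdot> i0 m) \<cdot> d1 = \<phi> \<cdot> d1"
      using inclusion_slide(1)[of k d1 m b] by (simp add: k1)
    ultimately show "k \<cdot> i0 m = \<phi>" by - (rule M_eq, simp_all)
  qed
  have Ext_const: "Ext \<phi> (\<phi> \<cdot> j \<cdot> p a) (\<phi> \<cdot> p m)" if [simp]: "\<phi> \<in> Arr A" "Dom A \<phi> = m" for \<phi>
  proof -
    note g = glue[OF q(1)[OF that]]
    have "Sq \<phi> (\<phi> \<cdot> j \<cdot> p a) (glue a (\<phi> \<cdot> d0) (\<phi> \<cdot> d0 \<cdot> i1 a \<cdot> p a) \<cdot> p (omap S a))"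
      using g by (simp add: Sq_def j_def comp_eq_pre[OF g(4)] comp_eq_pre[OF g(5)])
    moreover have "(\<phi> \<cdot> p m) \<cdot> amap I d0 =
        (glue a (\<phi> \<cdot> d0) (\<phi> \<cdot> d0 \<cdot> i1 a \<cdot> p a) \<cdot> p (omap S a)) \<cdot> amap I (s a)"
      using g by (simp add: comp_eq_pre[OF q(2)])
    ultimately show ?thesis by (auto simp: Ext_def)
  qed
  have Ext_nat: "Ext (u \<cdot> \<phi>) (u \<cdot> h) (u \<cdot> k)"
    if kk: "adm \<phi> h" "Ext \<phi> h k" "u \<in> Arr A" "Dom A u = Cod A \<phi>" for u \<phi> h k
  proof -
    obtain w where w: "Sq \<phi> h w" "k \<cdot> amap I d0 = w \<cdot> amap I (s a)"
      using kk unfolding Ext_def by blast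
    have "Sq (u \<cdot> \<phi>) (u \<cdot> h) (u \<cdot> w)" "(u \<cdot> k) \<cdot> amap I d0 = (u \<cdot> w) \<cdot> amap I (s a)"
      using w that by (simp_all add: Sq_def Ext_def adm_def)
    then show ?thesis
      using that by (auto simp: Ext_def adm_def)
  qed
  define K where "K = (\<lambda>x::'o. \<lambda>\<phi> h. SOME k. Ext \<phi> h k)"
  have K_Ext: "Ext \<phi> h (K x \<phi> h)" if "adm \<phi> h" for x \<phi> h
    unfolding K_def using someI_ex[OF Ext_ex[OF that]] .
  have K_eq: "K x \<phi> h = k" if "Ext \<phi> h k" for x \<phi> h k
    unfolding K_def using that by (rule some_equality) (rule Ext_unique[OF _ that])
  have "j \<in> normally_cloven_fibrations (opp A) I i0 p"
    unfolding normally_cloven_fibrations_def mem_Collect_eq hom_opp opp_simps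
  proof (rule exI[of _ m], rule exI[of _ a], rule conjI, simp add: hom_def,
      rule exI[of _ K], intro conjI allI impI)
    fix x \<phi> h assume *: "\<phi> \<in> hom A m x" "h \<in> hom A (omap I a) x" "h \<cdot> i0 a = \<phi> \<cdot> j"
    then have adm: "adm \<phi> h" by (simp add: adm_def hom_def)
    show "K x \<phi> h \<in> hom A (omap I m) x" using K_Ext[OF adm] * by (auto simp: Ext_def hom_def)
    show "K x \<phi> h \<cdot> amap I j = h" "K x \<phi> h \<cdot> i0 m = \<phi>"
      using Ext_extends[OF adm K_Ext[OF adm]] by simp_all
  next
    fix x \<phi> assume "\<phi> \<in> hom A m x"
    then show "K x \<phi> ((\<phi> \<cdot> j) \<cdot> p a) = \<phi> \<cdot> p m"
      using K_eq[OF Ext_const[of \<phi>]] by (simp add: hom_def)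
  next
    fix x y \<phi> h u assume *: "\<phi> \<in> hom A m x" "h \<in> hom A (omap I a) x" "h \<cdot> i0 a = \<phi> \<cdot> j"
      "u \<in> hom A x y"
    then have adm: "adm \<phi> h" by (simp add: adm_def hom_def)
    show "K y (u \<cdot> \<phi>) (u \<cdot> h) = u \<cdot> K x \<phi> h"
      by (rule K_eq, rule Ext_nat[OF adm K_Ext[OF adm]]) (use * in \<open>simp_all add: hom_def\<close>)
  qed
  moreover
  obtain r where r [simp]: "r \<in> Arr A" "Dom A r = m" "Cod A r = b"
    and rd: "r \<cdot> d0 = f \<cdot> p a" "r \<cdot> d1 = Id A b"
    by (rule is_pushout_ex[OF po, of "f \<cdot> p a" "Id A b"]) simp_all
  obtain H where H [simp]: "H \<in> Arr A" "Dom A H = omap I m" "Cod A H = m"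
    and Hd: "H \<cdot> amap I d0 = d0 \<cdot> \<Gamma>lr a" "H \<cdot> amap I d1 = d1 \<cdot> p b"
    by (rule is_pushout_ex[OF Ipo, of "d0 \<cdot> \<Gamma>lr a" "d1 \<cdot> p b"]) (simp_all add: comm_pre)
  note [simp] = rd comp_eq_pre[OF rd(1)] comp_eq_pre[OF rd(2)]
  have slideH: "(H \<cdot> i0 m) \<cdot> d0 = (d0 \<cdot> \<Gamma>lr a) \<cdot> i0 (omap I a)" "(H \<cdot> i0 m) \<cdot> d1 = (d1 \<cdot> p b) \<cdot> i0 b"
    "(H \<cdot> i1 m) \<cdot> d0 = (d0 \<cdot> \<Gamma>lr a) \<cdot> i1 (omap I a)" "(H \<cdot> i1 m) \<cdot> d1 = (d1 \<cdot> p b) \<cdot> i1 b"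
    using inclusion_slide[of H d0 m "omap I a"] inclusion_slide[of H d1 m b] unfolding Hd by simp_all
  have H_ends: "H \<cdot> i0 m = d1 \<cdot> r" "H \<cdot> i1 m = Id A m"
    by (rule M_eq, use slideH in \<open>simp_all add: comm_pre\<close>)+
  have "sdr A I i0 i1 p d1 r H"
    by (rule sdrI) (simp_all add: H_ends Hd)
  moreover have "r \<cdot> H = r \<cdot> p m"
    by (rule IM_eq) (simp_all add: Hd)
  ultimately show ?thesis
    using that[of j r d1 H] by (simp add: j_def)
qed

section \<open>Composites and retracts\<close>

lemma normally_cloven_cof: "normally_cloven_fibrations (opp A) I i0 p \<subseteq> C"
proof
  fix j assume "j \<in> normally_cloven_fibrations (opp A) I i0 p"
  then obtain a b k where j: "j \<in> hom A a b" and k: "\<forall>x \<phi> h. \<phi> \<in> hom A b x \<longrightarrow>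
      h \<in> hom A (omap I a) x \<longrightarrow> h \<cdot> i0 a = \<phi> \<cdot> j \<longrightarrow>
      k x \<phi> h \<in> hom A (omap I b) x \<and> k x \<phi> h \<cdot> amap I j = h \<and> k x \<phi> h \<cdot> i0 b = \<phi>"
    unfolding normally_cloven_fibrations_def hom_opp opp_simps by auto
  have "\<exists>k \<in> hom A (omap I b) x. k \<cdot> amap I j = h \<and> k \<cdot> i0 b = \<phi>"
    if "\<phi> \<in> hom A b x" "h \<in> hom A (omap I a) x" "h \<cdot> i0 a = \<phi> \<cdot> j" for x \<phi> h
    using k that by (intro bexI[of _ "k x \<phi> h"]) auto
  then show "j \<in> C" unfolding cofibrations_def using j by blast
qed

lemma cof_comp:
  assumes j: "j \<in> C" and j': "j' \<in> C" and jj: "Dom A j' = Cod A j"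
  shows "j' \<cdot> j \<in> C"
proof (rule cofI)
  note [simp] = cof_arr[OF j] cof_arr[OF j'] jj
  show "j' \<cdot> j \<in> Arr A" by simp
  fix f h
  assume [simp]: "f \<in> Arr A" "Dom A f = Cod A (j' \<cdot> j)" "h \<in> Arr A" "Dom A h = omap I (Dom A (j' \<cdot> j))"
    "Cod A h = Cod A f" and hf: "h \<cdot> i0 (Dom A (j' \<cdot> j)) = f \<cdot> j' \<cdot> j"
  obtain k where [simp]: "k \<in> Arr A" "Dom A k = omap I (Cod A j)" "Cod A k = Cod A f"
    and k: "k \<cdot> amap I j = h" "k \<cdot> i0 (Cod A j) = f \<cdot> j'"
    by (rule cofE[OF j, of "f \<cdot> j'" h]) (use hf in simp_all)
  obtain k' where [simp]: "k' \<in> Arr A" "Dom A k' = omap I (Cod A j')" "Cod A k' = Cod A f"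
    and k': "k' \<cdot> amap I j' = k" "k' \<cdot> i0 (Cod A j') = f"
    by (rule cofE[OF j', of f k]) (use k in simp_all)
  show "\<exists>k. k \<in> Arr A \<and> Dom A k = omap I (Cod A (j' \<cdot> j)) \<and> Cod A k = Cod A f \<and>
      k \<cdot> amap I (j' \<cdot> j) = h \<and> k \<cdot> i0 (Cod A (j' \<cdot> j)) = f"
    by (rule exI[of _ k']) (simp add: k k' comp_eq_pre[OF k'(1)])
qed

lemma cof_retract:
  assumes w: "w \<in> C" and q: "q \<in> Arr A" "Dom A q = Cod A w" and \<sigma>: "\<sigma> \<in> Arr A"
    "Cod A \<sigma> = Cod A w" "Dom A \<sigma> = Cod A q" and "\<sigma> \<cdot> q \<cdot> w = w" and q\<sigma>: "q \<cdot> \<sigma> = Id A (Cod A q)"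
  shows "q \<cdot> w \<in> C"
proof (rule cofI)
  note [simp] = cof_arr[OF w] q \<sigma>
  have \<sigma>': "\<sigma> \<cdot> q \<cdot> w = w" by fact
  show "q \<cdot> w \<in> Arr A" by simp
  fix f h
  assume [simp]: "f \<in> Arr A" "Dom A f = Cod A (q \<cdot> w)" "h \<in> Arr A" "Dom A h = omap I (Dom A (q \<cdot> w))"
    "Cod A h = Cod A f" and hf: "h \<cdot> i0 (Dom A (q \<cdot> w)) = f \<cdot> q \<cdot> w"
  obtain k where [simp]: "k \<in> Arr A" "Dom A k = omap I (Cod A w)" "Cod A k = Cod A f"
    and k: "k \<cdot> amap I w = h" "k \<cdot> i0 (Cod A w) = f \<cdot> q"
    by (rule cofE[OF w, of "f \<cdot> q" h]) (use hf in simp_all)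
  have "amap I \<sigma> \<cdot> amap I (q \<cdot> w) = amap I (\<sigma> \<cdot> (q \<cdot> w))"
    by (rule is_functorD(6)[OF I_functor, symmetric]) simp_all
  then have "amap I \<sigma> \<cdot> amap I (q \<cdot> w) = amap I w" using \<sigma>' by simp
  moreover have "k \<cdot> i0 (Cod A w) \<cdot> \<sigma> = f"
    using comp_eq_pre[OF k(2), of \<sigma>] by (simp add: q\<sigma>)
  ultimately show "\<exists>k. k \<in> Arr A \<and> Dom A k = omap I (Cod A (q \<cdot> w)) \<and> Cod A k = Cod A f \<and>
      k \<cdot> amap I (q \<cdot> w) = h \<and> k \<cdot> i0 (Cod A (q \<cdot> w)) = f"
    by (intro exI[of _ "k \<cdot> amap I \<sigma>"]) (simp add: k)
qed

lemma W_retract_fst: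
  assumes w: "w \<in> W" and q: "q \<in> Arr A" "Dom A q = Cod A w" and \<sigma>: "\<sigma> \<in> Arr A"
    "Cod A \<sigma> = Cod A w" "Dom A \<sigma> = Cod A q" and \<sigma>': "\<sigma> \<cdot> q \<cdot> w = w"
    and q\<sigma>: "q \<cdot> \<sigma> = Id A (Cod A q)"
  shows "q \<cdot> w \<in> W"
proof -
  obtain w' where wh: "w \<in> hom A (Dom A w) (Cod A w)" and w'h: "w' \<in> hom A (Cod A w) (Dom A w)"
    and w'w: "homotopic (Dom A w) (Dom A w) (w' \<cdot> w) (Id A (Dom A w))"
    and ww': "homotopic (Cod A w) (Cod A w) (w \<cdot> w') (Id A (Cod A w))"
    using W_E[OF w] by blast
  note [simp] = homD(1)[OF wh] homD[OF w'h] q \<sigma> \<sigma>'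
  have qh: "q \<in> hom A (Cod A w) (Cod A q)" and \<sigma>h: "\<sigma> \<in> hom A (Cod A q) (Cod A w)"
    by (simp_all add: hom_def)
  show ?thesis
  proof (rule W_I)
    show "q \<cdot> w \<in> hom A (Dom A w) (Cod A q)" "w' \<cdot> \<sigma> \<in> hom A (Cod A q) (Dom A w)"
      by (simp_all add: hom_def)
    show "homotopic (Dom A w) (Dom A w) ((w' \<cdot> \<sigma>) \<cdot> q \<cdot> w) (Id A (Dom A w))"
      using w'w by simp
    show "homotopic (Cod A q) (Cod A q) ((q \<cdot> w) \<cdot> w' \<cdot> \<sigma>) (Id A (Cod A q))"
      using homotopic_pre[OF homotopic_post[OF ww' qh] \<sigma>h] by (simp add: q\<sigma>)
  qed
qed

lemma W_retract_snd:
  assumes q: "q \<in> W" and w: "w \<in> Arr A" "Cod A w = Dom A q" and \<rho>: "\<rho> \<in> Arr A"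
    "Dom A \<rho> = Dom A q" "Cod A \<rho> = Dom A w" and \<rho>': "(q \<cdot> w) \<cdot> \<rho> = q"
    and \<rho>w: "\<rho> \<cdot> w = Id A (Dom A w)"
  shows "q \<cdot> w \<in> W"
proof -
  obtain q' where qh: "q \<in> hom A (Dom A q) (Cod A q)" and q'h: "q' \<in> hom A (Cod A q) (Dom A q)"
    and q'q: "homotopic (Dom A q) (Dom A q) (q' \<cdot> q) (Id A (Dom A q))"
    and qq': "homotopic (Cod A q) (Cod A q) (q \<cdot> q') (Id A (Cod A q))"
    using W_E[OF q] by blast
  note [simp] = homD(1)[OF qh] homD[OF q'h] w \<rho>
  have \<rho>h: "\<rho> \<in> hom A (Dom A q) (Dom A w)" and wh: "w \<in> hom A (Dom A w) (Dom A q)"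
    by (simp_all add: hom_def)
  show ?thesis
  proof (rule W_I)
    show "q \<cdot> w \<in> hom A (Dom A w) (Cod A q)" "\<rho> \<cdot> q' \<in> hom A (Cod A q) (Dom A w)"
      by (simp_all add: hom_def)
    show "homotopic (Dom A w) (Dom A w) ((\<rho> \<cdot> q') \<cdot> q \<cdot> w) (Id A (Dom A w))"
      using homotopic_pre[OF homotopic_post[OF q'q \<rho>h] wh] by (simp add: \<rho>w)
    show "homotopic (Cod A q) (Cod A q) ((q \<cdot> w) \<cdot> \<rho> \<cdot> q') (Id A (Cod A q))"
      using comp_eq_pre[OF \<rho>', of q'] qq' by simp
  qed
qed

end

section \<open>A cylinder left adjoint to a co-cylinder\<close>

locale adjoint_cylinders =
  structured_cylinder A I S i0 i1 p v r0 r1 s \<Gamma>ul \<Gamma>lr +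
  co: structured_cylinder "opp A" P S' e0 e1 c v' r0' r1' s' \<Gamma>ul' \<Gamma>lr'
  for A :: "('o, 'm) cat" (structure) and I S i0 i1 p v r0 r1 s \<Gamma>ul \<Gamma>lr
    and P S' e0 e1 c v' r0' r1' s' \<Gamma>ul' \<Gamma>lr' +
  fixes adj :: "'o \<Rightarrow> 'o \<Rightarrow> 'm \<Rightarrow> 'm"
  assumes adjoint: "cylinder_left_adjoint A I i0 i1 P e0 e1 adj"
    and adjoint_comp: "adjunction_compatible A p c adj"
begin

abbreviation F :: "'m set" where "F \<equiv> normally_cloven_fibrations A P e0 c"

lemma P_functor: "is_functor A A P" using co.I_functor by simp
lemma e0_nat_trans: "nat_trans A P id_func e0" using co.i0_nat_trans by simp
lemma e1_nat_trans: "nat_trans A P id_func e1" using co.i1_nat_trans by simp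
lemma c_nat_trans: "nat_trans A id_func P c" using co.p_nat_trans by simp

lemmas [simp] = is_functorD[OF P_functor]

lemma conat_arr [simp]:
  assumes "a \<in> Obj A"
  shows "e0 a \<in> Arr A" "Dom A (e0 a) = omap P a" "Cod A (e0 a) = a"
    "e1 a \<in> Arr A" "Dom A (e1 a) = omap P a" "Cod A (e1 a) = a"
    "c a \<in> Arr A" "Dom A (c a) = a" "Cod A (c a) = omap P a"
  using nat_transD(1-3)[OF e0_nat_trans assms] nat_transD(1-3)[OF e1_nat_trans assms]
    nat_transD(1-3)[OF c_nat_trans assms]
  by (simp_all add: id_func_def)

lemma conat_simps [simp]:
  assumes "f \<in> Arr A"
  shows "b = Cod A f \<Longrightarrow> e0 b \<cdot> amap P f = f \<cdot> e0 (Dom A f)"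
    "b = Cod A f \<Longrightarrow> e1 b \<cdot> amap P f = f \<cdot> e1 (Dom A f)"
    "a = Dom A f \<Longrightarrow> amap P f \<cdot> c a = c (Cod A f) \<cdot> f"
  using nat_transD(4)[OF e0_nat_trans assms] nat_transD(4)[OF e1_nat_trans assms]
    nat_transD(4)[OF c_nat_trans assms]
  by (simp_all add: id_func_def)

lemma conat_simps_pre [simp]:
  assumes "f \<in> Arr A" "x \<in> Arr A"
  shows "b = Cod A f \<Longrightarrow> Cod A x = omap P (Dom A f) \<Longrightarrow>
      e0 b \<cdot> amap P f \<cdot> x = f \<cdot> e0 (Dom A f) \<cdot> x"
    "b = Cod A f \<Longrightarrow> Cod A x = omap P (Dom A f) \<Longrightarrow>
      e1 b \<cdot> amap P f \<cdot> x = f \<cdot> e1 (Dom A f) \<cdot> x"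
    "a = Dom A f \<Longrightarrow> Cod A x = a \<Longrightarrow> amap P f \<cdot> c a \<cdot> x = c (Cod A f) \<cdot> f \<cdot> x"
  using assms by (auto simp: comp_eq_pre[OF conat_simps(1)] comp_eq_pre[OF conat_simps(2)] comp_eq_pre[OF conat_simps(3)])

lemma cofaces [simp]:
  assumes "a \<in> Obj A"
  shows "e0 a \<cdot> c a = Id A a" "e1 a \<cdot> c a = Id A a"
  using co.contr assms by (auto simp: contraction_def)

lemma cofaces_pre [simp]:
  assumes "a \<in> Obj A" "x \<in> Arr A" "Cod A x = a"
  shows "e0 a \<cdot> c a \<cdot> x = x" "e1 a \<cdot> c a \<cdot> x = x"
  using assms by (auto simp: comp_eq_pre[OF cofaces(1)] comp_eq_pre[OF cofaces(2)])

lemma adj_bij: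
  assumes "a \<in> Obj A" "b \<in> Obj A"
  shows "bij_betw (adj a b) (hom A (omap I a) b) (hom A a (omap P b))"
  using adjoint assms by (auto simp: cylinder_left_adjoint_def adjunction_def)

lemma adj:
  assumes "a \<in> Obj A" "h \<in> Arr A" "Dom A h = omap I a" "Cod A h = b"
  shows "adj a b h \<in> Arr A" "Dom A (adj a b h) = a" "Cod A (adj a b h) = omap P b"
    "e0 b \<cdot> adj a b h = h \<cdot> i0 a" "e1 b \<cdot> adj a b h = h \<cdot> i1 a"
proof -
  have h: "h \<in> hom A (omap I a) b" and b: "b \<in> Obj A" using assms by (auto simp: hom_def)
  show "adj a b h \<in> Arr A" "Dom A (adj a b h) = a" "Cod A (adj a b h) = omap P b"
    using bij_betwE[OF adj_bij[OF assms(1) b]] h by (auto simp: hom_def)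
  show "e0 b \<cdot> adj a b h = h \<cdot> i0 a" "e1 b \<cdot> adj a b h = h \<cdot> i1 a"
    using adjoint h assms(1) b by (auto simp: cylinder_left_adjoint_def)
qed

lemma adj_nat:
  assumes "a \<in> Obj A" "h \<in> Arr A" "Dom A h = omap I a" "Cod A h = b"
    and "u \<in> Arr A" "Dom A u = a'" "Cod A u = a" "g \<in> Arr A" "Dom A g = b" "Cod A g = b'"
  shows "adj a' b' (g \<cdot> h \<cdot> amap I u) = amap P g \<cdot> adj a b h \<cdot> u"
  using adjoint assms unfolding cylinder_left_adjoint_def adjunction_def
  by (auto simp: hom_def)

lemma adj_pre:
  assumes "a \<in> Obj A" "h \<in> Arr A" "Dom A h = omap I a" "Cod A h = b"
    and "u \<in> Arr A" "Dom A u = a'" "Cod A u = a"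
  shows "adj a' b (h \<cdot> amap I u) = adj a b h \<cdot> u"
  using adj_nat[OF assms, of "Id A b" b] adj[OF assms(1-4)] assms dom_cod_obj[OF assms(2)] by simp

lemma adj_post:
  assumes "a \<in> Obj A" "h \<in> Arr A" "Dom A h = omap I a" "Cod A h = b"
    and "g \<in> Arr A" "Dom A g = b" "Cod A g = b'"
  shows "adj a b' (g \<cdot> h) = amap P g \<cdot> adj a b h"
  using adj_nat[OF assms(1-4), of "Id A a" a g b'] adj[OF assms(1-4)] assms by simp

lemma adj_p:
  assumes "f \<in> Arr A" "Dom A f = a" "Cod A f = b"
  shows "adj a b (f \<cdot> p a) = c b \<cdot> f"
  using adjoint_comp assms by (auto simp: adjunction_compatible_def hom_def)

lemma adj_inj:
  assumes "a \<in> Obj A" "h \<in> Arr A" "Dom A h = omap I a" "Cod A h = b"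
    "k \<in> Arr A" "Dom A k = omap I a" "Cod A k = b" "adj a b h = adj a b k"
  shows "h = k"
  using adj_bij[of a b] assms unfolding bij_betw_def inj_on_def
  by (auto simp: hom_def)

lemma adj_surj:
  assumes "g \<in> Arr A" "Dom A g = a" "Cod A g = omap P b" "b \<in> Obj A"
  obtains h where "h \<in> Arr A" "Dom A h = omap I a" "Cod A h = b" "adj a b h = g"
proof -
  have "a \<in> Obj A" using assms by auto
  then have "g \<in> adj a b ` hom A (omap I a) b"
    using adj_bij[of a b] assms unfolding bij_betw_def by (simp add: hom_def)
  then show ?thesis using that by (auto simp: hom_def)
qed

lemma homotopy_adj_iff:
  assumes "a \<in> Obj A" "b \<in> Obj A"
  shows "(\<exists>h. cyl_homotopy A I i0 i1 a b f g h) \<longleftrightarrow> (\<exists>h. cocyl_homotopy A P e0 e1 a b f g h)"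
proof
  assume "\<exists>h. cyl_homotopy A I i0 i1 a b f g h"
  then obtain h where "h \<in> Arr A" "Dom A h = omap I a" "Cod A h = b" "h \<cdot> i0 a = f" "h \<cdot> i1 a = g"
    by (auto simp: cyl_homotopy_def hom_def)
  then have "cocyl_homotopy A P e0 e1 a b f g (adj a b h)"
    using adj[OF assms(1), of h b] by (simp add: cocyl_homotopy_def hom_def)
  then show "\<exists>h. cocyl_homotopy A P e0 e1 a b f g h" ..
next
  assume "\<exists>h. cocyl_homotopy A P e0 e1 a b f g h"
  then obtain h where h: "h \<in> Arr A" "Dom A h = a" "Cod A h = omap P b" "e0 b \<cdot> h = f" "e1 b \<cdot> h = g"
    by (auto simp: cocyl_homotopy_def hom_def)
  obtain k where "k \<in> Arr A" "Dom A k = omap I a" "Cod A k = b" "adj a b k = h"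
    using adj_surj[OF h(1-3) assms(2)] by blast
  then have "cyl_homotopy A I i0 i1 a b f g k"
    using adj[OF assms(1), of k b] h by (simp add: cyl_homotopy_def hom_def)
  then show "\<exists>h. cyl_homotopy A I i0 i1 a b f g h" ..
qed

lemma W_eq_cocyl: "W = cocyl_homotopy_equivalences A P e0 e1"
proof -
  have "a \<in> Obj A" "b \<in> Obj A" if "f \<in> hom A a b" for f a b
    using homD[OF that] dom_cod_obj[of f] by auto
  then show ?thesis
    unfolding cyl_homotopy_equivalences_def cocyl_homotopy_equivalences_def homotopy_equivalences_def
    by (metis (no_types, lifting) homotopy_adj_iff)
qed

lemma co_W_eq: "co.W = W"
proof -
  have "cyl_homotopy (opp A) P e0 e1 a a = cocyl_homotopy A P e0 e1 a a" for a
    by (intro ext) (simp add: cyl_homotopy_def cocyl_homotopy_def)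
  then have "co.W = cocyl_homotopy_equivalences A P e0 e1"
    unfolding cyl_homotopy_equivalences_def cocyl_homotopy_equivalences_def
      homotopy_equivalences_def hom_opp opp_simps by auto
  then show ?thesis by (simp add: W_eq_cocyl)
qed

section \<open>Lifting properties\<close>

lemma fibE:
  assumes "f \<in> F"
  obtains k where "f \<in> Arr A"
    "\<And>a g h. g \<in> hom A a (Dom A f) \<Longrightarrow> h \<in> hom A a (omap P (Cod A f)) \<Longrightarrow>
      e0 (Cod A f) \<cdot> h = f \<cdot> g \<Longrightarrow> k a g h \<in> hom A a (omap P (Dom A f)) \<and>
        amap P f \<cdot> k a g h = h \<and> e0 (Dom A f) \<cdot> k a g h = g"
    "\<And>a g. g \<in> hom A a (Dom A f) \<Longrightarrow> k a g (c (Cod A f) \<cdot> f \<cdot> g) = c (Dom A f) \<cdot> g"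
    "\<And>a b g h u. g \<in> hom A a (Dom A f) \<Longrightarrow> h \<in> hom A a (omap P (Cod A f)) \<Longrightarrow>
      e0 (Cod A f) \<cdot> h = f \<cdot> g \<Longrightarrow> u \<in> hom A b a \<Longrightarrow> k b (g \<cdot> u) (h \<cdot> u) = k a g h \<cdot> u"
proof -
  obtain x y k where f: "f \<in> hom A x y" and k:
    "\<forall>a0 g h. g \<in> hom A a0 x \<longrightarrow> h \<in> hom A a0 (omap P y) \<longrightarrow> e0 y \<cdot> h = f \<cdot> g \<longrightarrow>
          k a0 g h \<in> hom A a0 (omap P x) \<and> amap P f \<cdot> k a0 g h = h \<and> e0 x \<cdot> k a0 g h = g"
    "\<forall>a0 g. g \<in> hom A a0 x \<longrightarrow> k a0 g (c y \<cdot> f \<cdot> g) = c x \<cdot> g"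
    "\<forall>a0 b g h u. g \<in> hom A a0 x \<longrightarrow> h \<in> hom A a0 (omap P y) \<longrightarrow> e0 y \<cdot> h = f \<cdot> g \<longrightarrow>
          u \<in> hom A b a0 \<longrightarrow> k b (g \<cdot> u) (h \<cdot> u) = k a0 g h \<cdot> u"
    using assms unfolding normally_cloven_fibrations_def by auto
  have xy: "Dom A f = x" "Cod A f = y" "f \<in> Arr A" using homD[OF f] by auto
  show ?thesis
    by (rule that[of k]; (unfold xy)?) (use k xy in blast)+
qed

lemma fib_arr: "f \<in> F \<Longrightarrow> f \<in> Arr A"
  by (erule fibE)

text \<open>A path \<open>y\<close> that starts below \<open>l\<close> and is constant along \<open>j\<close> lifts to a path starting at \<open>l\<close>;
  naturality and normality of the cleavage make the lift constant along \<open>j\<close> as well, so that its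
  end point still agrees with \<open>l\<close> there.\<close>

lemma normal_lift:
  assumes f: "f \<in> F" and j: "j \<in> Arr A"
    and l: "l \<in> Arr A" "Dom A l = Cod A j" "Cod A l = Dom A f"
    and y: "y \<in> Arr A" "Dom A y = Cod A j" "Cod A y = omap P (Cod A f)"
    and y0: "e0 (Cod A f) \<cdot> y = f \<cdot> l" and yj: "y \<cdot> j = c (Cod A f) \<cdot> f \<cdot> l \<cdot> j"
  shows "\<exists>l' \<in> hom A (Cod A j) (Dom A f). l' \<cdot> j = l \<cdot> j \<and> f \<cdot> l' = e1 (Cod A f) \<cdot> y"
proof -
  obtain k where fa [simp]: "f \<in> Arr A" and
    k: "\<And>a g h. g \<in> hom A a (Dom A f) \<Longrightarrow> h \<in> hom A a (omap P (Cod A f)) \<Longrightarrow>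
      e0 (Cod A f) \<cdot> h = f \<cdot> g \<Longrightarrow> k a g h \<in> hom A a (omap P (Dom A f)) \<and>
        amap P f \<cdot> k a g h = h \<and> e0 (Dom A f) \<cdot> k a g h = g"
    and k_const: "\<And>a g. g \<in> hom A a (Dom A f) \<Longrightarrow> k a g (c (Cod A f) \<cdot> f \<cdot> g) = c (Dom A f) \<cdot> g"
    and k_nat: "\<And>a b g h u. g \<in> hom A a (Dom A f) \<Longrightarrow> h \<in> hom A a (omap P (Cod A f)) \<Longrightarrow>
      e0 (Cod A f) \<cdot> h = f \<cdot> g \<Longrightarrow> u \<in> hom A b a \<Longrightarrow> k b (g \<cdot> u) (h \<cdot> u) = k a g h \<cdot> u"
    using fibE[OF f] by blast
  note [simp] = j l y
  have lh: "l \<in> hom A (Cod A j) (Dom A f)" and yh: "y \<in> hom A (Cod A j) (omap P (Cod A f))"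
    and jh: "j \<in> hom A (Dom A j) (Cod A j)" and ljh: "l \<cdot> j \<in> hom A (Dom A j) (Dom A f)"
    by (simp_all add: hom_def)
  define z where "z = k (Cod A j) l y"
  have z: "z \<in> Arr A" "Dom A z = Cod A j" "Cod A z = omap P (Dom A f)" "amap P f \<cdot> z = y"
    using k[OF lh yh y0] by (simp_all add: z_def hom_def)
  have zj: "z \<cdot> j = c (Dom A f) \<cdot> l \<cdot> j"
    using k_nat[OF lh yh y0 jh] k_const[OF ljh] yj by (simp add: z_def)
  have "f \<cdot> e1 (Dom A f) \<cdot> z = e1 (Cod A f) \<cdot> amap P f \<cdot> z"
    using z(1-3) by simp
  then have "f \<cdot> e1 (Dom A f) \<cdot> z = e1 (Cod A f) \<cdot> y" using z(4) by simp
  then show ?thesis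
    using z zj by (intro bexI[of _ "e1 (Dom A f) \<cdot> z"]) (simp_all add: hom_def)
qed

text \<open>With a retraction \<open>r\<close> the square has the approximate solution \<open>g r\<close>; the deformation of \<open>j r\<close>
  to the identity is the path along which it is corrected.\<close>

lemma sdr_lift:
  assumes j: "sdr A I i0 i1 p j r H" and f: "f \<in> F"
  shows "lifts_against A j f"
  unfolding lifts_against_def
proof (intro allI impI)
  fix g h assume "g \<in> hom A (Dom A j) (Dom A f)" "h \<in> hom A (Cod A j) (Cod A f)"
    and fg: "f \<cdot> g = h \<cdot> j"
  note [simp] = homD[OF this(1)] homD[OF this(2)] sdrD[OF j] fib_arr[OF f]
  define y where "y = amap P h \<cdot> adj (Cod A j) (Cod A j) H"
  note H = adj[of "Cod A j" H "Cod A j", simplified]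
  have y: "y \<in> Arr A" "Dom A y = Cod A j" "Cod A y = omap P (Cod A f)"
    using H by (simp_all add: y_def)
  have "e0 (Cod A f) \<cdot> y = h \<cdot> j \<cdot> r" "e1 (Cod A f) \<cdot> y = h"
    using H by (simp_all add: y_def)
  moreover have "adj (Cod A j) (Cod A j) H \<cdot> j = c (Cod A j) \<cdot> j"
    using adj_pre[of "Cod A j" H "Cod A j" j "Dom A j"] by (simp add: adj_p)
  then have "y \<cdot> j = c (Cod A f) \<cdot> h \<cdot> j" using H by (simp add: y_def)
  ultimately show "\<exists>l\<in>hom A (Cod A j) (Dom A f). l \<cdot> j = g \<and> f \<cdot> l = h"
    using normal_lift[OF f, of j "g \<cdot> r" y] y fg comp_eq_pre[OF fg, of r] by simp
qed

text \<open>Dually to \<open>trivial_cof_sdr\<close>, \<open>f\<close> has a section \<open>t\<close> with a homotopy \<open>L\<close> over the target from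
  \<open>t f\<close> to the identity. Extending \<open>L g\<close> along the cofibration \<open>j\<close> turns \<open>t h\<close> into a map \<open>l\<close>
  with \<open>l j = g\<close>, and \<open>f l\<close> is homotopic to \<open>h\<close> by a homotopy constant along \<open>j\<close>, which is lifted.\<close>

lemma trivial_fib_lift:
  assumes f: "f \<in> F" "f \<in> W" and j: "j \<in> C"
  shows "lifts_against A j f"
  unfolding lifts_against_def
proof (intro allI impI)
  have "f \<in> co.C" using f(1) co.normally_cloven_cof by auto
  then obtain t K where tK: "sdr (opp A) P e0 e1 c f t K"
    using co.trivial_cof_sdr f(2) co_W_eq by blast
  define E X where "E = Dom A f" and "X = Cod A f"
  have [simp]: "f \<in> Arr A" "Dom A f = E" "Cod A f = X" "E \<in> Obj A" "X \<in> Obj A"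
    using fib_arr[OF f(1)] by (simp_all add: E_def X_def)
  note K [simp] = co.sdrD[OF tK, simplified]
  obtain L where [simp]: "L \<in> Arr A" "Dom A L = omap I E" "Cod A L = E" and L: "adj E E L = K"
    using adj_surj[of K E E] by auto
  have L0 [simp]: "L \<cdot> i0 E = t \<cdot> f" and L1 [simp]: "L \<cdot> i1 E = Id A E"
    using adj(4,5)[of E L E] by (simp_all add: L)
  have fL: "f \<cdot> L = f \<cdot> p E"
    by (rule adj_inj[of E _ X]) (simp_all add: adj_post[of E L E f X] adj_p L)
  fix g h assume "g \<in> hom A (Dom A j) (Dom A f)" "h \<in> hom A (Cod A j) (Cod A f)"
    and fg: "f \<cdot> g = h \<cdot> j"
  note [simp] = homD[OF this(1), simplified] homD[OF this(2), simplified] cof_arr[OF j]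
  note [simp] = comp_eq_pre[OF L0, simplified] comp_eq_pre[OF L1, simplified]
  obtain M where [simp]: "M \<in> Arr A" "Dom A M = omap I (Cod A j)" "Cod A M = E"
    and M: "M \<cdot> amap I j = L \<cdot> amap I g" "M \<cdot> i0 (Cod A j) = t \<cdot> h"
    by (rule cofE[OF j, of "t \<cdot> h" "L \<cdot> amap I g"]) (simp_all add: fg)
  define l where "l = M \<cdot> i1 (Cod A j)"
  have l [simp]: "l \<in> Arr A" "Dom A l = Cod A j" "Cod A l = E" by (simp_all add: l_def)
  have lj: "l \<cdot> j = g"
    using inclusion_slide(2)[of M j "Cod A j" "Dom A j"] by (simp add: l_def M)
  define Y where "Y = f \<cdot> M \<cdot> v (Cod A j)"
  have Y [simp]: "Y \<in> Arr A" "Dom A Y = omap I (Cod A j)" "Cod A Y = X"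
    "Y \<cdot> i0 (Cod A j) = f \<cdot> l" "Y \<cdot> i1 (Cod A j) = h"
    using comp_eq_pre[OF K(5)] by (simp_all add: Y_def l_def M)
  have "Y \<cdot> amap I j = f \<cdot> L \<cdot> amap I g \<cdot> v (Dom A j)"
    using comp_eq_pre[OF M(1), of "v (Dom A j)"] by (simp add: Y_def)
  also have "\<dots> = (f \<cdot> g) \<cdot> p (Dom A j)"
    using comp_eq_pre[OF fL, of "amap I g \<cdot> v (Dom A j)"] by simp
  finally have Yj: "Y \<cdot> amap I j = (f \<cdot> g) \<cdot> p (Dom A j)" .
  have "adj (Cod A j) X Y \<cdot> j = c X \<cdot> f \<cdot> g"
    using adj_pre[of "Cod A j" Y X j "Dom A j"] adj_p[of "f \<cdot> g" "Dom A j" X] unfolding Yj by simp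
  then show "\<exists>l\<in>hom A (Cod A j) (Dom A f). l \<cdot> j = g \<and> f \<cdot> l = h"
    using normal_lift[OF f(1), of j l "adj (Cod A j) X Y"] adj[of "Cod A j" Y X] lj by simp
qed

section \<open>The factorisations\<close>

text \<open>Factorisation through the mapping co-cylinder. The homotopy contracting its paths is
  constant on the image of \<open>w\<close>, so \<open>w\<close> is a strong deformation retract for the cylinder and, by
  strictness of identities, a cofibration.\<close>

lemma factor_trivial_cof_fib:
  assumes f: "f \<in> Arr A"
  obtains w q where "w \<in> C" "w \<in> W" "q \<in> F" "Dom A q = Cod A w" "q \<cdot> w = f"
proof -
  obtain q w d H where q: "q \<in> F" "q \<in> Arr A" and w: "w \<in> Arr A" "Cod A w = Dom A q"
    and qw: "q \<cdot> w = f" and dH: "sdr (opp A) P e0 e1 c d w H" and Hw: "H \<cdot> w = c (Dom A d) \<cdot> w"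
    by (rule co.mapping_cylinder_factorisation[of f, simplified, OF f], rule that; assumption)
  define n where "n = Dom A d"
  note d = co.sdrD[OF dH, unfolded opp_simps, folded n_def]
  have [simp]: "q \<in> Arr A" "w \<in> Arr A" "Cod A w = n" "Dom A q = n" "d \<in> Arr A" "Dom A d = n"
    "Cod A d = Dom A w" "H \<in> Arr A" "Dom A H = n" "Cod A H = omap P n"
    using q(2) w(1) w(2)[symmetric] d(3) d(1,6-8) d(4)[symmetric] n_def[symmetric] by simp_all
  have [simp]: "n \<in> Obj A" using dom_cod_obj(1)[of d] by simp
  obtain L where [simp]: "L \<in> Arr A" "Dom A L = omap I n" "Cod A L = n" and L: "adj n n L = H"
    using adj_surj[of H n n] by auto
  have "L \<cdot> amap I w = w \<cdot> p (Dom A w)"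
    by (rule adj_inj[of "Dom A w" _ n])
      (use Hw in \<open>simp_all add: adj_pre[of n L n w "Dom A w"] adj_p L\<close>)
  then have "sdr A I i0 i1 p w d L"
    using adj(4,5)[of n L n] d(5,9,10) by (intro sdrI) (simp_all add: L)
  then show ?thesis
    using that[of w q] sdr_cof sdr_W q qw by simp
qed

text \<open>The projection \<open>r\<close> of the mapping cylinder is a homotopy equivalence. Factoring \<open>r\<close> itself through a
  mapping co-cylinder turns it into a fibration, at the cost of one more cofibration.\<close>

lemma factor_cof_trivial_fib:
  assumes f: "f \<in> Arr A"
  obtains w q where "w \<in> C" "q \<in> F" "q \<in> W" "Dom A q = Cod A w" "q \<cdot> w = f"
proof -
  obtain j r d H where j: "j \<in> C" and [simp]: "j \<in> Arr A" and r [simp]: "r \<in> Arr A" "Dom A r = Cod A j"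
    and rj: "r \<cdot> j = f" and d: "sdr A I i0 i1 p d r H"
    by (rule mapping_cylinder_factorisation[OF f], rule that[OF subsetD[OF normally_cloven_cof]]; assumption)
  obtain w q where w: "w \<in> C" "w \<in> W" and q: "q \<in> F" and [simp]: "Dom A q = Cod A w" and qw: "q \<cdot> w = r"
    using factor_trivial_cof_fib[OF r(1)] by blast
  have [simp]: "w \<in> Arr A" "q \<in> Arr A" using cof_arr[OF w(1)] fib_arr[OF q] .
  have [simp]: "Dom A w = Cod A j" using r(2) by (simp add: qw[symmetric])
  have "q \<in> W"
    using W_two_out_of_three w(2) sdr_W(2)[OF d] qw unfolding two_out_of_three_def
    by (metis homI \<open>Dom A q = Cod A w\<close> \<open>w \<in> Arr A\<close> \<open>q \<in> Arr A\<close>)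
  moreover have "w \<cdot> j \<in> C" using cof_comp[OF j w(1)] by simp
  moreover have "q \<cdot> w \<cdot> j = f" using comp_eq_pre[OF qw, of j] rj by simp
  ultimately show ?thesis using that[of "w \<cdot> j" q] q by simp
qed

lemma fib_retract:
  assumes q: "q \<in> F" and w: "w \<in> Arr A" "Cod A w = Dom A q" and \<rho>: "\<rho> \<in> Arr A"
    "Dom A \<rho> = Dom A q" "Cod A \<rho> = Dom A w" and \<rho>': "(q \<cdot> w) \<cdot> \<rho> = q"
    and \<rho>w: "\<rho> \<cdot> w = Id A (Dom A w)"
  shows "q \<cdot> w \<in> F"
proof -
  obtain k where [simp]: "q \<in> Arr A" and
    k: "\<And>a g h. g \<in> hom A a (Dom A q) \<Longrightarrow> h \<in> hom A a (omap P (Cod A q)) \<Longrightarrow>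
      e0 (Cod A q) \<cdot> h = q \<cdot> g \<Longrightarrow> k a g h \<in> hom A a (omap P (Dom A q)) \<and>
        amap P q \<cdot> k a g h = h \<and> e0 (Dom A q) \<cdot> k a g h = g"
    and k_const: "\<And>a g. g \<in> hom A a (Dom A q) \<Longrightarrow> k a g (c (Cod A q) \<cdot> q \<cdot> g) = c (Dom A q) \<cdot> g"
    and k_nat: "\<And>a b g h u. g \<in> hom A a (Dom A q) \<Longrightarrow> h \<in> hom A a (omap P (Cod A q)) \<Longrightarrow>
      e0 (Cod A q) \<cdot> h = q \<cdot> g \<Longrightarrow> u \<in> hom A b a \<Longrightarrow> k b (g \<cdot> u) (h \<cdot> u) = k a g h \<cdot> u"
    using fibE[OF q] by blast
  note [simp] = w \<rho>
  define f where "f = q \<cdot> w"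
  have f: "f \<in> hom A (Dom A w) (Cod A q)" and [simp]: "f \<in> Arr A" "Dom A f = Dom A w" "Cod A f = Cod A q"
    by (simp_all add: f_def hom_def)
  have P\<rho>: "amap P f \<cdot> amap P \<rho> = amap P q"
    using \<rho>' is_functorD(6)[OF P_functor, of \<rho> f] by (simp add: f_def)
  have step: "w \<cdot> g \<in> hom A a (Dom A q)" "e0 (Cod A q) \<cdot> h = q \<cdot> w \<cdot> g"
    if "g \<in> hom A a (Dom A w)" "e0 (Cod A q) \<cdot> h = f \<cdot> g" for a g h
    using that by (auto simp: hom_def f_def)
  define k' where "k' = (\<lambda>a g h. amap P \<rho> \<cdot> k a (w \<cdot> g) h)"
  have "f \<in> F"
    unfolding normally_cloven_fibrations_def mem_Collect_eq
  proof (rule exI[of _ "Dom A w"], rule exI[of _ "Cod A q"], rule conjI[OF f],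
      rule exI[of _ k'], intro conjI allI impI)
    fix a g h assume *: "g \<in> hom A a (Dom A w)" "h \<in> hom A a (omap P (Cod A q))"
      "e0 (Cod A q) \<cdot> h = f \<cdot> g"
    note s = step[OF *(1,3)]
    have kk: "k a (w \<cdot> g) h \<in> Arr A" "Dom A (k a (w \<cdot> g) h) = a"
      "Cod A (k a (w \<cdot> g) h) = omap P (Dom A q)" "amap P q \<cdot> k a (w \<cdot> g) h = h"
      "e0 (Dom A q) \<cdot> k a (w \<cdot> g) h = w \<cdot> g"
      using k[OF s(1) *(2) s(2)] by (auto simp: hom_def)
    show "k' a g h \<in> hom A a (omap P (Dom A w))" using kk by (simp add: k'_def hom_def)
    show "amap P f \<cdot> k' a g h = h" using kk comp_eq_pre[OF P\<rho>, of "k a (w \<cdot> g) h"] by (simp add: k'_def)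
    show "e0 (Dom A w) \<cdot> k' a g h = g"
      using kk homD[OF *(1)] comp_eq_pre[OF \<rho>w, of g] by (simp add: k'_def)
  next
    fix a g assume *: "g \<in> hom A a (Dom A w)"
    have "w \<cdot> g \<in> hom A a (Dom A q)" using homD[OF *] by (simp add: hom_def)
    from k_const[OF this] show "k' a g (c (Cod A q) \<cdot> f \<cdot> g) = c (Dom A w) \<cdot> g"
      using homD[OF *] comp_eq_pre[OF \<rho>w, of g] by (simp add: k'_def f_def)
  next
    fix a b g h u assume *: "g \<in> hom A a (Dom A w)" "h \<in> hom A a (omap P (Cod A q))"
      "e0 (Cod A q) \<cdot> h = f \<cdot> g" "u \<in> hom A b a"
    note s = step[OF *(1,3)]
    have "k a (w \<cdot> g) h \<in> hom A a (omap P (Dom A q))" using k[OF s(1) *(2) s(2)] by simp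
    then show "k' b (g \<cdot> u) (h \<cdot> u) = k' a g h \<cdot> u"
      using k_nat[OF s(1) *(2) s(2) *(4)] homD[OF *(1)] homD[OF *(4)] by (simp add: k'_def hom_def)
  qed
  then show ?thesis by (simp add: f_def)
qed

lemma trivial_cof_lift:
  assumes "j \<in> C" "j \<in> W" "f \<in> F"
  shows "lifts_against A j f"
  using trivial_cof_sdr[OF assms(1,2)] sdr_lift[OF _ assms(3)] by blast

lemma lifts_againstE:
  assumes "lifts_against A j f" "g \<in> hom A (Dom A j) (Dom A f)" "h \<in> hom A (Cod A j) (Cod A f)"
    "f \<cdot> g = h \<cdot> j"
  obtains l where "l \<in> Arr A" "Dom A l = Cod A j" "Cod A l = Dom A f" "l \<cdot> j = g" "f \<cdot> l = h"
  using assms unfolding lifts_against_def by (auto simp: hom_def)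

text \<open>The retract argument: lifting one factor of \<open>q w\<close> against the composite, or the composite
  against a factor, exhibits \<open>q w\<close> as a retract of \<open>q\<close> or of \<open>w\<close>.\<close>

lemma retract_fib:
  assumes "w \<in> Arr A" "q \<in> Arr A" "Dom A q = Cod A w" "lifts_against A w (q \<cdot> w)"
  obtains \<rho> where "\<rho> \<in> Arr A" "Dom A \<rho> = Dom A q" "Cod A \<rho> = Dom A w" "(q \<cdot> w) \<cdot> \<rho> = q"
    "\<rho> \<cdot> w = Id A (Dom A w)"
  by (rule lifts_againstE[OF assms(4), of "Id A (Dom A w)" q])
    (use assms that in \<open>auto simp: hom_def\<close>)

lemma retract_cof:
  assumes "w \<in> Arr A" "q \<in> Arr A" "Dom A q = Cod A w" "lifts_against A (q \<cdot> w) q"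
  obtains \<sigma> where "\<sigma> \<in> Arr A" "Cod A \<sigma> = Cod A w" "Dom A \<sigma> = Cod A q" "\<sigma> \<cdot> q \<cdot> w = w"
    "q \<cdot> \<sigma> = Id A (Cod A q)"
  by (rule lifts_againstE[OF assms(4), of w "Id A (Cod A q)"])
    (use assms that in \<open>auto simp: hom_def\<close>)

section \<open>The model structure\<close>

lemma rlp_trivial_cof: "rlp A (C \<inter> W) \<subseteq> F"
proof
  fix f assume f: "f \<in> rlp A (C \<inter> W)"
  obtain w q where wq: "w \<in> C" "w \<in> W" "q \<in> F" "Dom A q = Cod A w" "q \<cdot> w = f"
    using factor_trivial_cof_fib f by (auto simp: rlp_def)
  note a = cof_arr[OF wq(1)] fib_arr[OF wq(3)]
  have "lifts_against A w (q \<cdot> w)" using f wq by (auto simp: rlp_def)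
  from retract_fib[OF a wq(4) this] show "f \<in> F"
    using fib_retract[OF wq(3) a(1)] wq by metis
qed

lemma rlp_cof: "rlp A C \<subseteq> F \<inter> W"
proof
  fix f assume f: "f \<in> rlp A C"
  then have F: "f \<in> F" using rlp_trivial_cof by (auto simp: rlp_def)
  obtain w q where wq: "w \<in> C" "q \<in> F" "q \<in> W" "Dom A q = Cod A w" "q \<cdot> w = f"
    using factor_cof_trivial_fib f by (auto simp: rlp_def)
  note a = cof_arr[OF wq(1)] fib_arr[OF wq(2)]
  have "lifts_against A w (q \<cdot> w)" using f wq by (auto simp: rlp_def)
  from retract_fib[OF a wq(4) this] show "f \<in> F \<inter> W"
    using W_retract_snd[OF wq(3) a(1)] wq F by (metis IntI)
qed

lemma llp_trivial_fib: "llp A (F \<inter> W) \<subseteq> C"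
proof
  fix f assume f: "f \<in> llp A (F \<inter> W)"
  obtain w q where wq: "w \<in> C" "q \<in> F" "q \<in> W" "Dom A q = Cod A w" "q \<cdot> w = f"
    using factor_cof_trivial_fib f by (auto simp: llp_def)
  note a = cof_arr[OF wq(1)] fib_arr[OF wq(2)]
  have "lifts_against A (q \<cdot> w) q" using f wq by (auto simp: llp_def)
  from retract_cof[OF a wq(4) this] show "f \<in> C"
    using cof_retract[OF wq(1) a(2)] wq by metis
qed

lemma llp_fib: "llp A F \<subseteq> C \<inter> W"
proof
  fix f assume f: "f \<in> llp A F"
  then have C: "f \<in> C" using llp_trivial_fib by (auto simp: llp_def)
  obtain w q where wq: "w \<in> C" "w \<in> W" "q \<in> F" "Dom A q = Cod A w" "q \<cdot> w = f"
    using factor_trivial_cof_fib f by (auto simp: llp_def)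
  note a = cof_arr[OF wq(1)] fib_arr[OF wq(3)]
  have "lifts_against A (q \<cdot> w) q" using f wq by (auto simp: llp_def)
  from retract_cof[OF a wq(4) this] show "f \<in> C \<inter> W"
    using W_retract_fst[OF wq(2) a(2)] wq C by (metis IntI)
qed

lemma W_arr: "W \<subseteq> Arr A"
  by (auto elim: W_E simp: hom_def)

theorem homotopy_model_structure: "model_structure A W F C"
  unfolding model_structure_def
proof (intro conjI)
  show "W \<subseteq> Arr A" by (rule W_arr)
  show "F \<subseteq> Arr A" using fib_arr by blast
  show "C \<subseteq> Arr A" using cof_arr by blast
  show "two_out_of_three A W" by (rule W_two_out_of_three)
  show "F = rlp A (C \<inter> W)"
    using rlp_trivial_cof trivial_cof_lift fib_arr by (auto simp: rlp_def)
  show "F \<inter> W = rlp A C"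
    using rlp_cof trivial_fib_lift fib_arr by (auto simp: rlp_def)
  show "C = llp A (F \<inter> W)"
    using llp_trivial_fib trivial_fib_lift cof_arr by (auto simp: llp_def)
  show "C \<inter> W = llp A F"
    using llp_fib trivial_cof_lift cof_arr by (auto simp: llp_def)
  show "factors_through A C (F \<inter> W)"
    unfolding factors_through_def
  proof
    fix f assume "f \<in> Arr A"
    then obtain w q where "w \<in> C" "q \<in> F" "q \<in> W" "Dom A q = Cod A w" "q \<cdot> w = f"
      by (rule factor_cof_trivial_fib)
    then show "\<exists>l\<in>C. \<exists>r\<in>F \<inter> W. Cod A l = Dom A r \<and> r \<cdot> l = f"
      by (intro bexI[of _ w] bexI[of _ q]) auto
  qed
  show "factors_through A (C \<inter> W) F"
    unfolding factors_through_def
  proof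
    fix f assume "f \<in> Arr A"
    then obtain w q where "w \<in> C" "w \<in> W" "q \<in> F" "Dom A q = Cod A w" "q \<cdot> w = f"
      by (rule factor_trivial_cof_fib)
    then show "\<exists>l\<in>C \<inter> W. \<exists>r\<in>F. Cod A l = Dom A r \<and> r \<cdot> l = f"
      by (intro bexI[of _ w] bexI[of _ q]) auto
  qed
qed

end

theorem mainTheorem1:
  fixes A :: "('o, 'm) cat"
    and Cyl S coCyl S' :: "('o, 'm) endofunc"
    and i0 i1 p v r0 r1 s \<Gamma>ul \<Gamma>lr \<Gamma>ur :: "'o \<Rightarrow> 'm"
    and e0 e1 c v' r0' r1' s' \<Gamma>ul' \<Gamma>lr' :: "'o \<Rightarrow> 'm"
    and adj :: "'o \<Rightarrow> 'o \<Rightarrow> 'm \<Rightarrow> 'm"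
  assumes "category A" and "has_finite_limits A" and "has_finite_colimits A"
    \<comment> \<open>the cylinder\<close>
    and "cylinder A Cyl i0 i1"
    and "contraction A Cyl i0 i1 p"
    and "involution A Cyl i0 i1 v" and "involution_compatible A v p"
    and "subdivision A Cyl i0 i1 S r0 r1 s" and "subdivision_compatible A S r0 r1 s p"
    and "upper_left_connection A Cyl i0 i1 p \<Gamma>ul"
    and "lower_right_connection A Cyl i0 i1 p \<Gamma>lr" and "lower_right_compatible A Cyl p \<Gamma>lr"
    and "upper_right_connection A Cyl i0 i1 p v \<Gamma>ur"
    and "connections_compatible A Cyl p S r0 r1 s \<Gamma>lr \<Gamma>ur"
    and "preserves_mapping_cylinders A Cyl i0"
    and "strict_identities A Cyl i0 i1 p S r0 r1 s"
    \<comment> \<open>the co-cylinder\<close>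
    and "cocylinder A coCyl e0 e1"
    and "contraction (opp A) coCyl e0 e1 c"
    and "involution (opp A) coCyl e0 e1 v'" and "involution_compatible (opp A) v' c"
    and "subdivision (opp A) coCyl e0 e1 S' r0' r1' s'"
    and "subdivision_compatible (opp A) S' r0' r1' s' c"
    and "upper_left_connection (opp A) coCyl e0 e1 c \<Gamma>ul'"
    and "lower_right_connection (opp A) coCyl e0 e1 c \<Gamma>lr'"
    and "lower_right_compatible (opp A) coCyl c \<Gamma>lr'"
    and "preserves_mapping_cylinders (opp A) coCyl e0"
    and "strict_identities (opp A) coCyl e0 e1 c S' r0' r1' s'"
    \<comment> \<open>the adjunction\<close>
    and "cylinder_left_adjoint A Cyl i0 i1 coCyl e0 e1 adj"
    and "adjunction_compatible A p c adj"
  shows "model_structure A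
      (cyl_homotopy_equivalences A Cyl i0 i1)
      (normally_cloven_fibrations A coCyl e0 c)
      (cofibrations A Cyl i0)
    \<and> cyl_homotopy_equivalences A Cyl i0 i1 = cocyl_homotopy_equivalences A coCyl e0 e1"
proof -
  interpret category A by fact
  interpret co: category "opp A" by (rule category_opp) fact
  interpret adjoint_cylinders A Cyl S i0 i1 p v r0 r1 s \<Gamma>ul \<Gamma>lr
    coCyl S' e0 e1 c v' r0' r1' s' \<Gamma>ul' \<Gamma>lr' adj
    by unfold_locales (use assms has_finite_limits_opp[OF assms(3)] cylinder_opp[of A coCyl e0 e1] in auto)
  show ?thesis using homotopy_model_structure W_eq_cocyl by blast
qed

end
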